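(* Assume that $f$ is twice continuously differentiable on $\mathcal S_d$. Then, as $n\to\infty$, $$\mathrm{MISE}[\hat f_{n,b}]:=\int_{\mathcal S_d}\mathbb E\bigl[|\hat f_{n,b}(s)-f(s)|^2\bigr]ds=n^{-1}b^{-d/2}\int_{\mathcal S_d}\psi(s)f(s)\,ds+b^2\int_{\mathcal S_d}g^2(s)\,ds+o(n^{-1}b^{-d/2})+o(b^2).$$ In particular, if $\int_{\mathcal S_d}g^2(s)\,ds>0$, the asymptotically optimal choice of $b$ with respect to $\mathrm{MISE}$ is $$b_{\mathrm{opt}}=n^{-2/(d+4)}\left[\frac d4\cdot\frac{\int_{\mathcal S_d}\psi(s)f(s)\,ds}{\int_{\mathcal S_d}g^2(s)\,ds}\right]^{2/(d+4)},$$ with $$\mathrm{MISE}[\hat f_{n,b_{\mathrm{opt}}}]=n^{-4/(d+4)}\left[\frac{1+\frac d4}{(\frac d4)^{d/(d+4)}}\right]\frac{\bigl(\int_{\mathcal S_d}\psi(s)f(s)\,ds\bigr)^{4/(d+4)}}{\bigl(\int_{\mathcal S_d}g^2(s)\,ds\bigr)^{-d/(d+4)}}+o(n^{-4/(d+4)}).$$ More generally, if $n^{2/(d+4)}b\to\lambda$ for some $\lambda>0$ as $n\to\infty$, then $$\mathrm{MISE}[\hat f_{n,b}]=n^{-4/(d+4)}\left[\lambda^{-d/2}\int_{\mathcal S_d}\psi(s)f(s)\,ds+\lambda^2\int_{\mathcal S_d}g^2(s)\,ds\right]+o(n^{-4/(d+4)}).$$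
   Context: Let $d\in\mathbb N$, $[d]=\{1,\dots,d\}$, $\|s\|_1=\sum_{i=1}^d|s_i|$, $\mathcal S_d=\{s\in[0,1]^d:\|s\|_1\le1\}$. For $\alpha\in(0,\infty)^d$ and $\beta>0$, the Dirichlet$(\alpha,\beta)$ density on $\mathcal S_d$ is $$K_{\alpha,\beta}(s)=\frac{\Gamma(\|\alpha\|_1+\beta)}{\Gamma(\beta)\prod_{i=1}^d\Gamma(\alpha_i)}(1-\|s\|_1)^{\beta-1}\prod_{i=1}^ds_i^{\alpha_i-1}.$$ Let $X_1,X_2,\dots$ be i.i.d. random vectors with a density $f$ supported on $\mathcal S_d$. The bandwidth $b=b(n)>0$ is a function of $n$ with $b\to0$ as $n\to\infty$. The Dirichlet kernel estimator is $$\hat f_{n,b}(s)=\frac1n\sum_{i=1}^nK_{s/b+1,\,(1-\|s\|_1)/b+1}(X_i),\qquad s\in\mathcal S_d,$$ where $s/b+1=(s_1/b+1,\dots,s_d/b+1)$. Put $$\psi(s)=\Bigl[(4\pi)^d(1-\|s\|_1)\prod_{i\in[d]}s_i\Bigr]^{-1/2},$$ $$g(s)=\sum_{i\in[d]}(1-(d+1)s_i)\frac{\partial}{\partial s_i}f(s)+\frac12\sum_{i,j\in[d]}s_i(\mathbf 1_{\{i=j\}}-s_j)\frac{\partial^2}{\partial s_i\partial s_j}f(s).$$ "Asymptotically optimal choice of $b$" means the minimizer over $b>0$ of the leading part $n^{-1}b^{-d/2}\int_{\mathcal S_d}\psi f\,ds+b^2\int_{\mathcal S_d}g^2\,ds$.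 Notation: $u=o(v)$ means $u/v\to0$. *)

theory Defs
  imports "HOL-Probability.Probability" "HOL-Library.Landau_Symbols"
begin

definition l1_norm :: "real ^ 'd \<Rightarrow> real" where
  "l1_norm s = (\<Sum>i\<in>UNIV. \<bar>s $ i\<bar>)"

definition simplex_set :: "(real ^ 'd) set" where
  "simplex_set = {s. (\<forall>i. 0 \<le> s $ i \<and> s $ i \<le> 1) \<and> l1_norm s \<le> 1}"

(* The density is extended by 0 outside the simplex.  Because 0 powr x = 0 for every x, the
   values on the boundary of the simplex, a Lebesgue null set, can differ from the usual
   conventions (e.g. when an exponent is 0). *)
definition dirichlet_density :: "real ^ 'd \<Rightarrow> real \<Rightarrow> real ^ 'd \<Rightarrow> real" where
  "dirichlet_density \<alpha> \<beta> s =
     (if s \<in> simplex_set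
      then Gamma (l1_norm \<alpha> + \<beta>) / (Gamma \<beta> * (\<Prod>i\<in>UNIV. Gamma (\<alpha> $ i)))
             * (1 - l1_norm s) powr (\<beta> - 1) * (\<Prod>i\<in>UNIV. (s $ i) powr (\<alpha> $ i - 1))
      else 0)"

(* The sample is X 1, X 2, ...; the value X 0 is not used. *)
definition dirichlet_estimator ::
    "(nat \<Rightarrow> 'a \<Rightarrow> real ^ 'd) \<Rightarrow> nat \<Rightarrow> real \<Rightarrow> real ^ 'd \<Rightarrow> 'a \<Rightarrow> real" where
  "dirichlet_estimator X n b s \<omega> =
     1 / real n *
       (\<Sum>i=1..n. dirichlet_density (\<chi> j. s $ j / b + 1) ((1 - l1_norm s) / b + 1) (X i \<omega>))"

definition MISE ::
    "'a measure \<Rightarrow> (nat \<Rightarrow> 'a \<Rightarrow> real ^ 'd) \<Rightarrow> (real ^ 'd \<Rightarrow> real) \<Rightarrow> nat \<Rightarrow> real \<Rightarrow> real" where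
  "MISE M X f n b =
     (LINT s:simplex_set|lborel.
        prob_space.expectation M (\<lambda>\<omega>. \<bar>dirichlet_estimator X n b s \<omega> - f s\<bar>\<^sup>2))"

(* Partial derivative relative to the simplex.  The simplex is convex with nonempty interior, so a
   derivative within it is unique, also at boundary points; at interior points this is the ordinary
   partial derivative.  A density supported on the simplex may jump to 0 across the boundary, so
   derivatives in the whole space would be too restrictive. *)
definition partial_deriv :: "'d \<Rightarrow> (real ^ 'd \<Rightarrow> real) \<Rightarrow> real ^ 'd \<Rightarrow> real" where
  "partial_deriv i f s = frechet_derivative f (at s within simplex_set) (axis i 1)"

definition twice_cont_diff_on_simplex :: "(real ^ 'd \<Rightarrow> real) \<Rightarrow> bool" where
  "twice_cont_diff_on_simplex f \<longleftrightarrow>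
     f differentiable_on simplex_set \<and>
     (\<forall>i. partial_deriv i f differentiable_on simplex_set) \<and>
     (\<forall>i j. continuous_on simplex_set (partial_deriv i (partial_deriv j f)))"

definition psi :: "real ^ 'd \<Rightarrow> real" where
  "psi s = ((4 * pi) ^ CARD('d) * (1 - l1_norm s) * (\<Prod>i\<in>UNIV. s $ i)) powr (- 1 / 2)"

definition g_fun :: "(real ^ 'd \<Rightarrow> real) \<Rightarrow> real ^ 'd \<Rightarrow> real" where
  "g_fun f s =
     (\<Sum>i\<in>UNIV. (1 - (real CARD('d) + 1) * s $ i) * partial_deriv i f s)
     + 1 / 2 * (\<Sum>i\<in>UNIV. \<Sum>j\<in>UNIV.
         s $ i * ((if i = j then 1 else 0) - s $ j) * partial_deriv i (partial_deriv j f) s)"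

definition int_psi_f :: "(real ^ 'd \<Rightarrow> real) \<Rightarrow> real" where
  "int_psi_f f = (LINT s:simplex_set|lborel. psi s * f s)"

definition int_g_sq :: "(real ^ 'd \<Rightarrow> real) \<Rightarrow> real" where
  "int_g_sq f = (LINT s:simplex_set|lborel. (g_fun f s)\<^sup>2)"

definition leading_MISE :: "(real ^ 'd \<Rightarrow> real) \<Rightarrow> nat \<Rightarrow> real \<Rightarrow> real" where
  "leading_MISE f n b =
     (real n) powr (-1) * b powr (- real CARD('d) / 2) * int_psi_f f + b\<^sup>2 * int_g_sq f"

definition b_opt :: "(real ^ 'd \<Rightarrow> real) \<Rightarrow> nat \<Rightarrow> real" where
  "b_opt f n =
     real n powr (- 2 / (real CARD('d) + 4))
       * (real CARD('d) / 4 * (int_psi_f f / int_g_sq f)) powr (2 / (real CARD('d) + 4))"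

end

theory Submission
  imports Defs
begin

text \<open>
  At a fixed point \<open>s\<close> the estimator is the mean of \<open>n\<close> independent copies of \<open>K (X)\<close>, where \<open>K\<close> is the
  Dirichlet density attached to \<open>s\<close> and \<open>b\<close>. Its mean squared error is therefore variance plus
  squared bias, and both are governed by one positive operator: let \<open>T\<^sub>b h (s)\<close> be the expectation of
  \<open>h (\<xi>)\<close> for a random vector \<open>\<xi>\<close> with density \<open>K\<close>.

  Bias. The mean of the estimator is \<open>T\<^sub>b f (s)\<close>. The moments of Dirichlet laws are explicit, and they
  show that \<open>\<xi> - s\<close> has mean \<open>b (1 - (d + 1) s\<^sub>i) + O(b\<^sup>2)\<close>, second moments
  \<open>b s\<^sub>i (\<delta>\<^sub>i\<^sub>j - s\<^sub>j) + O(b\<^sup>2)\<close> and fourth moments \<open>O(b\<^sup>2)\<close>, all uniformly in \<open>s\<close>. Inserted into the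
  second order Taylor expansion of \<open>f\<close> this gives \<open>T\<^sub>b f - f = b g + o(b)\<close> uniformly on the simplex
  (\<open>smooth_bias_uniform\<close>), so the integral of the squared bias is \<open>b\<^sup>2\<close> times that of \<open>g\<^sup>2\<close>, up to
  \<open>o(b\<^sup>2)\<close>.

  Variance. Squaring the kernel doubles its exponents, which halves the bandwidth: \<open>K\<^sup>2\<close> is a factor
  \<open>A\<^sub>b (s)\<close> times the kernel of bandwidth \<open>b / 2\<close> (\<open>dirichlet_kernel_square\<close>). Hence the second
  moment is \<open>A\<^sub>b (s) * T\<^bsub>b/2\<^esub> f (s)\<close>. By the duplication formula \<open>A\<^sub>b\<close> is a product of ratios
  \<open>Gamma (y + 1 / 2) / Gamma (y + 1)\<close>, which log-convexity of Gamma encloses between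
  \<open>(y + 1 / 2) powr (- 1 / 2)\<close> and \<open>y powr (- 1 / 2)\<close>. So \<open>b powr (d / 2) * A\<^sub>b\<close> converges to \<open>\<psi>\<close> in the
  interior (\<open>kernel_sq_factor_tendsto\<close>) and is at most a constant times \<open>\<psi>\<close> (\<open>kernel_sq_factor_le\<close>);
  since \<open>\<psi>\<close> is integrable, dominated convergence yields the leading term.

  The identity \<open>MISE_decomposition\<close> combines the two parts and gives the expansion for every
  bandwidth sequence tending to 0. The statement for \<open>n powr (2 / (d + 4)) * b \<longlongrightarrow> l\<close> is a rescaling of
  it, and the one for the optimal bandwidth is the special case in which this product is constant.
  That the optimal bandwidth is the only minimiser follows from \<open>1 + y < exp y\<close>
  (\<open>power_sum_unique_min\<close>).
\<close>

section \<open>The simplex\<close>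

lemma simplex_set_iff: "s \<in> simplex_set \<longleftrightarrow> (\<forall>i. 0 \<le> s $ i) \<and> (\<Sum>i\<in>UNIV. s $ i) \<le> 1"
proof
  assume "s \<in> simplex_set"
  then show "(\<forall>i. 0 \<le> s $ i) \<and> (\<Sum>i\<in>UNIV. s $ i) \<le> 1"
    by (auto simp: simplex_set_def l1_norm_def)
next
  assume s: "(\<forall>i. 0 \<le> s $ i) \<and> (\<Sum>i\<in>UNIV. s $ i) \<le> 1"
  have "s $ i \<le> 1" for i
    using s member_le_sum[of i UNIV "\<lambda>i. s $ i"] by force
  with s show "s \<in> simplex_set"
    by (auto simp: simplex_set_def l1_norm_def)
qed

lemma l1_norm_nonneg_eq: "(\<And>i. 0 \<le> s $ i) \<Longrightarrow> l1_norm s = (\<Sum>i\<in>UNIV. s $ i)"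
  by (simp add: l1_norm_def)

lemma l1_norm_simplex: "s \<in> simplex_set \<Longrightarrow> l1_norm s = (\<Sum>i\<in>UNIV. s $ i)"
  by (simp add: simplex_set_iff l1_norm_nonneg_eq)

lemma simplex_nth:
  assumes "s \<in> simplex_set"
  shows "0 \<le> s $ i" "s $ i \<le> 1" "l1_norm s \<le> 1" "0 \<le> l1_norm s"
  using assms by (auto simp: simplex_set_def l1_norm_def sum_nonneg)

lemma continuous_on_l1_norm [continuous_intros]:
  "continuous_on A f \<Longrightarrow> continuous_on A (\<lambda>x. l1_norm (f x))"
  unfolding l1_norm_def by (intro continuous_intros)

lemma borel_measurable_l1_norm [measurable]: "l1_norm \<in> borel_measurable borel"
  by (intro borel_measurable_continuous_onI continuous_intros)

lemma closed_simplex_set: "closed (simplex_set :: (real ^ 'd) set)"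
proof -
  have "simplex_set = (\<Inter>i. {s::real^'d. 0 \<le> s $ i}) \<inter> {s. (\<Sum>i\<in>UNIV. s $ i) \<le> 1}"
    by (auto simp: simplex_set_iff)
  also have "closed \<dots>"
    by (intro closed_Int closed_INT ballI closed_Collect_le continuous_intros)
  finally show ?thesis .
qed

lemma compact_simplex_set: "compact (simplex_set :: (real ^ 'd) set)"
proof -
  have "simplex_set \<subseteq> cbox (0::real^'d) (\<chi> i. 1)"
    by (auto simp: simplex_set_def mem_box_cart)
  then show ?thesis
    using bounded_subset[OF bounded_cbox] closed_simplex_set compact_eq_bounded_closed by blast
qed

lemma convex_simplex_set: "convex (simplex_set :: (real ^ 'd) set)"
proof (rule convexI)
  fix x y :: "real^'d" and u v :: real
  assume xy: "x \<in> simplex_set" "y \<in> simplex_set" and uv: "0 \<le> u" "0 \<le> v" "u + v = 1"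
  have "(\<Sum>i\<in>UNIV. (u *\<^sub>R x + v *\<^sub>R y) $ i) = u * (\<Sum>i\<in>UNIV. x $ i) + v * (\<Sum>i\<in>UNIV. y $ i)"
    by (simp add: sum.distrib sum_distrib_left)
  also have "\<dots> \<le> u * 1 + v * 1"
    using xy uv by (intro add_mono mult_left_mono) (auto simp: simplex_set_iff)
  finally show "u *\<^sub>R x + v *\<^sub>R y \<in> simplex_set"
    using xy uv by (auto simp: simplex_set_iff)
qed

lemma simplex_set_borel [measurable]: "(simplex_set :: (real ^ 'd) set) \<in> sets borel"
  using closed_simplex_set by (rule borel_closed)

text \<open>
  The faces of the simplex lie in hyperplanes, so they are null sets. This makes the convention
  \<open>0 powr x = 0\<close> on the boundary harmless for all integrals below.
\<close>

lemma AE_simplex_interior: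
  "AE s in (lborel :: (real ^ 'd) measure). s \<in> simplex_set \<longrightarrow> (\<forall>i. 0 < s $ i) \<and> l1_norm s < 1"
proof -
  have hyp: "AE s in (lborel :: (real ^ 'd) measure). a \<bullet> s \<noteq> c" if "a \<noteq> 0 \<or> c \<noteq> 0" for a c
  proof -
    have "{s. a \<bullet> s = c} \<in> null_sets (lborel :: (real ^ 'd) measure)"
      using negligible_hyperplane[OF that] closed_hyperplane[of a c]
      by (intro null_setsI)
         (auto simp: negligible_iff_null_sets null_sets_completion_iff dest!: null_setsD1 borel_closed)
    from AE_not_in[OF this] show ?thesis by simp
  qed
  have "AE s in (lborel :: (real ^ 'd) measure). \<forall>i\<in>UNIV. s $ i \<noteq> 0"
    using hyp[of "axis i 1" 0 for i] by (intro AE_finite_allI) (auto simp: inner_axis' axis_eq_0_iff)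
  moreover have "AE s in (lborel :: (real ^ 'd) measure). (\<Sum>i\<in>UNIV. s $ i) \<noteq> 1"
    using hyp[of "\<chi> i. 1" 1] by (simp add: inner_vec_def)
  ultimately show ?thesis
    by eventually_elim (auto simp: simplex_set_iff l1_norm_nonneg_eq order_less_le)
qed

section \<open>The Dirichlet integral\<close>

lemma nn_integral_prod_vec:
  fixes h :: "'d::finite \<Rightarrow> real \<Rightarrow> ennreal"
  assumes [measurable]: "\<And>i. h i \<in> borel_measurable borel"
  shows "(\<integral>\<^sup>+x. (\<Prod>i\<in>UNIV. h i ((x::real^'d) $ i)) \<partial>lborel) = (\<Prod>i\<in>UNIV. \<integral>\<^sup>+t. h i t \<partial>lborel)"
proof -
  have inj: "inj (\<lambda>i::'d. axis i (1::real))"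
    by (auto simp: inj_on_def axis_eq_axis)
  define J where "J = the_inv (\<lambda>i::'d. axis i (1::real))"
  have J: "J (axis i 1) = i" for i
    unfolding J_def by (rule the_inv_f_f[OF inj])
  have B: "Basis = range (\<lambda>i::'d. axis i (1::real))"
    by (auto simp: Basis_vec_def)
  have "(\<integral>\<^sup>+x. (\<Prod>b\<in>Basis. h (J b) ((x::real^'d) \<bullet> b)) \<partial>lborel) = (\<Prod>b\<in>Basis. \<integral>\<^sup>+t. h (J b) t \<partial>lborel)"
    by (intro nn_integral_lborel_prod) auto
  then show ?thesis
    unfolding B by (simp add: prod.reindex[OF inj] J inner_axis)
qed

lemma nn_integral_lborel_scale:
  fixes h :: "real ^ 'd \<Rightarrow> ennreal"
  assumes [measurable]: "h \<in> borel_measurable borel" and t: "t > 0"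
  shows "(\<integral>\<^sup>+x. h x \<partial>lborel) = ennreal (t ^ CARD('d)) * (\<integral>\<^sup>+x. h (t *\<^sub>R x) \<partial>lborel)"
proof -
  have "(\<integral>\<^sup>+x. h x \<partial>lborel)
      = (\<integral>\<^sup>+x. h x \<partial>density (distr lborel borel (\<lambda>x. 0 + t *\<^sub>R x)) (\<lambda>_. \<bar>t\<bar>^DIM(real^'d)))"
    using lborel_affine[of t "0::real^'d"] t by simp
  also have "\<dots> = ennreal (t ^ CARD('d)) * (\<integral>\<^sup>+x. h (t *\<^sub>R x) \<partial>lborel)"
    using t by (simp add: nn_integral_density nn_integral_distr nn_integral_cmult)
  finally show ?thesis .
qed

definition dirichlet_weight :: "real ^ 'd \<Rightarrow> real \<Rightarrow> real ^ 'd \<Rightarrow> real" where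
  "dirichlet_weight \<alpha> \<beta> x =
     indicator simplex_set x * (1 - l1_norm x) powr (\<beta> - 1) * (\<Prod>i\<in>UNIV. x $ i powr (\<alpha> $ i - 1))"

lemma borel_measurable_dirichlet_weight [measurable]:
  "dirichlet_weight \<alpha> \<beta> \<in> borel_measurable borel"
  unfolding dirichlet_weight_def by measurable

lemma dirichlet_weight_nonneg: "dirichlet_weight \<alpha> \<beta> x \<ge> 0"
  unfolding dirichlet_weight_def by (intro mult_nonneg_nonneg prod_nonneg) auto

text \<open>
  The double integral of \<open>\<Prod> y\<^sub>i powr (\<alpha>\<^sub>i - 1) * (t - \<Sum> y\<^sub>i) powr (\<beta> - 1) * exp (- t)\<close> over
  \<open>0 \<le> y\<close>, \<open>\<Sum> y\<^sub>i \<le> t\<close> is computed in two ways. Integrating over \<open>t\<close> first, the shift \<open>t \<mapsto> t + \<Sum> y\<^sub>i\<close> turns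
  it into a product of one-dimensional Gamma integrals. Integrating over \<open>y\<close> first, the dilation
  \<open>y = t x\<close> extracts the Dirichlet integral and leaves the Gamma integral of \<open>l1_norm \<alpha> + \<beta>\<close>.
  Treating all coordinates at once avoids an induction on the dimension, which is a type here.
\<close>

lemma nn_integral_dirichlet_weight:
  fixes \<alpha> :: "real ^ 'd"
  assumes \<alpha>: "\<And>i. 0 < \<alpha> $ i" and \<beta>: "0 < \<beta>"
  shows "(\<integral>\<^sup>+x. ennreal (dirichlet_weight \<alpha> \<beta> x) \<partial>lborel)
    = ennreal (Gamma \<beta> * (\<Prod>i\<in>UNIV. Gamma (\<alpha> $ i)) / Gamma (l1_norm \<alpha> + \<beta>))"
proof -
  define I where "I = (\<integral>\<^sup>+x. ennreal (dirichlet_weight \<alpha> \<beta> x) \<partial>lborel)"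
  define \<sigma> where "\<sigma> = (\<lambda>y::real^'d. \<Sum>i\<in>UNIV. y $ i)"
  have [measurable]: "\<sigma> \<in> borel_measurable borel" unfolding \<sigma>_def by measurable
  define P where "P = {y::real^'d. \<forall>i. 0 \<le> y $ i}"
  have [measurable]: "P \<in> sets borel"
    unfolding P_def by measurable
  define F where "F = (\<lambda>(t::real) (y::real^'d). indicator P y * indicator {\<sigma> y..} t * (t - \<sigma> y) powr (\<beta> - 1)
       * (\<Prod>i\<in>UNIV. y $ i powr (\<alpha> $ i - 1)) * exp (- t))"
  have [measurable]: "case_prod F \<in> borel_measurable (borel \<Otimes>\<^sub>M borel)"
    unfolding F_def indicator_def case_prod_unfold atLeast_iff by measurable
  have F0: "F t y \<ge> 0" for t y
    unfolding F_def by (intro mult_nonneg_nonneg prod_nonneg) auto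
  have l1: "l1_norm \<alpha> = (\<Sum>i\<in>UNIV. \<alpha> $ i)"
    using \<alpha> by (intro l1_norm_nonneg_eq) (simp add: less_imp_le)
  have l1p: "l1_norm \<alpha> > 0"
    unfolding l1 using \<alpha> by (intro sum_pos) auto
  have gam: "ennreal (Gamma s) = (\<integral>\<^sup>+t. ennreal (indicator {0..} t * t powr (s - 1) * exp (- t)) \<partial>lborel)"
    if "s > 0" for s :: real
    using Gamma_conv_nn_integral_real[OF that] by (simp add: exp_minus divide_inverse)
  have in1: "(\<integral>\<^sup>+t. ennreal (F t y) \<partial>lborel)
     = ennreal (Gamma \<beta>) * (\<Prod>i\<in>UNIV. ennreal (indicator {0..} (y $ i) * y $ i powr (\<alpha> $ i - 1) * exp (- (y $ i))))" for y
  proof (cases "y \<in> P")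
    case True
    then have y: "\<And>i. 0 \<le> y $ i" by (simp add: P_def)
    let ?c = "(\<Prod>i\<in>UNIV. y $ i powr (\<alpha> $ i - 1))"
    have c: "?c \<ge> 0" by (intro prod_nonneg) auto
    have "(\<integral>\<^sup>+t. ennreal (F t y) \<partial>lborel) = (\<integral>\<^sup>+t. ennreal (F (\<sigma> y + t) y) \<partial>lborel)"
      using nn_integral_real_affine[of "\<lambda>t. ennreal (F t y)" 1 "\<sigma> y"] by simp
    also have "\<dots> = (\<integral>\<^sup>+t. ennreal (?c * exp (- \<sigma> y)) * ennreal (indicator {0..} t * t powr (\<beta> - 1) * exp (- t)) \<partial>lborel)"
      using True c by (intro nn_integral_cong)
        (auto simp: F_def indicator_def exp_add exp_minus divide_inverse exp_diff ennreal_mult' [symmetric] mult_ac)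
    also have "\<dots> = ennreal (?c * exp (- \<sigma> y)) * ennreal (Gamma \<beta>)"
      by (subst nn_integral_cmult) (auto simp: gam[OF \<beta>])
    also have "?c * exp (- \<sigma> y) = (\<Prod>i\<in>UNIV. indicator {0..} (y $ i) * y $ i powr (\<alpha> $ i - 1) * exp (- (y $ i)))"
      using y by (simp add: \<sigma>_def sum_negf[symmetric] exp_sum prod.distrib)
    finally show ?thesis
      by (simp add: prod_ennreal mult.commute)
  next
    case False
    then obtain i where i: "y $ i < 0" by (auto simp: P_def not_le)
    have "(\<Prod>i\<in>UNIV. ennreal (indicator {0..} (y $ i) * y $ i powr (\<alpha> $ i - 1) * exp (- (y $ i)))) = 0"
      using i by (intro prod_zero) (auto intro!: exI[of _ i])
    then show ?thesis using False by (simp add: F_def)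
  qed
  have J1: "(\<integral>\<^sup>+y. \<integral>\<^sup>+t. ennreal (F t y) \<partial>lborel \<partial>lborel) = ennreal (Gamma \<beta> * (\<Prod>i\<in>UNIV. Gamma (\<alpha> $ i)))"
  proof -
    have "(\<integral>\<^sup>+y. \<integral>\<^sup>+t. ennreal (F t y) \<partial>lborel \<partial>lborel)
      = ennreal (Gamma \<beta>) * (\<Prod>i\<in>UNIV. \<integral>\<^sup>+t. ennreal (indicator {0..} t * t powr (\<alpha> $ i - 1) * exp (- t)) \<partial>lborel)"
      unfolding in1
      by (subst nn_integral_cmult) (auto simp: nn_integral_prod_vec[symmetric])
    also have "\<dots> = ennreal (Gamma \<beta>) * (\<Prod>i\<in>UNIV. ennreal (Gamma (\<alpha> $ i)))"
      using \<alpha> by (simp add: gam)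
    also have "\<dots> = ennreal (Gamma \<beta> * (\<Prod>i\<in>UNIV. Gamma (\<alpha> $ i)))"
      using \<alpha> \<beta> by (simp add: prod_ennreal ennreal_mult' less_imp_le Gamma_real_pos prod_nonneg)
    finally show ?thesis .
  qed
  have in2: "(\<integral>\<^sup>+y. ennreal (F t y) \<partial>lborel)
      = ennreal (indicator {0..} t * t powr (l1_norm \<alpha> + \<beta> - 1) * exp (- t)) * I" if t: "t \<noteq> 0" for t
  proof (cases "t > 0")
    case True
    have sc: "F t (t *\<^sub>R x) = t powr (l1_norm \<alpha> + \<beta> - 1) / t ^ CARD('d) * exp (- t) * dirichlet_weight \<alpha> \<beta> x" for x
    proof (cases "x \<in> simplex_set")
      case xs: True
      then have x: "\<And>i. 0 \<le> x $ i" "(\<Sum>i\<in>UNIV. x $ i) \<le> 1"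
        by (auto simp: simplex_set_iff)
      have \<sigma>t: "\<sigma> (t *\<^sub>R x) = t * l1_norm x"
        using x by (simp add: \<sigma>_def l1_norm_nonneg_eq sum_distrib_left)
      have le: "t * l1_norm x \<le> t"
        using True x by (simp add: l1_norm_nonneg_eq mult_left_le)
      have a: "(t - t * l1_norm x) powr (\<beta> - 1) = t powr (\<beta> - 1) * (1 - l1_norm x) powr (\<beta> - 1)"
        using True x by (subst powr_mult[symmetric]) (auto simp: algebra_simps l1_norm_nonneg_eq)
      have b: "(\<Prod>i\<in>UNIV. (t *\<^sub>R x) $ i powr (\<alpha> $ i - 1)) = t powr (l1_norm \<alpha> - CARD('d)) * (\<Prod>i\<in>UNIV. x $ i powr (\<alpha> $ i - 1))"
        using True x by (simp add: powr_mult prod.distrib powr_sum[symmetric] sum_subtractf l1)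
      have c: "t powr (\<beta> - 1) * t powr (l1_norm \<alpha> - CARD('d)) = t powr (l1_norm \<alpha> + \<beta> - 1) / t ^ CARD('d)"
        using True by (simp add: powr_add[symmetric] powr_diff[symmetric] powr_realpow[symmetric] algebra_simps)
      show ?thesis
        unfolding F_def dirichlet_weight_def \<sigma>t a b using x True le xs
        by (simp add: c[symmetric] P_def)
    next
      case False
      then consider i where "x $ i < 0" | "\<not> (\<Sum>i\<in>UNIV. x $ i) \<le> 1"
        by (auto simp: simplex_set_iff not_le)
      then have "t *\<^sub>R x \<notin> P \<or> \<not> \<sigma> (t *\<^sub>R x) \<le> t"
      proof cases
        case 1
        then have "t * x $ i < 0" using True by (simp add: mult_pos_neg)
        then show ?thesis by (auto simp: P_def not_le intro!: exI[of _ i])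
      next
        case 2
        then have "\<sigma> (t *\<^sub>R x) = t * (\<Sum>i\<in>UNIV. x $ i)" by (simp add: \<sigma>_def sum_distrib_left)
        with 2 True show ?thesis by (auto simp: not_le)
      qed
      then show ?thesis using False by (auto simp: F_def dirichlet_weight_def)
    qed
    have "(\<integral>\<^sup>+y. ennreal (F t y) \<partial>lborel) = ennreal (t ^ CARD('d)) * (\<integral>\<^sup>+x. ennreal (F t (t *\<^sub>R x)) \<partial>lborel)"
      using True by (intro nn_integral_lborel_scale) auto
    also have "(\<integral>\<^sup>+x. ennreal (F t (t *\<^sub>R x)) \<partial>lborel)
        = ennreal (t powr (l1_norm \<alpha> + \<beta> - 1) / t ^ CARD('d) * exp (- t)) * I"
      unfolding sc I_def using True
      by (subst nn_integral_cmult[symmetric]) (auto simp: ennreal_mult''[symmetric] dirichlet_weight_nonneg)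
    finally show ?thesis
      using True by (simp add: mult.assoc[symmetric] ennreal_mult'[symmetric])
  next
    case False
    then have "F t y = 0" for y
      using t sum_nonneg[of UNIV "\<lambda>i. y $ i"] by (auto simp: F_def P_def \<sigma>_def indicator_def)
    then show ?thesis using False t by simp
  qed
  have J2: "(\<integral>\<^sup>+t. \<integral>\<^sup>+y. ennreal (F t y) \<partial>lborel \<partial>lborel) = ennreal (Gamma (l1_norm \<alpha> + \<beta>)) * I"
  proof -
    have "(\<integral>\<^sup>+t. \<integral>\<^sup>+y. ennreal (F t y) \<partial>lborel \<partial>lborel)
      = (\<integral>\<^sup>+t. ennreal (indicator {0..} t * t powr (l1_norm \<alpha> + \<beta> - 1) * exp (- t)) * I \<partial>lborel)"
      using AE_lborel_singleton[of "0::real"] by (intro nn_integral_cong_AE) (auto simp: in2)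
    also have "\<dots> = ennreal (Gamma (l1_norm \<alpha> + \<beta>)) * I"
      using l1p \<beta> by (subst nn_integral_multc) (auto simp: gam)
    finally show ?thesis .
  qed
  have "(\<integral>\<^sup>+t. \<integral>\<^sup>+y. ennreal (F t y) \<partial>lborel \<partial>lborel) = (\<integral>\<^sup>+y. \<integral>\<^sup>+t. ennreal (F t y) \<partial>lborel \<partial>lborel)"
    by (rule lborel_pair.Fubini') measurable
  then have eq: "ennreal (Gamma (l1_norm \<alpha> + \<beta>)) * I = ennreal (Gamma \<beta> * (\<Prod>i\<in>UNIV. Gamma (\<alpha> $ i)))"
    unfolding J1 J2 by simp
  have g: "Gamma (l1_norm \<alpha> + \<beta>) > 0" using l1p \<beta> by (intro Gamma_real_pos) auto
  have "I = ennreal (inverse (Gamma (l1_norm \<alpha> + \<beta>))) * (ennreal (Gamma (l1_norm \<alpha> + \<beta>)) * I)"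
    using g by (simp add: mult.assoc[symmetric] ennreal_mult'[symmetric])
  also have "\<dots> = ennreal (Gamma \<beta> * (\<Prod>i\<in>UNIV. Gamma (\<alpha> $ i)) / Gamma (l1_norm \<alpha> + \<beta>))"
    unfolding eq using g by (subst ennreal_mult'[symmetric]) (auto simp: field_simps)
  finally show ?thesis unfolding I_def .
qed

section \<open>Dirichlet moments\<close>

text \<open>
  Measurability is immediate from the reciprocal Gamma function, which has no poles.
\<close>

lemma borel_measurable_Gamma [measurable]: "(Gamma :: real \<Rightarrow> real) \<in> borel_measurable borel"
proof -
  have "(\<lambda>x::real. inverse (rGamma x)) \<in> borel_measurable borel"
    by (intro borel_measurable_inverse borel_measurable_continuous_onI continuous_on_rGamma)
  then show ?thesis by (simp add: rGamma_inverse_Gamma)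
qed

lemma l1_norm_pos: "(\<And>i. 0 < \<alpha> $ i) \<Longrightarrow> 0 < l1_norm \<alpha>"
  by (subst l1_norm_nonneg_eq) (auto intro!: sum_pos less_imp_le)

lemma dirichlet_density_eq_weight:
  "dirichlet_density \<alpha> \<beta> x =
     Gamma (l1_norm \<alpha> + \<beta>) / (Gamma \<beta> * (\<Prod>i\<in>UNIV. Gamma (\<alpha> $ i))) * dirichlet_weight \<alpha> \<beta> x"
  by (simp add: dirichlet_density_def dirichlet_weight_def)

lemma borel_measurable_dirichlet_density [measurable]:
  "dirichlet_density \<alpha> \<beta> \<in> borel_measurable borel"
  unfolding dirichlet_density_eq_weight[abs_def] by measurable

context
  fixes \<alpha> :: "real ^ 'd" and \<beta> :: real
  assumes \<alpha>: "\<And>i. 0 < \<alpha> $ i" and \<beta>: "0 < \<beta>"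
begin

lemma dirichlet_constant_pos:
  "Gamma (l1_norm \<alpha> + \<beta>) / (Gamma \<beta> * (\<Prod>i\<in>UNIV. Gamma (\<alpha> $ i))) > 0"
  using l1_norm_pos[of \<alpha>] \<alpha> \<beta>
  by (intro divide_pos_pos mult_pos_pos prod_pos Gamma_real_pos add_pos_pos) auto

lemma dirichlet_density_nonneg: "0 \<le> dirichlet_density \<alpha> \<beta> x"
  unfolding dirichlet_density_eq_weight
  using dirichlet_constant_pos by (intro mult_nonneg_nonneg dirichlet_weight_nonneg) auto

lemma integrable_dirichlet_weight: "integrable lborel (dirichlet_weight \<alpha> \<beta>)"
  using nn_integral_dirichlet_weight[of \<alpha> \<beta>] \<alpha> \<beta>
  by (intro integrableI_nonneg) (auto simp: dirichlet_weight_nonneg)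

lemma integrable_dirichlet_density: "integrable lborel (dirichlet_density \<alpha> \<beta>)"
  unfolding dirichlet_density_eq_weight[abs_def]
  by (intro integrable_mult_right integrable_dirichlet_weight)

lemma integral_dirichlet_density: "(\<integral>x. dirichlet_density \<alpha> \<beta> x \<partial>lborel) = 1"
proof -
  let ?c = "Gamma (l1_norm \<alpha> + \<beta>) / (Gamma \<beta> * (\<Prod>i\<in>UNIV. Gamma (\<alpha> $ i)))"
  have "0 < Gamma \<beta> * (\<Prod>i\<in>UNIV. Gamma (\<alpha> $ i)) / Gamma (l1_norm \<alpha> + \<beta>)"
    using l1_norm_pos[of \<alpha>] \<alpha> \<beta>
    by (intro divide_pos_pos mult_pos_pos prod_pos Gamma_real_pos add_pos_pos) auto
  then have "(\<integral>x. dirichlet_weight \<alpha> \<beta> x \<partial>lborel) = 1 / ?c"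
    using nn_integral_dirichlet_weight[of \<alpha> \<beta>] \<alpha> \<beta> dirichlet_constant_pos
    by (subst integral_eq_nn_integral) (auto simp: dirichlet_weight_nonneg)
  then have "(\<integral>x. dirichlet_density \<alpha> \<beta> x \<partial>lborel) = ?c * (1 / ?c)"
    unfolding dirichlet_density_eq_weight[abs_def] by (simp only: integral_mult_right_zero)
  moreover have "c * (1 / c) = 1" if "c > 0" for c :: real
    using that by simp
  ultimately show ?thesis
    using dirichlet_constant_pos by metis
qed

lemma integrable_dirichlet_density_mult:
  assumes [measurable]: "h \<in> borel_measurable borel"
    and h: "\<And>x. x \<in> simplex_set \<Longrightarrow> \<bar>h x\<bar> \<le> B"
  shows "integrable lborel (\<lambda>x. dirichlet_density \<alpha> \<beta> x * h x)"
proof (rule Bochner_Integration.integrable_bound)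
  show "integrable lborel (\<lambda>x. B * dirichlet_density \<alpha> \<beta> x)"
    by (intro integrable_mult_right integrable_dirichlet_density)
  have "norm (dirichlet_density \<alpha> \<beta> x * h x) \<le> norm (B * dirichlet_density \<alpha> \<beta> x)" for x
  proof (cases "x \<in> simplex_set")
    case True
    then show ?thesis
      using h[OF True] by (auto simp: abs_mult mult.commute intro!: mult_right_mono)
  qed (simp add: dirichlet_density_def)
  then show "AE x in lborel. norm (dirichlet_density \<alpha> \<beta> x * h x) \<le> norm (B * dirichlet_density \<alpha> \<beta> x)"
    by simp
qed measurable

text \<open>
  Multiplying by a coordinate raises one parameter by 1 and stays inside the Dirichlet family. This
  recursion is the source of all moments.
\<close>

lemma dirichlet_density_mult_nth:
  "dirichlet_density \<alpha> \<beta> x * x $ i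
     = \<alpha> $ i / (l1_norm \<alpha> + \<beta>) * dirichlet_density (\<alpha> + axis i 1) \<beta> x"
proof (cases "x \<in> simplex_set")
  case True
  have nz: "z \<notin> \<int>\<^sub>\<le>\<^sub>0" if "z > 0" for z :: real
    using that by (auto elim!: nonpos_Ints_cases)
  have l1: "l1_norm (\<alpha> + axis i 1) = l1_norm \<alpha> + 1"
    using \<alpha> by (simp add: l1_norm_nonneg_eq less_imp_le axis_def sum.distrib)
  have s: "(\<Prod>j\<in>UNIV. x $ j powr ((\<alpha> + axis i 1) $ j - 1)) = (\<Prod>j\<in>UNIV. x $ j powr (\<alpha> $ j - 1)) * x $ i"
  proof -
    have "(\<Prod>j\<in>UNIV. x $ j powr ((\<alpha> + axis i 1) $ j - 1))
      = (\<Prod>j\<in>UNIV. x $ j powr (\<alpha> $ j - 1) * (if j = i then x $ j else 1))"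
    proof (intro prod.cong refl)
      fix j
      have "x $ j powr (\<alpha> $ j) = x $ j powr (\<alpha> $ j - 1) * x $ j"
        using simplex_nth(1)[OF True, of j] by (cases "x $ j = 0") (auto simp: powr_diff)
      then show "x $ j powr ((\<alpha> + axis i 1) $ j - 1) = x $ j powr (\<alpha> $ j - 1) * (if j = i then x $ j else 1)"
        by (cases "j = i") (auto simp: axis_def)
    qed
    then show ?thesis by (simp add: prod.distrib)
  qed
  have g: "(\<Prod>j\<in>UNIV. Gamma ((\<alpha> + axis i 1) $ j)) = (\<Prod>j\<in>UNIV. Gamma (\<alpha> $ j)) * \<alpha> $ i"
  proof -
    have "(\<Prod>j\<in>UNIV. Gamma ((\<alpha> + axis i 1) $ j)) = (\<Prod>j\<in>UNIV. Gamma (\<alpha> $ j) * (if j = i then \<alpha> $ j else 1))"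
      using Gamma_plus1[OF nz[OF \<alpha>[of i]]] by (intro prod.cong) (auto simp: axis_def)
    then show ?thesis by (simp add: prod.distrib)
  qed
  have pos: "l1_norm \<alpha> + \<beta> > 0" using l1_norm_pos[of \<alpha>] \<alpha> \<beta> by simp
  have G: "Gamma (l1_norm (\<alpha> + axis i 1) + \<beta>) = (l1_norm \<alpha> + \<beta>) * Gamma (l1_norm \<alpha> + \<beta>)"
    unfolding l1 using Gamma_plus1[OF nz[OF pos]] by (simp add: add_ac)
  show ?thesis
    unfolding dirichlet_density_def s g G using True pos \<alpha>[of i] by simp
qed (simp add: dirichlet_density_def)

end

definition dirichlet_mean :: "real ^ 'd \<Rightarrow> real \<Rightarrow> (real ^ 'd \<Rightarrow> real) \<Rightarrow> real" where
  "dirichlet_mean \<alpha> \<beta> h = (\<integral>x. dirichlet_density \<alpha> \<beta> x * h x \<partial>lborel)"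

lemma dirichlet_mean_const:
  assumes "\<And>i. 0 < \<alpha> $ i" "0 < \<beta>"
  shows "dirichlet_mean \<alpha> \<beta> (\<lambda>x. c) = c"
  using integral_dirichlet_density[OF assms] by (simp add: dirichlet_mean_def)

lemma dirichlet_mean_nth_mult:
  assumes "\<And>i. 0 < \<alpha> $ i" "0 < \<beta>"
  shows "dirichlet_mean \<alpha> \<beta> (\<lambda>x. x $ i * h x)
     = \<alpha> $ i / (l1_norm \<alpha> + \<beta>) * dirichlet_mean (\<alpha> + axis i 1) \<beta> h"
  unfolding dirichlet_mean_def mult.assoc[symmetric] dirichlet_density_mult_nth[OF assms]
  by (simp add: mult.assoc)

lemma dirichlet_moments:
  fixes \<alpha> :: "real ^ 'd"
  assumes \<alpha>: "\<And>i. 0 < \<alpha> $ i" and \<beta>: "0 < \<beta>"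
  defines "A \<equiv> l1_norm \<alpha> + \<beta>"
  shows "dirichlet_mean \<alpha> \<beta> (\<lambda>x. x $ i) = \<alpha> $ i / A"
    and "dirichlet_mean \<alpha> \<beta> (\<lambda>x. x $ i * x $ j) = \<alpha> $ i / A * ((\<alpha> $ j + (if i = j then 1 else 0)) / (A + 1))"
    and "dirichlet_mean \<alpha> \<beta> (\<lambda>x. x $ i ^ 2) = \<alpha> $ i / A * ((\<alpha> $ i + 1) / (A + 1))"
    and "dirichlet_mean \<alpha> \<beta> (\<lambda>x. x $ i ^ 3) = \<alpha> $ i / A * ((\<alpha> $ i + 1) / (A + 1)) * ((\<alpha> $ i + 2) / (A + 2))"
    and "dirichlet_mean \<alpha> \<beta> (\<lambda>x. x $ i ^ 4) =
      \<alpha> $ i / A * ((\<alpha> $ i + 1) / (A + 1)) * ((\<alpha> $ i + 2) / (A + 2)) * ((\<alpha> $ i + 3) / (A + 3))"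
proof -
  have ax: "axis i c $ j = (if i = j then c else 0 :: real)" for i j :: 'd and c
    by (auto simp: axis_def)
  have l1: "l1_norm (\<alpha> + axis i c) = l1_norm \<alpha> + c" if "c \<ge> 0" for i c
    using \<alpha> that by (simp add: l1_norm_nonneg_eq less_imp_le axis_def sum.distrib add_nonneg_nonneg)
  have pos: "0 < (\<alpha> + axis i c) $ j" if "c \<ge> 0" for i j c
    using \<alpha>[of j] that by (simp add: ax)
  have axax: "\<alpha> + axis i c + axis i e = \<alpha> + axis i (c + e)" for c e i
    by (simp add: vec_eq_iff axis_def)
  have step: "dirichlet_mean (\<alpha> + axis i c) \<beta> (\<lambda>x. x $ j * h x)
     = (\<alpha> $ j + (if i = j then c else 0)) / (A + c) * dirichlet_mean (\<alpha> + axis i c + axis j 1) \<beta> h"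
    if "c \<ge> 0" for i j c h
    using dirichlet_mean_nth_mult[of "\<alpha> + axis i c" \<beta> j h] pos[OF that] \<beta> that
    by (simp add: ax l1 A_def add_ac)
  have one: "dirichlet_mean (\<alpha> + axis i c) \<beta> (\<lambda>x. x $ j) = (\<alpha> $ j + (if i = j then c else 0)) / (A + c)"
    if "c \<ge> 0" for i j c
  proof -
    have "0 < (\<alpha> + axis i c + axis j 1) $ k" for k
      using \<alpha>[of k] that by (auto simp: ax)
    with step[OF that, of i j "\<lambda>_. 1"] \<beta> show ?thesis by (simp add: dirichlet_mean_const)
  qed
  have p: "x ^ 2 = x * x" "x ^ 3 = x * x ^ 2" "x ^ 4 = x * x ^ 3" for x :: real
    by (simp_all add: eval_nat_numeral)
  have ax0: "axis i 0 = (0 :: real ^ 'd)" for i by (simp add: vec_eq_iff axis_def)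
  show m1: "dirichlet_mean \<alpha> \<beta> (\<lambda>x. x $ i) = \<alpha> $ i / A"
    using one[of 0 i i] by (simp add: ax0)
  show m2: "dirichlet_mean \<alpha> \<beta> (\<lambda>x. x $ i * x $ j) = \<alpha> $ i / A * ((\<alpha> $ j + (if i = j then 1 else 0)) / (A + 1))"
    using step[of 0 i i "\<lambda>x. x $ j"] one[of 1 i j] by (simp add: ax0)
  have s2: "dirichlet_mean (\<alpha> + axis i c) \<beta> (\<lambda>x. x $ i ^ 2) = (\<alpha> $ i + c) / (A + c) * ((\<alpha> $ i + (c + 1)) / (A + (c + 1)))"
    if "c \<ge> 0" for c
    unfolding p(1) using step[OF that, of i i "\<lambda>x. x $ i"] one[of "c + 1" i i] that by (simp add: axax)
  have s3: "dirichlet_mean (\<alpha> + axis i c) \<beta> (\<lambda>x. x $ i ^ 3) = (\<alpha> $ i + c) / (A + c) *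
       ((\<alpha> $ i + (c + 1)) / (A + (c + 1)) * ((\<alpha> $ i + (c + 1 + 1)) / (A + (c + 1 + 1))))"
    if "c \<ge> 0" for c
    unfolding p(2) using step[OF that, of i i "\<lambda>x. x $ i ^ 2"] s2[of "c + 1"] that by (simp add: axax)
  show "dirichlet_mean \<alpha> \<beta> (\<lambda>x. x $ i ^ 2) = \<alpha> $ i / A * ((\<alpha> $ i + 1) / (A + 1))"
    using s2[of 0] by (simp add: ax0)
  show "dirichlet_mean \<alpha> \<beta> (\<lambda>x. x $ i ^ 3) = \<alpha> $ i / A * ((\<alpha> $ i + 1) / (A + 1)) * ((\<alpha> $ i + 2) / (A + 2))"
    using s3[of 0] by (simp add: ax0 mult.assoc)
  show "dirichlet_mean \<alpha> \<beta> (\<lambda>x. x $ i ^ 4) =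
      \<alpha> $ i / A * ((\<alpha> $ i + 1) / (A + 1)) * ((\<alpha> $ i + 2) / (A + 2)) * ((\<alpha> $ i + 3) / (A + 3))"
    unfolding p(3) using step[of 0 i i "\<lambda>x. x $ i ^ 3"] s3[of 1] by (simp add: ax0 mult.assoc)
qed

section \<open>The kernel and its centred moments\<close>

definition dirichlet_kernel :: "real \<Rightarrow> real ^ 'd \<Rightarrow> real ^ 'd \<Rightarrow> real" where
  "dirichlet_kernel b s = dirichlet_density (\<chi> j. s $ j / b + 1) ((1 - l1_norm s) / b + 1)"

text \<open>
  For fixed \<open>s\<close> this is the expectation of \<open>h\<close> under the Dirichlet law used by the estimator at \<open>s\<close>.
  It is a positive operator, similar to the Bernstein operators, and the expectation of the
  estimator is this operator applied to the density.
\<close>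

definition dirichlet_smooth :: "real \<Rightarrow> (real ^ 'd \<Rightarrow> real) \<Rightarrow> real ^ 'd \<Rightarrow> real" where
  "dirichlet_smooth b h s = (\<integral>x. dirichlet_kernel b s x * h x \<partial>lborel)"

lemma dirichlet_smooth_eq_mean:
  "dirichlet_smooth b h s = dirichlet_mean (\<chi> j. s $ j / b + 1) ((1 - l1_norm s) / b + 1) h"
  by (simp add: dirichlet_smooth_def dirichlet_mean_def dirichlet_kernel_def)

lemma borel_measurable_dirichlet_kernel [measurable]:
  "dirichlet_kernel b s \<in> borel_measurable borel"
  unfolding dirichlet_kernel_def by measurable

lemma kernel_parameters:
  fixes s :: "real ^ 'd"
  assumes "b > 0" "s \<in> simplex_set"
  shows "0 < (\<chi> j. s $ j / b + 1) $ i" "0 < (1 - l1_norm s) / b + 1"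
    "l1_norm (\<chi> j. s $ j / b + 1) + ((1 - l1_norm s) / b + 1) = 1 / b + (real CARD('d) + 1)"
proof -
  show p: "0 < (\<chi> j. s $ j / b + 1) $ i" for i
    using assms simplex_nth(1)[OF assms(2), of i] by (simp add: add_nonneg_pos)
  show "0 < (1 - l1_norm s) / b + 1"
    using assms simplex_nth(3)[OF assms(2)] by (simp add: add_nonneg_pos)
  have "l1_norm (\<chi> j. s $ j / b + 1) = (\<Sum>i\<in>UNIV. s $ i / b + 1)"
    using p by (subst l1_norm_nonneg_eq) (auto intro: less_imp_le)
  then show "l1_norm (\<chi> j. s $ j / b + 1) + ((1 - l1_norm s) / b + 1) = 1 / b + (real CARD('d) + 1)"
    using assms by (simp add: sum.distrib sum_divide_distrib[symmetric] l1_norm_simplex diff_divide_distrib)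
qed

lemma dirichlet_kernel_nonneg: "b > 0 \<Longrightarrow> s \<in> simplex_set \<Longrightarrow> 0 \<le> dirichlet_kernel b s x"
  unfolding dirichlet_kernel_def by (intro dirichlet_density_nonneg kernel_parameters)

lemma dirichlet_kernel_outside: "x \<notin> simplex_set \<Longrightarrow> dirichlet_kernel b s x = 0"
  by (simp add: dirichlet_kernel_def dirichlet_density_def)

lemma integrable_dirichlet_kernel_mult:
  assumes "b > 0" "s \<in> simplex_set" "h \<in> borel_measurable borel"
    "\<And>x. x \<in> simplex_set \<Longrightarrow> \<bar>h x\<bar> \<le> B"
  shows "integrable lborel (\<lambda>x. dirichlet_kernel b s x * h x)"
  unfolding dirichlet_kernel_def
  by (rule integrable_dirichlet_density_mult[OF _ _ assms(3,4)]) (use kernel_parameters[OF assms(1,2)] in auto)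

lemma dirichlet_smooth_const: "b > 0 \<Longrightarrow> s \<in> simplex_set \<Longrightarrow> dirichlet_smooth b (\<lambda>_. c) s = c"
  unfolding dirichlet_smooth_eq_mean by (intro dirichlet_mean_const kernel_parameters)

lemma dirichlet_smooth_mono:
  assumes "b > 0" "s \<in> simplex_set" "h \<in> borel_measurable borel" "g \<in> borel_measurable borel"
    "\<And>x. x \<in> simplex_set \<Longrightarrow> \<bar>h x\<bar> \<le> B" "\<And>x. x \<in> simplex_set \<Longrightarrow> \<bar>g x\<bar> \<le> C"
    "\<And>x. x \<in> simplex_set \<Longrightarrow> h x \<le> g x"
  shows "dirichlet_smooth b h s \<le> dirichlet_smooth b g s"
  unfolding dirichlet_smooth_def
proof (rule integral_mono)
  fix x
  show "dirichlet_kernel b s x * h x \<le> dirichlet_kernel b s x * g x"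
    using dirichlet_kernel_nonneg[OF assms(1,2), of x] assms(7)[of x]
    by (cases "x \<in> simplex_set") (auto intro: mult_left_mono simp: dirichlet_kernel_outside)
qed (rule integrable_dirichlet_kernel_mult[OF assms(1,2)] | fact)+

text \<open>
  The numerator of a centred moment is a polynomial in a coordinate \<open>p\<close> and in \<open>b\<close>, so compactness
  bounds it uniformly in \<open>s\<close>.
\<close>

lemma continuous_bound_unit_square:
  fixes P :: "real \<times> real \<Rightarrow> real"
  assumes "continuous_on UNIV P"
  obtains C where "C \<ge> 0" "\<And>p b. 0 \<le> p \<Longrightarrow> p \<le> 1 \<Longrightarrow> 0 \<le> b \<Longrightarrow> b \<le> 1 \<Longrightarrow> \<bar>P (p, b)\<bar> \<le> C"
proof -
  have "compact (P ` ({0..1} \<times> {0..1}))"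
    by (intro compact_continuous_image continuous_on_subset[OF assms] compact_Times) auto
  then have "bounded (P ` ({0..1} \<times> {0..1}))" by (rule compact_imp_bounded)
  then obtain C where C: "C > 0" "\<And>z. z \<in> P ` ({0..1} \<times> {0..1}) \<Longrightarrow> \<bar>z\<bar> \<le> C"
    unfolding bounded_pos by auto
  show thesis
    by (rule that[of C]) (use C in auto)
qed

text \<open>
  With bandwidth \<open>b\<close> the parameters sum to \<open>1 / b + d + 1\<close>, and every factor of a Dirichlet moment
  becomes \<open>(s\<^sub>i / b + 1 + k) / (1 / b + d + 1 + k) = (s\<^sub>i + (1 + k) b) / (1 + (d + 1 + k) b)\<close>.
\<close>

lemma smooth_raw_moments:
  fixes s :: "real ^ 'd"
  assumes b: "b > 0" and s: "s \<in> simplex_set"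
  defines "q \<equiv> \<lambda>k. 1 + (real CARD('d) + 1 + k) * b"
  shows "dirichlet_smooth b (\<lambda>x. x $ i) s = (s $ i + b) / q 0"
    "dirichlet_smooth b (\<lambda>x. x $ i * x $ j) s
       = (s $ i + b) / q 0 * ((s $ j + (1 + (if i = j then 1 else 0)) * b) / q 1)"
    "dirichlet_smooth b (\<lambda>x. x $ i ^ 2) s = (s $ i + b) / q 0 * ((s $ i + 2 * b) / q 1)"
    "dirichlet_smooth b (\<lambda>x. x $ i ^ 3) s
       = (s $ i + b) / q 0 * ((s $ i + 2 * b) / q 1) * ((s $ i + 3 * b) / q 2)"
    "dirichlet_smooth b (\<lambda>x. x $ i ^ 4) s
       = (s $ i + b) / q 0 * ((s $ i + 2 * b) / q 1) * ((s $ i + 3 * b) / q 2) * ((s $ i + 4 * b) / q 3)"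
proof -
  have A: "1 / b + (real CARD('d) + 1) = q 0 / b" "q 0 / b + k = q k / b" for k
    using b by (simp_all add: q_def field_simps)
  have a: "p / b + 1 = (p + b) / b" "(p + b) / b + k = (p + (1 + k) * b) / b" for k p
    using b by (simp_all add: field_simps)
  have cancel: "(u / b) / (v / b) = u / v" for u v
    using b by simp
  note mom = dirichlet_moments[OF kernel_parameters(1)[OF b s] kernel_parameters(2)[OF b s],
      folded dirichlet_smooth_eq_mean, unfolded kernel_parameters(3)[OF b s] vec_lambda_beta A, unfolded a cancel]
  show "dirichlet_smooth b (\<lambda>x. x $ i) s = (s $ i + b) / q 0"
    using mom(1) .
  show "dirichlet_smooth b (\<lambda>x. x $ i * x $ j) s
       = (s $ i + b) / q 0 * ((s $ j + (1 + (if i = j then 1 else 0)) * b) / q 1)"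
    using mom(2) .
  show "dirichlet_smooth b (\<lambda>x. x $ i ^ 2) s = (s $ i + b) / q 0 * ((s $ i + 2 * b) / q 1)"
    using mom(3) by simp
  show "dirichlet_smooth b (\<lambda>x. x $ i ^ 3) s
       = (s $ i + b) / q 0 * ((s $ i + 2 * b) / q 1) * ((s $ i + 3 * b) / q 2)"
    using mom(4) by simp
  show "dirichlet_smooth b (\<lambda>x. x $ i ^ 4) s
       = (s $ i + b) / q 0 * ((s $ i + 2 * b) / q 1) * ((s $ i + 3 * b) / q 2) * ((s $ i + 4 * b) / q 3)"
    using mom(5) by simp
qed

lemma smooth_first_moment:
  fixes s :: "real ^ 'd"
  assumes b: "b > 0" and s: "s \<in> simplex_set"
  defines "D \<equiv> real CARD('d) + 1"
  shows "dirichlet_smooth b (\<lambda>x. x $ i - s $ i) s = b * (1 - D * s $ i) / (1 + D * b)"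
proof -
  have [simp]: "1 + D * b \<noteq> 0" using b by (simp add: D_def add_pos_nonneg less_imp_neq[symmetric])
  note int = integrable_dirichlet_kernel_mult[OF b s]
  have m1: "dirichlet_smooth b (\<lambda>x. x $ i) s = (s $ i + b) / (1 + D * b)"
    using smooth_raw_moments(1)[OF b s, of i] by (simp add: D_def)
  have "dirichlet_smooth b (\<lambda>x. x $ i - s $ i) s = dirichlet_smooth b (\<lambda>x. x $ i) s - dirichlet_smooth b (\<lambda>x. s $ i) s"
    unfolding dirichlet_smooth_def right_diff_distrib
    by (intro Bochner_Integration.integral_diff int[where B=1]) (use s in \<open>auto simp: simplex_nth\<close>)
  also have "\<dots> = (s $ i + b) / (1 + D * b) - s $ i"
    by (simp add: m1 dirichlet_smooth_const[OF b s])
  also have "\<dots> = b * (1 - D * s $ i) / (1 + D * b)"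
    by (simp add: field_simps)
  finally show ?thesis .
qed

text \<open>
  The drift \<open>1 - (d + 1) s\<^sub>i\<close> is the coefficient of \<open>\<partial>f / \<partial>s\<^sub>i\<close> in \<^const>\<open>g_fun\<close>.
\<close>

lemma smooth_first_moment_bound:
  obtains C where "C \<ge> 0" "\<And>b (s :: real ^ 'd) (i :: 'd). 0 < b \<Longrightarrow> b \<le> 1 \<Longrightarrow> s \<in> simplex_set \<Longrightarrow>
     \<bar>dirichlet_smooth b (\<lambda>x. x $ i - s $ i) s - b * (1 - (real CARD('d) + 1) * s $ i)\<bar> \<le> C * b\<^sup>2"
proof (rule that[of "(real CARD('d) + 1) * (real CARD('d) + 2)"])
  fix b :: real and s :: "real ^ 'd" and i :: 'd
  assume b: "0 < b" "b \<le> 1" and s: "s \<in> simplex_set"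
  define D where "D = real CARD('d) + 1"
  have D: "D \<ge> 1" by (simp add: D_def)
  have q: "1 + D * b \<ge> 1" using D b by simp
  have p: "\<bar>1 - D * s $ i\<bar> \<le> 1 + D"
  proof -
    have "0 \<le> D * s $ i" "D * s $ i \<le> D * 1" using simplex_nth(1,2)[OF s, of i] D by (auto intro!: mult_left_mono)
    then show ?thesis by auto
  qed
  have "dirichlet_smooth b (\<lambda>x. x $ i - s $ i) s - b * (1 - D * s $ i)
      = - b\<^sup>2 * (D * (1 - D * s $ i) / (1 + D * b))"
    using smooth_first_moment[OF b(1) s, of i] q unfolding D_def[symmetric]
    by (simp add: field_simps power2_eq_square)
  also have "\<bar>\<dots>\<bar> = b\<^sup>2 * (D * \<bar>1 - D * s $ i\<bar> / (1 + D * b))"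
    using D q by (simp add: abs_mult)
  also have "\<dots> \<le> b\<^sup>2 * (D * (1 + D) / 1)"
    using D q p by (intro mult_left_mono frac_le) auto
  finally show "\<bar>dirichlet_smooth b (\<lambda>x. x $ i - s $ i) s - b * (1 - (real CARD('d) + 1) * s $ i)\<bar>
     \<le> (real CARD('d) + 1) * (real CARD('d) + 2) * b\<^sup>2"
    by (simp add: D_def algebra_simps)
qed simp

lemma smooth_second_moment:
  fixes s :: "real ^ 'd"
  assumes b: "b > 0" and s: "s \<in> simplex_set"
  defines "D \<equiv> real CARD('d) + 1"
  defines "\<delta> \<equiv> \<lambda>i j. (if i = j then 1 else 0 :: real)"
  shows "dirichlet_smooth b (\<lambda>x. (x $ i - s $ i) * (x $ j - s $ j)) s
     = (b * (s $ i * (\<delta> i j - s $ j)) + b\<^sup>2 * (1 + \<delta> i j - (D + 1) * s $ i - (D + 1) * s $ j + D * (D + 1) * s $ i * s $ j))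
       / ((1 + D * b) * (1 + (D + 1) * b))"
proof -
  define q where "q k = 1 + (D + k) * b" for k
  have q: "q k > 0" if "k \<ge> 0" for k using b that by (simp add: q_def D_def add_pos_nonneg)
  note int = integrable_dirichlet_kernel_mult[OF b s]
  have m1: "dirichlet_smooth b (\<lambda>x. x $ i) s = (s $ i + b) / q 0" for i
    using smooth_raw_moments(1)[OF b s] by (simp add: q_def D_def)
  have m2: "dirichlet_smooth b (\<lambda>x. x $ i * x $ j) s = (s $ i + b) / q 0 * ((s $ j + (1 + \<delta> i j) * b) / q 1)"
    using smooth_raw_moments(2)[OF b s] by (simp add: q_def D_def \<delta>_def)
  have "dirichlet_smooth b (\<lambda>x. (x $ i - s $ i) * (x $ j - s $ j)) s
    = (\<integral>x. dirichlet_kernel b s x * (x $ i * x $ j) - s $ j * (dirichlet_kernel b s x * x $ i)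
        - s $ i * (dirichlet_kernel b s x * x $ j) + dirichlet_kernel b s x * (s $ i * s $ j) \<partial>lborel)"
    unfolding dirichlet_smooth_def by (intro Bochner_Integration.integral_cong) (auto simp: algebra_simps)
  also have "\<dots> = dirichlet_smooth b (\<lambda>x. x $ i * x $ j) s - s $ j * dirichlet_smooth b (\<lambda>x. x $ i) s
     - s $ i * dirichlet_smooth b (\<lambda>x. x $ j) s + s $ i * s $ j"
  proof -
    have "integrable lborel (\<lambda>x. dirichlet_kernel b s x * (x $ i * x $ j))"
      by (rule int[where B=1]) (auto simp: simplex_nth abs_mult intro!: mult_le_one)
    moreover have "integrable lborel (\<lambda>x. dirichlet_kernel b s x * x $ i)" for i
      by (rule int[where B=1]) (auto simp: simplex_nth)
    moreover have "integrable lborel (\<lambda>x. dirichlet_kernel b s x * (s $ i * s $ j))"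
      by (rule int) auto
    ultimately show ?thesis
      using dirichlet_smooth_const[OF b s, of "s $ i * s $ j"]
      by (simp add: dirichlet_smooth_def)
  qed
  also have "\<dots> = ((s $ i + b) * (s $ j + (1 + \<delta> i j) * b) - s $ j * (s $ i + b) * q 1 - s $ i * (s $ j + b) * q 1
      + s $ i * s $ j * q 0 * q 1) / (q 0 * q 1)"
    unfolding m1 m2 using q[of 0] q[of 1] by (simp add: field_simps)
  also have "(s $ i + b) * (s $ j + (1 + \<delta> i j) * b) - s $ j * (s $ i + b) * q 1 - s $ i * (s $ j + b) * q 1
      + s $ i * s $ j * q 0 * q 1 = b * (s $ i * (\<delta> i j - s $ j)) + b\<^sup>2 * (1 + \<delta> i j - (D + 1) * s $ i - (D + 1) * s $ j + D * (D + 1) * s $ i * s $ j)"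
  proof -
    have "(p + b) * (r + (1 + \<epsilon>) * b) - r * (p + b) * (1 + (D + 1) * b) - p * (r + b) * (1 + (D + 1) * b)
      + p * r * (1 + (D + 0) * b) * (1 + (D + 1) * b)
      = b * (p * (\<epsilon> - r)) + b\<^sup>2 * (1 + \<epsilon> - (D + 1) * p - (D + 1) * r + D * (D + 1) * p * r)" for p r \<epsilon> :: real
      by algebra
    then show ?thesis unfolding q_def .
  qed
  finally show ?thesis by (simp add: q_def)
qed

text \<open>
  The covariance \<open>s\<^sub>i (\<delta>\<^sub>i\<^sub>j - s\<^sub>j)\<close> is twice the coefficient of \<open>\<partial>\<^sup>2f / \<partial>s\<^sub>i\<partial>s\<^sub>j\<close> in \<^const>\<open>g_fun\<close>.
\<close>

lemma smooth_second_moment_bound: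
  obtains C where "C \<ge> 0" "\<And>b (s :: real ^ 'd) (i :: 'd) (j :: 'd). 0 < b \<Longrightarrow> b \<le> 1 \<Longrightarrow> s \<in> simplex_set \<Longrightarrow>
     \<bar>dirichlet_smooth b (\<lambda>x. (x $ i - s $ i) * (x $ j - s $ j)) s
        - b * (s $ i * ((if i = j then 1 else 0) - s $ j))\<bar> \<le> C * b\<^sup>2"
proof -
  define D where "D = real CARD('d) + 1"
  have D: "D \<ge> 1" by (simp add: D_def)
  define C where "C = (2 + 2 * (D + 1) + D * (D + 1)) + 1 * (2 * D + 1 + D * (D + 1))"
  show ?thesis
  proof (rule that[of C])
    show "C \<ge> 0" using D by (simp add: C_def)
    fix b :: real and s :: "real ^ 'd" and i j :: 'd
    assume b: "0 < b" "b \<le> 1" and s: "s \<in> simplex_set"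
    define \<delta> where "\<delta> = (if i = j then 1 else 0 :: real)"
    define p r where "p = s $ i" and "r = s $ j"
    have pr: "0 \<le> p" "p \<le> 1" "0 \<le> r" "r \<le> 1" using simplex_nth[OF s] by (auto simp: p_def r_def)
    have \<delta>: "0 \<le> \<delta>" "\<delta> \<le> 1" by (auto simp: \<delta>_def)
    define Q where "Q = (1 + D * b) * (1 + (D + 1) * b)"
    have Q: "Q \<ge> 1" unfolding Q_def using D b by (intro mult_ge1_I) auto
    define P where "P = (1 + \<delta> - (D + 1) * p - (D + 1) * r + D * (D + 1) * (p * r)) - p * (\<delta> - r) * (2 * D + 1 + D * (D + 1) * b)"
    have "dirichlet_smooth b (\<lambda>x. (x $ i - s $ i) * (x $ j - s $ j)) s - b * (p * (\<delta> - r)) = b\<^sup>2 * (P / Q)"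
    proof -
      have "dirichlet_smooth b (\<lambda>x. (x $ i - s $ i) * (x $ j - s $ j)) s
         = (b * (p * (\<delta> - r)) + b\<^sup>2 * (1 + \<delta> - (D + 1) * p - (D + 1) * r + D * (D + 1) * p * r)) / Q"
        using smooth_second_moment[OF b(1) s, of i j] by (simp add: D_def Q_def p_def r_def \<delta>_def)
      moreover have "(b * (p * (\<delta> - r)) + b\<^sup>2 * (1 + \<delta> - (D + 1) * p - (D + 1) * r + D * (D + 1) * p * r))
         = b\<^sup>2 * P + b * (p * (\<delta> - r)) * Q"
        unfolding P_def Q_def by algebra
      ultimately show ?thesis using Q by (simp add: field_simps)
    qed
    moreover have "\<bar>P\<bar> \<le> C"
    proof -
      have a: "0 \<le> (D + 1) * p" "(D + 1) * p \<le> D + 1" "0 \<le> (D + 1) * r" "(D + 1) * r \<le> D + 1"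
        using D pr by (auto intro: mult_left_le)
      have c: "0 \<le> p * r" "p * r \<le> 1" using pr by (auto intro: mult_le_one)
      have a2: "0 \<le> D * (D + 1) * (p * r)" "D * (D + 1) * (p * r) \<le> D * (D + 1)"
        using D c by (auto intro!: mult_left_le)
      have "\<bar>p * (\<delta> - r) * (2 * D + 1 + D * (D + 1) * b)\<bar> \<le> 1 * (2 * D + 1 + D * (D + 1))"
        unfolding abs_mult
      proof (intro mult_mono)
        show "\<bar>p\<bar> * \<bar>\<delta> - r\<bar> \<le> 1" using pr \<delta> by (intro mult_le_one) auto
        have "D * (D + 1) * b \<le> D * (D + 1)" using D b by (intro mult_left_le) auto
        moreover have "0 \<le> D * (D + 1) * b" using D b by simp
        ultimately show "\<bar>2 * D + 1 + D * (D + 1) * b\<bar> \<le> 2 * D + 1 + D * (D + 1)"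
          using D by linarith
      qed auto
      moreover have "\<bar>1 + \<delta> - x - y + z - w\<bar> \<le> 2 + 2 * u + v + t"
        if "\<bar>w\<bar> \<le> t" "0 \<le> x" "x \<le> u" "0 \<le> y" "y \<le> u" "0 \<le> z" "z \<le> v" for x y z w u v t :: real
        using that \<delta> by linarith
      ultimately show ?thesis unfolding P_def C_def using a a2 by blast
    qed
    ultimately have "\<bar>dirichlet_smooth b (\<lambda>x. (x $ i - s $ i) * (x $ j - s $ j)) s - b * (p * (\<delta> - r))\<bar> \<le> b\<^sup>2 * (C / 1)"
      using Q by (simp only: abs_mult abs_divide) (intro mult_mono frac_le, auto)
    then show "\<bar>dirichlet_smooth b (\<lambda>x. (x $ i - s $ i) * (x $ j - s $ j)) s
        - b * (s $ i * ((if i = j then 1 else 0) - s $ j))\<bar> \<le> C * b\<^sup>2"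
      by (simp add: p_def r_def \<delta>_def mult.commute)
  qed
qed

text \<open>
  A centred fourth moment of order \<open>b\<^sup>2 = o(b)\<close> controls the mass of the kernel far from \<open>s\<close>. It is what
  makes the Taylor remainder negligible.
\<close>

lemma smooth_fourth_moment_bound:
  obtains C where "C \<ge> 0" "\<And>b (s :: real ^ 'd) (i :: 'd). 0 < b \<Longrightarrow> b \<le> 1 \<Longrightarrow> s \<in> simplex_set \<Longrightarrow>
     dirichlet_smooth b (\<lambda>x. (x $ i - s $ i) ^ 4) s \<le> C * b\<^sup>2"
proof -
  define D where "D = real CARD('d) + 1"
  have D: "D \<ge> 1" by (simp add: D_def)
  \<comment> \<open>The numerator of the centred moment has no terms of order 0 and 1 in \<open>b\<close>; this is its quotient by \<open>b\<^sup>2\<close>.\<close>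
  define P where "P = (\<lambda>(p::real, b::real). (3*p^2 + (-6)*p^3 + 3*p^4) + (26*p + (-72)*p^2 + (-20)*p^2*D + 64*p^3 + 42*p^3*D + 6*p^3*D^2 + (-18)*p^4 + (-22)*p^4*D + (-6)*p^4*D^2)*b + (24 + (-72)*p + (-24)*p*D + 72*p^2 + 60*p^2*D + 12*p^2*D^2 + (-24)*p^3 + (-44)*p^3*D + (-24)*p^3*D^2 + (-4)*p^3*D^3 + 6*p^4*D + 11*p^4*D^2 + 6*p^4*D^3 + p^4*D^4)*b^2)"
  have "continuous_on UNIV P"
    unfolding P_def case_prod_unfold by (intro continuous_intros)
  then obtain C where C: "C \<ge> 0" "\<And>p b. 0 \<le> p \<Longrightarrow> p \<le> 1 \<Longrightarrow> 0 \<le> b \<Longrightarrow> b \<le> 1 \<Longrightarrow> \<bar>P (p, b)\<bar> \<le> C"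
    by (rule continuous_bound_unit_square) blast
  show ?thesis
  proof (rule that[of C])
    show "C \<ge> 0" by fact
    fix b :: real and s :: "real ^ 'd" and i :: 'd
    assume b: "0 < b" "b \<le> 1" and s: "s \<in> simplex_set"
    define p where "p = s $ i"
    have p: "0 \<le> p" "p \<le> 1" using simplex_nth[OF s] by (auto simp: p_def)
    define q where "q k = 1 + (D + k) * b" for k
    have q: "q k \<ge> 1" if "k \<ge> 0" for k using b that D by (simp add: q_def)
    note m = smooth_raw_moments(1,3-5)[OF b(1) s, of i, folded D_def, folded q_def p_def]
    have int: "integrable lborel (\<lambda>x. dirichlet_kernel b s x * x $ i ^ k)" for k
      by (rule integrable_dirichlet_kernel_mult[OF b(1) s, where B=1])
         (auto simp: simplex_nth power_abs intro!: power_le_one)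
    have "dirichlet_smooth b (\<lambda>x. (x $ i - s $ i) ^ 4) s
      = (\<integral>x. dirichlet_kernel b s x * x $ i ^ 4 - 4 * p * (dirichlet_kernel b s x * x $ i ^ 3)
         + 6 * p^2 * (dirichlet_kernel b s x * x $ i ^ 2) - 4 * p^3 * (dirichlet_kernel b s x * x $ i ^ 1)
         + p^4 * (dirichlet_kernel b s x * x $ i ^ 0) \<partial>lborel)"
      unfolding dirichlet_smooth_def p_def
      by (intro Bochner_Integration.integral_cong) (auto simp: algebra_simps eval_nat_numeral)
    also have "\<dots> = dirichlet_smooth b (\<lambda>x. x $ i ^ 4) s - 4 * p * dirichlet_smooth b (\<lambda>x. x $ i ^ 3) s
       + 6 * p^2 * dirichlet_smooth b (\<lambda>x. x $ i ^ 2) s - 4 * p^3 * dirichlet_smooth b (\<lambda>x. x $ i) s + p^4"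
      using dirichlet_smooth_const[OF b(1) s, of 1] int[of 4] int[of 3] int[of 2] int[of 1] int[of 0]
      by (simp add: dirichlet_smooth_def)
    also have "\<dots> = ((p + b) * (p + 2 * b) * (p + 3 * b) * (p + 4 * b) - 4 * p * (p + b) * (p + 2 * b) * (p + 3 * b) * q 3
       + 6 * p^2 * (p + b) * (p + 2 * b) * q 2 * q 3 - 4 * p^3 * (p + b) * q 1 * q 2 * q 3 + p^4 * q 0 * q 1 * q 2 * q 3)
        / (q 0 * q 1 * q 2 * q 3)"
    proof -
      have "n0 / q0 * (n1 / q1) * (n2 / q2) * (n3 / q3) - 4 * p * (n0 / q0 * (n1 / q1) * (n2 / q2))
          + 6 * p\<^sup>2 * (n0 / q0 * (n1 / q1)) - 4 * p ^ 3 * (n0 / q0) + p ^ 4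
        = (n0 * n1 * n2 * n3 - 4 * p * n0 * n1 * n2 * q3 + 6 * p\<^sup>2 * n0 * n1 * q2 * q3
            - 4 * p ^ 3 * n0 * q1 * q2 * q3 + p ^ 4 * q0 * q1 * q2 * q3) / (q0 * q1 * q2 * q3)"
        if "q0 \<noteq> 0" "q1 \<noteq> 0" "q2 \<noteq> 0" "q3 \<noteq> 0" for n0 n1 n2 n3 q0 q1 q2 q3 :: real
        using that by (simp add: add_divide_distrib diff_divide_distrib)
      moreover have "q 0 \<noteq> 0" "q 1 \<noteq> 0" "q 2 \<noteq> 0" "q 3 \<noteq> 0" using q[of 0] q[of 1] q[of 2] q[of 3] by auto
      ultimately show ?thesis unfolding m by blast
    qed
    also have "((p + b) * (p + 2 * b) * (p + 3 * b) * (p + 4 * b) - 4 * p * (p + b) * (p + 2 * b) * (p + 3 * b) * q 3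
       + 6 * p^2 * (p + b) * (p + 2 * b) * q 2 * q 3 - 4 * p^3 * (p + b) * q 1 * q 2 * q 3 + p^4 * q 0 * q 1 * q 2 * q 3)
       = b\<^sup>2 * P (p, b)"
      unfolding P_def q_def prod.case by algebra
    also have "b\<^sup>2 * P (p, b) / (q 0 * q 1 * q 2 * q 3) \<le> b\<^sup>2 * C / 1"
    proof (rule frac_le)
      show "b\<^sup>2 * P (p, b) \<le> b\<^sup>2 * C"
        using C(2)[of p b] p b by (intro mult_left_mono) auto
      show "1 \<le> q 0 * q 1 * q 2 * q 3"
        using q by (intro mult_ge1_I) auto
    qed (use C in auto)
    finally show "dirichlet_smooth b (\<lambda>x. (x $ i - s $ i) ^ 4) s \<le> C * b\<^sup>2"
      by (simp add: mult.commute)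
  qed
qed

section \<open>The smoothing operator\<close>

text \<open>
  The class of functions on which the smoothing operator is linear and monotone: their products with
  the kernel are integrable.
\<close>

definition simplex_bounded :: "(real ^ 'd \<Rightarrow> real) \<Rightarrow> bool" where
  "simplex_bounded h \<longleftrightarrow> h \<in> borel_measurable borel \<and> (\<exists>B. \<forall>x\<in>simplex_set. \<bar>h x\<bar> \<le> B)"

lemma simplex_bounded_const [simp, intro]: "simplex_bounded (\<lambda>_. c)"
  by (auto simp: simplex_bounded_def)

lemma simplex_bounded_nth [simp, intro]: "simplex_bounded (\<lambda>x. x $ i)"
  by (auto simp: simplex_bounded_def simplex_nth intro!: exI[of _ 1])

lemma simplex_bounded_add [intro]:
  assumes "simplex_bounded h" "simplex_bounded k"
  shows "simplex_bounded (\<lambda>x. h x + k x)"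
proof -
  from assms obtain B C where *: "\<forall>x\<in>simplex_set. \<bar>h x\<bar> \<le> B" "\<forall>x\<in>simplex_set. \<bar>k x\<bar> \<le> C"
    by (auto simp: simplex_bounded_def)
  have "\<bar>h x + k x\<bar> \<le> B + C" if "x \<in> simplex_set" for x
    using *[rule_format, OF that] by linarith
  then show ?thesis using assms unfolding simplex_bounded_def by (intro conjI borel_measurable_add borel_measurable_times) blast+
qed

lemma simplex_bounded_mult [intro]:
  assumes "simplex_bounded h" "simplex_bounded k"
  shows "simplex_bounded (\<lambda>x. h x * k x)"
proof -
  from assms obtain B C where *: "\<forall>x\<in>simplex_set. \<bar>h x\<bar> \<le> B" "\<forall>x\<in>simplex_set. \<bar>k x\<bar> \<le> C"
    by (auto simp: simplex_bounded_def)
  have "\<bar>h x * k x\<bar> \<le> B * C" if "x \<in> simplex_set" for x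
    unfolding abs_mult using *[rule_format, OF that] by (intro mult_mono) auto
  then show ?thesis using assms unfolding simplex_bounded_def by (intro conjI borel_measurable_add borel_measurable_times) blast+
qed

lemma simplex_bounded_diff [intro]:
  assumes "simplex_bounded h" "simplex_bounded k"
  shows "simplex_bounded (\<lambda>x. h x - k x)"
  using simplex_bounded_add[OF assms(1) simplex_bounded_mult[OF simplex_bounded_const[of "-1"] assms(2)]]
  by simp

lemma simplex_bounded_power [intro]: "simplex_bounded h \<Longrightarrow> simplex_bounded (\<lambda>x. h x ^ n)"
  by (induction n) auto

lemma simplex_bounded_sum [intro]:
  "(\<And>i. i \<in> I \<Longrightarrow> simplex_bounded (h i)) \<Longrightarrow> simplex_bounded (\<lambda>x. \<Sum>i\<in>I. h i x)"
  by (induction I rule: infinite_finite_induct) auto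

lemma simplex_bounded_continuous_on:
  "h \<in> borel_measurable borel \<Longrightarrow> continuous_on simplex_set h \<Longrightarrow> simplex_bounded h"
  using compact_imp_bounded[OF compact_continuous_image[OF _ compact_simplex_set, of h]]
  by (auto simp: simplex_bounded_def bounded_iff)

context
  fixes b :: real and s :: "real ^ 'd"
  assumes b: "b > 0" and s: "s \<in> simplex_set"
begin

lemma integrable_kernel: "simplex_bounded h \<Longrightarrow> integrable lborel (\<lambda>x. dirichlet_kernel b s x * h x)"
  using integrable_dirichlet_kernel_mult[OF b s] by (auto simp: simplex_bounded_def)

lemma smooth_add:
  "simplex_bounded h \<Longrightarrow> simplex_bounded k \<Longrightarrow>
     dirichlet_smooth b (\<lambda>x. h x + k x) s = dirichlet_smooth b h s + dirichlet_smooth b k s"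
  unfolding dirichlet_smooth_def distrib_left
  by (intro Bochner_Integration.integral_add integrable_kernel)

lemma smooth_diff:
  "simplex_bounded h \<Longrightarrow> simplex_bounded k \<Longrightarrow>
     dirichlet_smooth b (\<lambda>x. h x - k x) s = dirichlet_smooth b h s - dirichlet_smooth b k s"
  unfolding dirichlet_smooth_def right_diff_distrib
  by (intro Bochner_Integration.integral_diff integrable_kernel)

lemma smooth_cmult: "dirichlet_smooth b (\<lambda>x. c * h x) s = c * dirichlet_smooth b h s"
  unfolding dirichlet_smooth_def by (simp add: mult.left_commute[of _ c])

lemma smooth_sum:
  "finite I \<Longrightarrow> (\<And>i. i \<in> I \<Longrightarrow> simplex_bounded (h i)) \<Longrightarrow>
     dirichlet_smooth b (\<lambda>x. \<Sum>i\<in>I. h i x) s = (\<Sum>i\<in>I. dirichlet_smooth b (h i) s)"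
  unfolding dirichlet_smooth_def sum_distrib_left
  by (intro Bochner_Integration.integral_sum integrable_kernel)

lemma smooth_mono:
  assumes "simplex_bounded h" "simplex_bounded k" "\<And>x. x \<in> simplex_set \<Longrightarrow> h x \<le> k x"
  shows "dirichlet_smooth b h s \<le> dirichlet_smooth b k s"
proof -
  from assms obtain B C where *: "\<forall>x\<in>simplex_set. \<bar>h x\<bar> \<le> B" "\<forall>x\<in>simplex_set. \<bar>k x\<bar> \<le> C"
    by (auto simp: simplex_bounded_def)
  then show ?thesis
    using assms by (intro dirichlet_smooth_mono[OF b s, of h k B C]) (auto simp: simplex_bounded_def)
qed

lemma smooth_abs_le:
  assumes "simplex_bounded h" "simplex_bounded k" "\<And>x. x \<in> simplex_set \<Longrightarrow> \<bar>h x\<bar> \<le> k x"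
  shows "\<bar>dirichlet_smooth b h s\<bar> \<le> dirichlet_smooth b k s"
proof -
  have "dirichlet_smooth b h s \<le> dirichlet_smooth b k s"
    using assms by (intro smooth_mono) force+
  moreover have "dirichlet_smooth b (\<lambda>x. (-1) * h x) s \<le> dirichlet_smooth b k s"
    using assms by (intro smooth_mono simplex_bounded_mult) force+
  ultimately show ?thesis unfolding smooth_cmult by linarith
qed

end

section \<open>Taylor expansion on the simplex and the bias\<close>

lemma has_derivative_partial_deriv:
  fixes f :: "real ^ 'd \<Rightarrow> real"
  assumes "f differentiable_on simplex_set" "s \<in> simplex_set"
  shows "(f has_derivative (\<lambda>h. \<Sum>i\<in>UNIV. h $ i * partial_deriv i f s)) (at s within simplex_set)"
proof -
  let ?D = "frechet_derivative f (at s within simplex_set)"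
  have D: "(f has_derivative ?D) (at s within simplex_set)"
    using assms frechet_derivative_works by (auto simp: differentiable_on_def)
  then have lin: "linear ?D" by (rule has_derivative_linear)
  have "?D = (\<lambda>h. \<Sum>i\<in>UNIV. h $ i * partial_deriv i f s)"
  proof
    fix h :: "real ^ 'd"
    have "?D h = ?D (\<Sum>i\<in>UNIV. h $ i *\<^sub>R axis i 1)"
      using basis_expansion[of h] by (simp add: scalar_mult_eq_scaleR)
    also have "\<dots> = (\<Sum>i\<in>UNIV. h $ i * partial_deriv i f s)"
      by (simp add: linear_sum[OF lin] linear_cmul[OF lin] partial_deriv_def)
    finally show "?D h = (\<Sum>i\<in>UNIV. h $ i * partial_deriv i f s)" .
  qed
  with D show ?thesis by simp
qed

lemma segment_in_simplex:
  assumes "s \<in> simplex_set" "s + h \<in> simplex_set" "t \<in> {0..1::real}"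
  shows "s + t *\<^sub>R h \<in> simplex_set"
  using convexD[OF convex_simplex_set assms(1,2), of "1 - t" t] assms(3)
  by (simp add: algebra_simps)

text \<open>
  By convexity of the simplex a derivative relative to the simplex is enough to differentiate along a
  segment, with one-sided derivatives at the two ends.
\<close>

lemma derivative_along_segment:
  fixes f :: "real ^ 'd \<Rightarrow> real"
  assumes f: "f differentiable_on simplex_set"
    and s: "s \<in> simplex_set" "s + h \<in> simplex_set" and t: "t \<in> {0..1::real}"
  shows "((\<lambda>t. f (s + t *\<^sub>R h)) has_field_derivative (\<Sum>i\<in>UNIV. h $ i * partial_deriv i f (s + t *\<^sub>R h)))
           (at t within {0..1})"
proof -
  let ?p = "\<lambda>t. s + t *\<^sub>R h"
  have "(f has_derivative (\<lambda>k. \<Sum>i\<in>UNIV. k $ i * partial_deriv i f (?p t))) (at (?p t) within ?p ` {0..1})"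
    by (rule has_derivative_subset[OF has_derivative_partial_deriv[OF f]])
       (use segment_in_simplex[OF s] t in auto)
  moreover have "(?p has_derivative (\<lambda>u. u *\<^sub>R h)) (at t within {0..1})"
    by (auto intro!: derivative_eq_intros)
  ultimately have "((\<lambda>t. f (?p t)) has_derivative (\<lambda>u. \<Sum>i\<in>UNIV. (u *\<^sub>R h) $ i * partial_deriv i f (?p t))) (at t within {0..1})"
    by (rule has_derivative_in_compose[rotated])
  moreover have "(\<lambda>u. \<Sum>i\<in>UNIV. (u *\<^sub>R h) $ i * partial_deriv i f (?p t)) = (*) (\<Sum>i\<in>UNIV. h $ i * partial_deriv i f (?p t))"
    by (auto simp: sum_distrib_left mult_ac)
  ultimately show ?thesis by (simp add: has_field_derivative_def)
qed

definition taylor2 :: "(real ^ 'd \<Rightarrow> real) \<Rightarrow> real ^ 'd \<Rightarrow> real ^ 'd \<Rightarrow> real" where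
  "taylor2 f s x = f s + (\<Sum>i\<in>UNIV. partial_deriv i f s * (x $ i - s $ i))
     + 1 / 2 * (\<Sum>i\<in>UNIV. \<Sum>j\<in>UNIV. partial_deriv i (partial_deriv j f) s * ((x $ i - s $ i) * (x $ j - s $ j)))"

text \<open>
  The difference of \<open>f\<close> and its Taylor polynomial is reduced to the segment from \<open>s\<close> to \<open>x\<close>. There
  the function \<open>\<phi> t - t\<^sup>2 / 2 * \<phi>'' 0\<close> is expanded to first order; its second derivative
  \<open>\<phi>'' t - \<phi>'' 0\<close> is controlled by the oscillation \<open>\<eta>\<close> of the second derivatives of \<open>f\<close>.
\<close>

lemma taylor2_remainder:
  fixes f :: "real ^ 'd \<Rightarrow> real"
  assumes f: "twice_cont_diff_on_simplex f" and s: "s \<in> simplex_set" and x: "x \<in> simplex_set"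
    and \<eta>: "\<And>z i j. z \<in> simplex_set \<Longrightarrow> norm (z - s) \<le> norm (x - s) \<Longrightarrow>
       \<bar>partial_deriv i (partial_deriv j f) z - partial_deriv i (partial_deriv j f) s\<bar> \<le> \<eta>"
  shows "\<bar>f x - taylor2 f s x\<bar> \<le> \<eta> * (\<Sum>i\<in>UNIV. \<bar>x $ i - s $ i\<bar>)\<^sup>2"
proof -
  define h where "h = x - s"
  have sh: "s + h \<in> simplex_set" using x by (simp add: h_def)
  let ?p = "\<lambda>t. s + t *\<^sub>R h"
  have f1: "f differentiable_on simplex_set" and f2: "\<And>i. partial_deriv i f differentiable_on simplex_set"
    using f by (auto simp: twice_cont_diff_on_simplex_def)
  define \<phi>1 where "\<phi>1 t = (\<Sum>j\<in>UNIV. h $ j * partial_deriv j f (?p t))" for t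
  define \<phi>2 where "\<phi>2 t = (\<Sum>j\<in>UNIV. h $ j * (\<Sum>i\<in>UNIV. h $ i * partial_deriv i (partial_deriv j f) (?p t)))" for t
  define F where "F k t = (if k = 0 then f (?p t) - t\<^sup>2 / 2 * \<phi>2 0 else if k = 1 then \<phi>1 t - t * \<phi>2 0 else \<phi>2 t - \<phi>2 0)"
    for k :: nat and t :: real
  have "norm (F 0 1 - (\<Sum>k\<le>1. F k 0 * (1 - 0) ^ k / fact k)) \<le> (\<eta> * (\<Sum>i\<in>UNIV. \<bar>h $ i\<bar>)\<^sup>2) * norm (1 - 0 :: real) ^ (Suc 1) / fact 1"
  proof (rule field_Taylor[of "{0..1::real}"])
    fix k :: nat and t :: real
    assume t: "t \<in> {0..1}"
    { assume k: "k \<le> 1"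
      show "(F k has_field_derivative F (Suc k) t) (at t within {0..1})"
      proof (cases "k = 0")
        case True
        have "((\<lambda>t. f (?p t) - t\<^sup>2 / 2 * \<phi>2 0) has_field_derivative (\<phi>1 t - t * \<phi>2 0)) (at t within {0..1})"
          using derivative_along_segment[OF f1 s sh t]
          by (auto intro!: derivative_eq_intros simp: \<phi>1_def)
        moreover have "F k = (\<lambda>t. f (?p t) - t\<^sup>2 / 2 * \<phi>2 0)" using True by (auto simp: F_def)
        ultimately show ?thesis using True by (simp add: F_def)
      next
        case False
        have "(\<phi>1 has_field_derivative \<phi>2 t) (at t within {0..1})"
          unfolding \<phi>1_def[abs_def] \<phi>2_def
          by (intro DERIV_sum DERIV_cmult derivative_along_segment f2 s sh t)
        then have "((\<lambda>t. \<phi>1 t - t * \<phi>2 0) has_field_derivative (\<phi>2 t - \<phi>2 0)) (at t within {0..1})"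
          by (auto intro!: derivative_eq_intros)
        moreover have "F k = (\<lambda>t. \<phi>1 t - t * \<phi>2 0)" using False k by (auto simp: F_def)
        ultimately show ?thesis using False k by (simp add: F_def)
      qed }
    have z: "?p t \<in> simplex_set" by (rule segment_in_simplex[OF s sh t])
    have nz: "norm (?p t - s) \<le> norm (x - s)"
      using t by (simp add: h_def mult_left_le_one_le)
    have "\<phi>2 t - \<phi>2 0 = (\<Sum>j\<in>UNIV. \<Sum>i\<in>UNIV. h $ j * h $ i * (partial_deriv i (partial_deriv j f) (?p t) - partial_deriv i (partial_deriv j f) s))"
      unfolding \<phi>2_def by (simp add: sum_subtractf[symmetric] sum_distrib_left algebra_simps)
    also have "\<bar>\<dots>\<bar> \<le> (\<Sum>j\<in>UNIV. \<Sum>i\<in>UNIV. \<bar>h $ j\<bar> * \<bar>h $ i\<bar> * \<eta>)"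
      by (intro order_trans[OF sum_abs] sum_mono) (auto simp: abs_mult intro!: mult_left_mono \<eta> z nz)
    also have "\<dots> = \<eta> * (\<Sum>i\<in>UNIV. \<bar>h $ i\<bar>)\<^sup>2"
      by (simp add: power2_eq_square sum_product sum_distrib_left sum_distrib_right mult_ac)
    finally show "norm (F (Suc 1) t) \<le> \<eta> * (\<Sum>i\<in>UNIV. \<bar>h $ i\<bar>)\<^sup>2"
      by (simp add: F_def)
  qed auto
  moreover have "F 0 1 - (\<Sum>k\<le>1. F k 0 * (1 - 0) ^ k / fact k) = f x - taylor2 f s x"
  proof -
    have "\<phi>1 0 = (\<Sum>i\<in>UNIV. partial_deriv i f s * (x $ i - s $ i))"
      by (simp add: \<phi>1_def h_def mult.commute)
    moreover have "\<phi>2 0 = (\<Sum>i\<in>UNIV. \<Sum>j\<in>UNIV. partial_deriv i (partial_deriv j f) s * ((x $ i - s $ i) * (x $ j - s $ j)))"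
      unfolding \<phi>2_def by (subst sum.swap) (simp add: h_def sum_distrib_left mult_ac)
    ultimately show ?thesis by (simp add: F_def taylor2_def h_def)
  qed
  ultimately show ?thesis by (simp add: h_def)
qed

lemma continuous_on_simplex_derivs:
  fixes f :: "real ^ 'd \<Rightarrow> real"
  assumes f: "twice_cont_diff_on_simplex f"
  shows "continuous_on simplex_set f" "continuous_on simplex_set (partial_deriv i f)"
    "continuous_on simplex_set (partial_deriv i (partial_deriv j f))"
  using f by (auto simp: twice_cont_diff_on_simplex_def intro: differentiable_imp_continuous_on)

lemma simplex_derivs_bound:
  fixes f :: "real ^ 'd \<Rightarrow> real"
  assumes f: "twice_cont_diff_on_simplex f"
  obtains M where "M > 0" "\<And>s i. s \<in> simplex_set \<Longrightarrow> \<bar>partial_deriv i f s\<bar> \<le> M"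
    "\<And>s i j. s \<in> simplex_set \<Longrightarrow> \<bar>partial_deriv i (partial_deriv j f) s\<bar> \<le> M"
proof -
  define G where "G s = ((\<chi> i. partial_deriv i f s), (\<chi> i j. partial_deriv i (partial_deriv j f) s))" for s
  have "continuous_on simplex_set G"
    unfolding G_def[abs_def] by (intro continuous_intros continuous_on_vec_lambda continuous_on_simplex_derivs f)
  then have "bounded (G ` simplex_set)"
    by (intro compact_imp_bounded compact_continuous_image compact_simplex_set)
  then obtain M where M: "M > 0" "\<And>s. s \<in> simplex_set \<Longrightarrow> norm (G s) \<le> M"
    unfolding bounded_pos by auto
  show thesis
  proof (rule that[of M])
    fix s :: "real ^ 'd" and i j
    assume s: "s \<in> simplex_set"
    have "\<bar>fst (G s) $ i\<bar> \<le> norm (fst (G s))" by (rule component_le_norm_cart)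
    also have "\<dots> \<le> norm (G s)" using norm_fst_le[of "fst (G s)" "snd (G s)"] by simp
    finally show "\<bar>partial_deriv i f s\<bar> \<le> M" using M(2)[OF s] by (simp add: G_def)
    have "\<bar>snd (G s) $ i $ j\<bar> \<le> norm (snd (G s) $ i)" by (rule component_le_norm_cart)
    also have "\<dots> \<le> norm (snd (G s))" by (rule Finite_Cartesian_Product.norm_nth_le)
    also have "\<dots> \<le> norm (G s)" using norm_snd_le[of "snd (G s)" "fst (G s)"] by simp
    finally show "\<bar>partial_deriv i (partial_deriv j f) s\<bar> \<le> M" using M(2)[OF s] by (simp add: G_def)
  qed (fact M)
qed

text \<open>
  If \<open>x\<close> is near \<open>s\<close>, uniform continuity of the second derivatives gives the term with \<open>\<epsilon>\<close>. If
  \<open>x\<close> is at distance at least \<open>\<delta>\<close>, the oscillation of the second derivatives is at most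
  \<open>2 M \<le> 2 M |x - s|\<^sup>2 / \<delta>\<^sup>2\<close>, which gives the fourth powers.
\<close>

lemma taylor2_remainder_uniform:
  fixes f :: "real ^ 'd \<Rightarrow> real"
  assumes f: "twice_cont_diff_on_simplex f" and "\<epsilon> > 0"
  obtains C where "C \<ge> 0" "\<And>s x. s \<in> simplex_set \<Longrightarrow> x \<in> simplex_set \<Longrightarrow>
    \<bar>f x - taylor2 f s x\<bar> \<le> (\<Sum>i\<in>UNIV. \<epsilon> * (x $ i - s $ i)\<^sup>2 + C * (x $ i - s $ i) ^ 4)"
proof -
  obtain M where M: "M > 0" "\<And>s i j. s \<in> simplex_set \<Longrightarrow> \<bar>partial_deriv i (partial_deriv j f) s\<bar> \<le> M"
    using simplex_derivs_bound[OF f] by metis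
  define d where "d = real CARD('d)"
  have d: "d > 0" by (simp add: d_def)
  define H :: "real ^ 'd \<Rightarrow> real ^ 'd ^ 'd" where "H s = (\<chi> i j. partial_deriv i (partial_deriv j f) s)" for s
  have "continuous_on simplex_set H"
    unfolding H_def[abs_def] by (intro continuous_on_vec_lambda continuous_on_simplex_derivs f)
  then have "uniformly_continuous_on simplex_set H"
    by (intro compact_uniformly_continuous compact_simplex_set)
  then obtain \<delta> where \<delta>: "\<delta> > 0" "\<And>s z. s \<in> simplex_set \<Longrightarrow> z \<in> simplex_set \<Longrightarrow> dist z s < \<delta> \<Longrightarrow> dist (H z) (H s) < \<epsilon> / d"
    using \<open>\<epsilon> > 0\<close> d unfolding uniformly_continuous_on_def by (metis divide_pos_pos)
  define K where "K = 2 * M / \<delta>\<^sup>2"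
  have K: "K > 0" using M \<delta> by (simp add: K_def)
  show thesis
  proof (rule that[of "K * d * d"])
    show "0 \<le> K * d * d" using K d by simp
    fix s x :: "real ^ 'd"
    assume s: "s \<in> simplex_set" and x: "x \<in> simplex_set"
    define N where "N = (\<Sum>i\<in>UNIV. (x $ i - s $ i)\<^sup>2)"
    have N: "N = (norm (x - s))\<^sup>2"
      by (simp add: N_def norm_vec_def L2_set_def sum_nonneg)
    have N0: "N \<ge> 0" by (simp add: N)
    have "\<bar>f x - taylor2 f s x\<bar> \<le> (\<epsilon> / d + K * N) * (\<Sum>i\<in>UNIV. \<bar>x $ i - s $ i\<bar>)\<^sup>2"
    proof (rule taylor2_remainder[OF f s x])
      fix z i j
      assume z: "z \<in> simplex_set" "norm (z - s) \<le> norm (x - s)"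
      show "\<bar>partial_deriv i (partial_deriv j f) z - partial_deriv i (partial_deriv j f) s\<bar> \<le> \<epsilon> / d + K * N"
      proof (cases "norm (x - s) < \<delta>")
        case True
        have "\<bar>(H z - H s) $ i $ j\<bar> \<le> norm ((H z - H s) $ i)" by (rule component_le_norm_cart)
        also have "\<dots> \<le> norm (H z - H s)" by (rule Finite_Cartesian_Product.norm_nth_le)
        also have "\<dots> \<le> \<epsilon> / d" using \<delta>(2)[OF s z(1)] z(2) True by (simp add: dist_norm)
        finally show ?thesis using N0 K by (simp add: H_def add_increasing2)
      next
        case False
        then have "\<delta>\<^sup>2 \<le> N" unfolding N using \<delta>(1) by (intro power_mono) auto
        then have "2 * M \<le> K * N" using \<delta>(1) M(1) by (simp add: K_def field_simps)
        moreover have "\<epsilon> / d > 0" using d \<open>\<epsilon> > 0\<close> by simp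
        ultimately show ?thesis using M(2)[OF z(1), of i j] M(2)[OF s, of i j] by linarith
      qed
    qed
    also have "(\<Sum>i\<in>UNIV. \<bar>x $ i - s $ i\<bar>)\<^sup>2 \<le> d * N"
      using sum_squared_le_sum_of_squares[of "\<lambda>i. \<bar>x $ i - s $ i\<bar>" UNIV] by (simp add: d_def N_def mult.commute)
    then have "(\<epsilon> / d + K * N) * (\<Sum>i\<in>UNIV. \<bar>x $ i - s $ i\<bar>)\<^sup>2 \<le> (\<epsilon> / d + K * N) * (d * N)"
      using N0 K d \<open>\<epsilon> > 0\<close> by (intro mult_left_mono) auto
    also have "\<dots> = \<epsilon> * N + K * d * N\<^sup>2" using d by (simp add: field_simps power2_eq_square)
    also have "N\<^sup>2 \<le> d * (\<Sum>i\<in>UNIV. (x $ i - s $ i) ^ 4)"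
      using sum_squared_le_sum_of_squares[of "\<lambda>i. (x $ i - s $ i)\<^sup>2" UNIV]
      by (simp add: d_def N_def mult.commute power_mult[symmetric])
    then have "\<epsilon> * N + K * d * N\<^sup>2 \<le> \<epsilon> * N + K * d * (d * (\<Sum>i\<in>UNIV. (x $ i - s $ i) ^ 4))"
      using K d by simp
    also have "\<dots> = (\<Sum>i\<in>UNIV. \<epsilon> * (x $ i - s $ i)\<^sup>2 + K * d * d * (x $ i - s $ i) ^ 4)"
      by (simp add: N_def sum.distrib sum_distrib_left mult_ac)
    finally show "\<bar>f x - taylor2 f s x\<bar> \<le> (\<Sum>i\<in>UNIV. \<epsilon> * (x $ i - s $ i)\<^sup>2 + K * d * d * (x $ i - s $ i) ^ 4)" .
  qed
qed

text \<open>
  The operator sees the Taylor polynomial only through the first two centred moments, and inserting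
  their leading terms yields exactly \<^const>\<open>g_fun\<close>.
\<close>

lemma smooth_taylor2:
  fixes f :: "real ^ 'd \<Rightarrow> real"
  assumes f: "twice_cont_diff_on_simplex f"
  obtains C where "C \<ge> 0" "\<And>b s. 0 < b \<Longrightarrow> b \<le> 1 \<Longrightarrow> s \<in> simplex_set \<Longrightarrow>
    \<bar>dirichlet_smooth b (taylor2 f s) s - f s - b * g_fun f s\<bar> \<le> C * b\<^sup>2"
proof -
  obtain M where M: "M > 0" "\<And>s i. s \<in> simplex_set \<Longrightarrow> \<bar>partial_deriv i f s\<bar> \<le> M"
    "\<And>s i j. s \<in> simplex_set \<Longrightarrow> \<bar>partial_deriv i (partial_deriv j f) s\<bar> \<le> M"
    using simplex_derivs_bound[OF f] by metis
  obtain C1 where C1: "C1 \<ge> 0" "\<And>b (s :: real ^ 'd) (i :: 'd). 0 < b \<Longrightarrow> b \<le> 1 \<Longrightarrow> s \<in> simplex_set \<Longrightarrow>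
     \<bar>dirichlet_smooth b (\<lambda>x. x $ i - s $ i) s - b * (1 - (real CARD('d) + 1) * s $ i)\<bar> \<le> C1 * b\<^sup>2"
    by (rule smooth_first_moment_bound) blast
  obtain C2 where C2: "C2 \<ge> 0" "\<And>b (s :: real ^ 'd) (i :: 'd) (j :: 'd). 0 < b \<Longrightarrow> b \<le> 1 \<Longrightarrow> s \<in> simplex_set \<Longrightarrow>
     \<bar>dirichlet_smooth b (\<lambda>x. (x $ i - s $ i) * (x $ j - s $ j)) s
        - b * (s $ i * ((if i = j then 1 else 0) - s $ j))\<bar> \<le> C2 * b\<^sup>2"
    by (rule smooth_second_moment_bound) blast
  define d where "d = real CARD('d)"
  show thesis
  proof (rule that[of "d * (M * C1) + 1 / 2 * (d * (d * (M * C2)))"])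
    show "0 \<le> d * (M * C1) + 1 / 2 * (d * (d * (M * C2)))" using M C1 C2 by (simp add: d_def)
    fix b :: real and s :: "real ^ 'd"
    assume b: "0 < b" "b \<le> 1" and s: "s \<in> simplex_set"
    define m1 where "m1 i = dirichlet_smooth b (\<lambda>x. x $ i - s $ i) s" for i
    define m2 where "m2 i j = dirichlet_smooth b (\<lambda>x. (x $ i - s $ i) * (x $ j - s $ j)) s" for i j
    define e1 where "e1 i = m1 i - b * (1 - (real CARD('d) + 1) * s $ i)" for i
    define e2 where "e2 i j = m2 i j - b * (s $ i * ((if i = j then 1 else 0) - s $ j))" for i j
    have "dirichlet_smooth b (taylor2 f s) s = f s + (\<Sum>i\<in>UNIV. partial_deriv i f s * m1 i)
      + 1 / 2 * (\<Sum>i\<in>UNIV. \<Sum>j\<in>UNIV. partial_deriv i (partial_deriv j f) s * m2 i j)"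
    proof -
      have "dirichlet_smooth b (taylor2 f s) s
        = dirichlet_smooth b (\<lambda>x. f s) s + dirichlet_smooth b (\<lambda>x. \<Sum>i\<in>UNIV. partial_deriv i f s * (x $ i - s $ i)) s
        + 1 / 2 * dirichlet_smooth b (\<lambda>x. \<Sum>i\<in>UNIV. \<Sum>j\<in>UNIV. partial_deriv i (partial_deriv j f) s * ((x $ i - s $ i) * (x $ j - s $ j))) s"
      proof -
        define P where "P x = (\<Sum>i\<in>UNIV. partial_deriv i f s * (x $ i - s $ i))" for x
        define Q where "Q x = (\<Sum>i\<in>UNIV. \<Sum>j\<in>UNIV. partial_deriv i (partial_deriv j f) s * ((x $ i - s $ i) * (x $ j - s $ j)))" for x
        have P: "simplex_bounded P"
          unfolding P_def[abs_def] by (intro simplex_bounded_mult simplex_bounded_sum simplex_bounded_diff simplex_bounded_const simplex_bounded_nth)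
        have Q: "simplex_bounded Q"
          unfolding Q_def[abs_def] by (intro simplex_bounded_mult simplex_bounded_sum simplex_bounded_diff simplex_bounded_const simplex_bounded_nth)
        have "taylor2 f s = (\<lambda>x. (f s + P x) + 1 / 2 * Q x)"
          by (simp add: taylor2_def P_def Q_def fun_eq_iff)
        moreover have "dirichlet_smooth b (\<lambda>x. (f s + P x) + 1 / 2 * Q x) s
            = dirichlet_smooth b (\<lambda>x. f s) s + dirichlet_smooth b P s + 1 / 2 * dirichlet_smooth b Q s"
          by (simp only: smooth_add[OF b(1) s simplex_bounded_add[OF simplex_bounded_const P] simplex_bounded_mult[OF simplex_bounded_const Q]]
            smooth_add[OF b(1) s simplex_bounded_const P] smooth_cmult[OF b(1) s])
        ultimately show ?thesis by (simp only: P_def[abs_def] Q_def[abs_def])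
      qed
      also have "dirichlet_smooth b (\<lambda>x. \<Sum>i\<in>UNIV. partial_deriv i f s * (x $ i - s $ i)) s = (\<Sum>i\<in>UNIV. partial_deriv i f s * m1 i)"
        unfolding m1_def by (subst smooth_sum[OF b(1) s]) (auto simp: smooth_cmult[OF b(1) s] intro!: simplex_bounded_mult simplex_bounded_diff)
      also have "dirichlet_smooth b (\<lambda>x. \<Sum>i\<in>UNIV. \<Sum>j\<in>UNIV. partial_deriv i (partial_deriv j f) s * ((x $ i - s $ i) * (x $ j - s $ j))) s
         = (\<Sum>i\<in>UNIV. \<Sum>j\<in>UNIV. partial_deriv i (partial_deriv j f) s * m2 i j)"
        unfolding m2_def
        by (simp add: smooth_sum[OF b(1) s] smooth_cmult[OF b(1) s] simplex_bounded_sum simplex_bounded_mult simplex_bounded_diff)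
      finally show ?thesis using dirichlet_smooth_const[OF b(1) s] by simp
    qed
    also have "\<dots> - f s - b * g_fun f s = (\<Sum>i\<in>UNIV. partial_deriv i f s * e1 i)
      + 1 / 2 * (\<Sum>i\<in>UNIV. \<Sum>j\<in>UNIV. partial_deriv i (partial_deriv j f) s * e2 i j)"
      unfolding g_fun_def e1_def e2_def
      by (simp add: right_diff_distrib sum_subtractf sum_distrib_left distrib_left mult_ac)
    also have "\<bar>\<dots>\<bar> \<le> (\<Sum>i::'d\<in>UNIV. M * (C1 * b\<^sup>2)) + 1 / 2 * (\<Sum>i::'d\<in>UNIV. \<Sum>j::'d\<in>UNIV. M * (C2 * b\<^sup>2))"
    proof -
      have "\<bar>e1 i\<bar> \<le> C1 * b\<^sup>2" for i unfolding e1_def m1_def by (rule C1(2)[OF b s])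
      then have "\<bar>\<Sum>i\<in>UNIV. partial_deriv i f s * e1 i\<bar> \<le> (\<Sum>i::'d\<in>UNIV. M * (C1 * b\<^sup>2))"
        using M C1 s by (intro order_trans[OF sum_abs] sum_mono) (auto simp: abs_mult intro!: mult_mono)
      moreover have "\<bar>e2 i j\<bar> \<le> C2 * b\<^sup>2" for i j unfolding e2_def m2_def by (rule C2(2)[OF b s])
      then have "\<bar>\<Sum>i\<in>UNIV. \<Sum>j\<in>UNIV. partial_deriv i (partial_deriv j f) s * e2 i j\<bar> \<le> (\<Sum>i::'d\<in>UNIV. \<Sum>j::'d\<in>UNIV. M * (C2 * b\<^sup>2))"
        using M C2 s by (intro order_trans[OF sum_abs] sum_mono) (auto simp: abs_mult intro!: mult_mono)
      ultimately show ?thesis by linarith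
    qed
    also have "\<dots> = (d * (M * C1) + 1 / 2 * (d * (d * (M * C2)))) * b\<^sup>2"
      by (simp add: d_def algebra_simps)
    finally show "\<bar>dirichlet_smooth b (taylor2 f s) s - f s - b * g_fun f s\<bar> \<le> (d * (M * C1) + 1 / 2 * (d * (d * (M * C2)))) * b\<^sup>2" .
  qed
qed

lemma smooth_second_moment_le:
  obtains C where "C \<ge> 0" "\<And>b (s :: real ^ 'd) (i :: 'd). 0 < b \<Longrightarrow> b \<le> 1 \<Longrightarrow> s \<in> simplex_set \<Longrightarrow>
     dirichlet_smooth b (\<lambda>x. (x $ i - s $ i)\<^sup>2) s \<le> C * b"
proof -
  obtain C2 where C2: "C2 \<ge> 0" "\<And>b (s :: real ^ 'd) (i :: 'd) (j :: 'd). 0 < b \<Longrightarrow> b \<le> 1 \<Longrightarrow> s \<in> simplex_set \<Longrightarrow>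
     \<bar>dirichlet_smooth b (\<lambda>x. (x $ i - s $ i) * (x $ j - s $ j)) s
        - b * (s $ i * ((if i = j then 1 else 0) - s $ j))\<bar> \<le> C2 * b\<^sup>2"
    by (rule smooth_second_moment_bound) blast
  show thesis
  proof (rule that[of "1 + C2"])
    fix b :: real and s :: "real ^ 'd" and i
    assume b: "0 < b" "b \<le> 1" and s: "s \<in> simplex_set"
    have "s $ i * (1 - s $ i) \<le> 1" using simplex_nth(1,2)[OF s, of i] by (intro mult_le_one) auto
    then have "b * (s $ i * (1 - s $ i)) \<le> b" using b by (simp add: mult_left_le)
    moreover have "C2 * b\<^sup>2 \<le> C2 * b" using b C2(1) by (intro mult_left_mono) (auto simp: power2_eq_square mult_left_le)
    ultimately show "dirichlet_smooth b (\<lambda>x. (x $ i - s $ i)\<^sup>2) s \<le> (1 + C2) * b"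
      using C2(2)[OF b s, of i i] by (simp add: power2_eq_square distrib_right)
  qed (use C2 in simp)
qed

text \<open>
  The bias of the estimator is \<open>b g + o(b)\<close>, uniformly on the closed simplex. The Taylor remainder
  contributes at most \<open>\<epsilon>'\<close> times second moments of order \<open>b\<close>, plus a constant times fourth moments
  of order \<open>b\<^sup>2\<close>.
\<close>

theorem smooth_bias_uniform:
  fixes f :: "real ^ 'd \<Rightarrow> real"
  assumes f: "twice_cont_diff_on_simplex f" and [measurable]: "f \<in> borel_measurable borel" and "\<epsilon> > 0"
  obtains b0 where "0 < b0" "b0 \<le> 1" "\<And>b s. 0 < b \<Longrightarrow> b < b0 \<Longrightarrow> s \<in> simplex_set \<Longrightarrow>
    \<bar>dirichlet_smooth b f s - f s - b * g_fun f s\<bar> \<le> \<epsilon> * b"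
proof -
  have sbf: "simplex_bounded f"
    by (rule simplex_bounded_continuous_on[OF _ continuous_on_simplex_derivs(1)[OF f]]) simp
  have sbt: "simplex_bounded (taylor2 f s)" for s
    unfolding taylor2_def[abs_def]
    by (intro simplex_bounded_add simplex_bounded_mult simplex_bounded_sum simplex_bounded_diff simplex_bounded_const simplex_bounded_nth)
  obtain C2 where C2: "C2 \<ge> 0" "\<And>b (s :: real ^ 'd) (i :: 'd). 0 < b \<Longrightarrow> b \<le> 1 \<Longrightarrow> s \<in> simplex_set \<Longrightarrow>
     dirichlet_smooth b (\<lambda>x. (x $ i - s $ i)\<^sup>2) s \<le> C2 * b"
    by (rule smooth_second_moment_le) blast
  obtain C4 where C4: "C4 \<ge> 0" "\<And>b (s :: real ^ 'd) (i :: 'd). 0 < b \<Longrightarrow> b \<le> 1 \<Longrightarrow> s \<in> simplex_set \<Longrightarrow>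
     dirichlet_smooth b (\<lambda>x. (x $ i - s $ i) ^ 4) s \<le> C4 * b\<^sup>2"
    by (rule smooth_fourth_moment_bound) blast
  obtain C where C: "C \<ge> 0" "\<And>b s. 0 < b \<Longrightarrow> b \<le> 1 \<Longrightarrow> s \<in> simplex_set \<Longrightarrow>
    \<bar>dirichlet_smooth b (taylor2 f s) s - f s - b * g_fun f s\<bar> \<le> C * b\<^sup>2"
    by (rule smooth_taylor2[OF f]) blast
  define d where "d = real CARD('d)"
  have d: "d > 0" by (simp add: d_def)
  define \<epsilon>' where "\<epsilon>' = \<epsilon> / (2 * d * (C2 + 1))"
  have \<epsilon>': "\<epsilon>' > 0" using \<open>\<epsilon> > 0\<close> C2 d by (simp add: \<epsilon>'_def)
  obtain R where R: "R \<ge> 0" "\<And>s x. s \<in> simplex_set \<Longrightarrow> x \<in> simplex_set \<Longrightarrow>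
    \<bar>f x - taylor2 f s x\<bar> \<le> (\<Sum>i\<in>UNIV. \<epsilon>' * (x $ i - s $ i)\<^sup>2 + R * (x $ i - s $ i) ^ 4)"
    by (rule taylor2_remainder_uniform[OF f \<epsilon>']) blast
  define K where "K = d * (R * C4) + C + 1"
  have K: "K > 0" using d R C4 C by (simp add: K_def add_nonneg_pos)
  show thesis
  proof (rule that[of "min 1 (\<epsilon> / (2 * K))"])
    fix b :: real and s :: "real ^ 'd"
    assume b: "0 < b" "b < min 1 (\<epsilon> / (2 * K))" and s: "s \<in> simplex_set"
    then have b1: "b \<le> 1" and bK: "K * b \<le> \<epsilon> / 2" using K by (auto simp: field_simps)
    have sb2: "simplex_bounded (\<lambda>x. (x $ i - s $ i) ^ k)" for i k
      by (intro simplex_bounded_power simplex_bounded_diff simplex_bounded_const simplex_bounded_nth)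
    have sbi: "simplex_bounded (\<lambda>x. \<epsilon>' * (x $ i - s $ i)\<^sup>2 + R * (x $ i - s $ i) ^ 4)" for i
      by (intro simplex_bounded_add simplex_bounded_mult simplex_bounded_const sb2)
    have "dirichlet_smooth b f s - dirichlet_smooth b (taylor2 f s) s = dirichlet_smooth b (\<lambda>x. f x - taylor2 f s x) s"
      by (rule smooth_diff[OF b(1) s sbf sbt, symmetric])
    also have "\<bar>\<dots>\<bar> \<le> dirichlet_smooth b (\<lambda>x. \<Sum>i\<in>UNIV. \<epsilon>' * (x $ i - s $ i)\<^sup>2 + R * (x $ i - s $ i) ^ 4) s"
      by (rule smooth_abs_le[OF b(1) s simplex_bounded_diff[OF sbf sbt] simplex_bounded_sum[OF sbi]])
        (rule R(2)[OF s])
    also have "\<dots> = (\<Sum>i\<in>UNIV. \<epsilon>' * dirichlet_smooth b (\<lambda>x. (x $ i - s $ i)\<^sup>2) s + R * dirichlet_smooth b (\<lambda>x. (x $ i - s $ i) ^ 4) s)"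
      by (simp only: smooth_sum[OF b(1) s finite sbi] smooth_cmult[OF b(1) s]
          smooth_add[OF b(1) s simplex_bounded_mult[OF simplex_bounded_const sb2] simplex_bounded_mult[OF simplex_bounded_const sb2]])
    also have "\<dots> \<le> (\<Sum>i::'d\<in>UNIV. \<epsilon>' * (C2 * b) + R * (C4 * b\<^sup>2))"
      using C2 C4 \<epsilon>' R b1 b s by (intro sum_mono add_mono mult_left_mono) auto
    also have "\<dots> = d * \<epsilon>' * C2 * b + d * (R * C4) * b\<^sup>2" by (simp add: d_def algebra_simps)
    finally have "\<bar>dirichlet_smooth b f s - f s - b * g_fun f s\<bar> \<le> d * \<epsilon>' * C2 * b + d * (R * C4) * b\<^sup>2 + C * b\<^sup>2"
      using C(2)[OF b(1) b1 s] by linarith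
    also have "\<dots> \<le> \<epsilon> / 2 * b + K * b * b"
    proof -
      have "d * \<epsilon>' * C2 = \<epsilon> / 2 * (C2 / (C2 + 1))" using d C2 by (simp add: \<epsilon>'_def)
      also have "\<dots> \<le> \<epsilon> / 2" using \<open>\<epsilon> > 0\<close> C2 by (intro mult_left_le) auto
      finally have "d * \<epsilon>' * C2 * b \<le> \<epsilon> / 2 * b" using b by (intro mult_right_mono) auto
      moreover have "K * b * b = d * (R * C4) * b\<^sup>2 + C * b\<^sup>2 + b\<^sup>2"
        by (simp add: K_def algebra_simps power2_eq_square)
      ultimately show ?thesis using zero_le_power2[of b] by linarith
    qed
    also have "\<dots> \<le> \<epsilon> / 2 * b + \<epsilon> / 2 * b" using bK b by (intro add_mono mult_right_mono) auto
    finally show "\<bar>dirichlet_smooth b f s - f s - b * g_fun f s\<bar> \<le> \<epsilon> * b" by simp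
  qed (use \<open>\<epsilon> > 0\<close> K in auto)
qed

section \<open>The square of the kernel\<close>

text \<open>
  After duplication, the dependence of the squared kernel's constant on \<open>s\<close> is through this ratio.
  Log-convexity gives explicit two-sided bounds for it, so that Stirling's formula can be avoided.
\<close>

definition half_ratio :: "real \<Rightarrow> real" where
  "half_ratio y = Gamma (y + 1 / 2) / Gamma (y + 1)"

lemma Gamma_plus1_pos: "x > 0 \<Longrightarrow> Gamma (x + 1) = x * Gamma (x :: real)"
  by (rule Gamma_plus1) (auto elim!: nonpos_Ints_cases)

lemma Gamma_midpoint_sq_le:
  fixes x :: real
  assumes "x > 0"
  shows "(Gamma (x + 1 / 2))\<^sup>2 \<le> Gamma x * Gamma (x + 1)"
proof -
  have g: "Gamma x > 0" "Gamma (x + 1 / 2) > 0" "Gamma (x + 1) > 0"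
    using assms by (auto intro!: Gamma_real_pos)
  have "(ln \<circ> Gamma) ((1 - 1 / 2) *\<^sub>R x + (1 / 2) *\<^sub>R (x + 1)) \<le> (1 - 1 / 2) * (ln \<circ> Gamma) x + 1 / 2 * (ln \<circ> Gamma) (x + 1)"
    using assms by (intro convex_onD[OF log_convex_Gamma_real]) auto
  moreover have "(1 - 1 / 2) *\<^sub>R x + (1 / 2) *\<^sub>R (x + 1) = x + 1 / 2" by (simp add: field_simps)
  ultimately have "2 * ln (Gamma (x + 1 / 2)) \<le> ln (Gamma x) + ln (Gamma (x + 1))"
    by simp
  then have "ln ((Gamma (x + 1 / 2))\<^sup>2) \<le> ln (Gamma x * Gamma (x + 1))"
    using g by (simp add: ln_mult ln_realpow)
  then show ?thesis using g by simp
qed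

text \<open>
  Both bounds are the midpoint inequality for the logarithm of Gamma, at \<open>y\<close> and at \<open>y + 1 / 2\<close>.
\<close>

lemma half_ratio_bounds:
  assumes "y > 0"
  shows "sqrt (y / (y + 1 / 2)) \<le> sqrt y * half_ratio y" "sqrt y * half_ratio y \<le> 1" "half_ratio y > 0"
proof -
  have g: "Gamma y > 0" "Gamma (y + 1 / 2) > 0" "Gamma (y + 1) > 0"
    using assms by (auto intro!: Gamma_real_pos)
  show pos: "half_ratio y > 0" using g by (simp add: half_ratio_def)
  have "y * (Gamma (y + 1 / 2))\<^sup>2 \<le> y * (Gamma y * Gamma (y + 1))"
    using assms by (intro mult_left_mono Gamma_midpoint_sq_le) auto
  also have "\<dots> = (Gamma (y + 1))\<^sup>2"
    using Gamma_plus1_pos[OF assms] by (simp add: power2_eq_square)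
  finally have "y * (Gamma (y + 1 / 2))\<^sup>2 \<le> (Gamma (y + 1))\<^sup>2" .
  then have "y * (half_ratio y)\<^sup>2 \<le> 1" using g by (simp add: half_ratio_def power_divide)
  then have "sqrt (y * (half_ratio y)\<^sup>2) \<le> 1" by simp
  then show "sqrt y * half_ratio y \<le> 1" using pos by (simp add: real_sqrt_mult)
  have "(Gamma (y + 1 / 2 + 1 / 2))\<^sup>2 \<le> Gamma (y + 1 / 2) * Gamma (y + 1 / 2 + 1)"
    using assms by (intro Gamma_midpoint_sq_le) auto
  also have "Gamma (y + 1 / 2 + 1) = (y + 1 / 2) * Gamma (y + 1 / 2)"
    using assms by (intro Gamma_plus1_pos) auto
  finally have "(Gamma (y + 1))\<^sup>2 \<le> (y + 1 / 2) * (Gamma (y + 1 / 2))\<^sup>2"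
    by (simp add: power2_eq_square ac_simps)
  then have "1 \<le> (y + 1 / 2) * (half_ratio y)\<^sup>2"
    using g by (simp add: half_ratio_def power_divide)
  then have "1 / (y + 1 / 2) \<le> (half_ratio y)\<^sup>2"
    using assms by (simp add: pos_divide_le_eq mult.commute)
  from mult_left_mono[OF this, of y] have "y / (y + 1 / 2) \<le> y * (half_ratio y)\<^sup>2"
    using assms by simp
  then have "sqrt (y / (y + 1 / 2)) \<le> sqrt (y * (half_ratio y)\<^sup>2)" by (rule real_sqrt_le_mono)
  then show "sqrt (y / (y + 1 / 2)) \<le> sqrt y * half_ratio y" using pos by (simp add: real_sqrt_mult)
qed

lemma sqrt_half_ratio_tendsto: "((\<lambda>y. sqrt y * half_ratio y) \<longlongrightarrow> 1) at_top"
proof (rule tendsto_sandwich)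
  show "\<forall>\<^sub>F y in at_top. sqrt (y / (y + 1 / 2)) \<le> sqrt y * half_ratio y"
    using eventually_gt_at_top[of 0] by eventually_elim (rule half_ratio_bounds)
  show "\<forall>\<^sub>F y in at_top. sqrt y * half_ratio y \<le> 1"
    using eventually_gt_at_top[of 0] by eventually_elim (rule half_ratio_bounds)
  show "((\<lambda>y::real. sqrt (y / (y + 1 / 2))) \<longlongrightarrow> 1) at_top" by real_asymp
qed simp

text \<open>
  Legendre's duplication formula, transferred from the complex numbers and rearranged so that
  \<open>Gamma (2 y + 1) / (Gamma (y + 1))\<^sup>2\<close> becomes \<open>4 powr y / sqrt pi * half_ratio y\<close>.
\<close>

lemma Gamma_double:
  fixes y :: real
  assumes "y \<ge> 0"
  shows "Gamma (2 * y + 1) = 4 powr y / sqrt pi * Gamma (y + 1 / 2) * Gamma (y + 1)"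
proof -
  have nz: "complex_of_real x \<notin> \<int>\<^sub>\<le>\<^sub>0" if "x > 0" for x
    using that by (auto elim!: nonpos_Ints_cases simp: complex_eq_iff)
  define z where "z = y + 1 / 2"
  have z: "z > 0" "z + 1 / 2 = y + 1" "2 * z = 2 * y + 1"
    using assms by (auto simp: z_def)
  have c: "complex_of_real z + 1 / 2 = of_real (z + 1 / 2)" "2 * complex_of_real z = of_real (2 * z)"
    "(1 - complex_of_real (2 * z)) * of_real (ln 2) = of_real ((1 - 2 * z) * ln 2)"
    by simp_all
  have "Gamma (complex_of_real z) * Gamma (complex_of_real z + 1 / 2)
      = exp ((1 - 2 * complex_of_real z) * of_real (ln 2)) * of_real (sqrt pi) * Gamma (2 * complex_of_real z)"
    using nz[of z] nz[of "z + 1 / 2"] z by (intro Gamma_legendre_duplication) (simp_all only: c, simp_all)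
  then have "Gamma z * Gamma (z + 1 / 2) = exp ((1 - 2 * z) * ln 2) * sqrt pi * Gamma (2 * z)"
    unfolding c Gamma_complex_of_real exp_of_real of_real_mult[symmetric] of_real_eq_iff .
  moreover have "exp ((1 - 2 * z) * ln 2) = 1 / 4 powr y"
  proof -
    have "ln 4 = 2 * ln (2::real)" using ln_realpow[of 2 2] by simp
    then have "(1 - 2 * z) * ln 2 = - (y * ln 4)" by (simp add: z_def algebra_simps)
    then show ?thesis by (simp add: powr_def exp_minus divide_inverse)
  qed
  ultimately have "Gamma z * Gamma (y + 1) = 1 / 4 powr y * sqrt pi * Gamma (2 * y + 1)"
    unfolding z by simp
  then have "4 powr y / sqrt pi * (Gamma z * Gamma (y + 1)) = Gamma (2 * y + 1)"
    by simp
  then show ?thesis by (simp add: z_def mult.assoc)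
qed

definition kernel_const :: "real \<Rightarrow> real ^ 'd \<Rightarrow> real" where
  "kernel_const b s = Gamma (1 / b + (real CARD('d) + 1))
     / (Gamma ((1 - l1_norm s) / b + 1) * (\<Prod>i\<in>UNIV. Gamma (s $ i / b + 1)))"

text \<open>
  The factor in \<open>(dirichlet_kernel b s)\<^sup>2 = kernel_sq_factor b s * dirichlet_kernel (b / 2) s\<close>: it is
  the integral of the squared kernel and thus the local size of the variance.
\<close>

definition kernel_sq_factor :: "real \<Rightarrow> real ^ 'd \<Rightarrow> real" where
  "kernel_sq_factor b s = (kernel_const b s)\<^sup>2 / kernel_const (b / 2) s"

lemma kernel_const_pos:
  assumes "b > 0" "s \<in> simplex_set"
  shows "kernel_const b s > 0"
  using simplex_nth[OF assms(2)] assms(1) unfolding kernel_const_def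
  by (intro divide_pos_pos mult_pos_pos prod_pos Gamma_real_pos add_nonneg_pos) auto

lemma kernel_sq_factor_pos: "b > 0 \<Longrightarrow> s \<in> simplex_set \<Longrightarrow> kernel_sq_factor b s > 0"
  unfolding kernel_sq_factor_def by (intro divide_pos_pos zero_less_power kernel_const_pos) auto

lemma dirichlet_kernel_eq:
  assumes "b > 0" "s \<in> simplex_set"
  shows "dirichlet_kernel b s x = kernel_const b s *
     (indicator simplex_set x * (1 - l1_norm x) powr ((1 - l1_norm s) / b) * (\<Prod>i\<in>UNIV. x $ i powr (s $ i / b)))"
  unfolding dirichlet_kernel_def dirichlet_density_eq_weight kernel_parameters(3)[OF assms]
  by (simp add: kernel_const_def dirichlet_weight_def)

text \<open>
  Squaring doubles all exponents \<open>s\<^sub>i / b\<close>, which is the same as halving the bandwidth.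
\<close>

lemma dirichlet_kernel_square:
  assumes "b > 0" "s \<in> simplex_set"
  shows "(dirichlet_kernel b s x)\<^sup>2 = kernel_sq_factor b s * dirichlet_kernel (b / 2) s x"
proof -
  have sq: "(z powr (a / b))\<^sup>2 = z powr (a / (b / 2))" for z a :: real
    by (simp add: power2_eq_square powr_add[symmetric] add_divide_distrib[symmetric] mult.commute)
  have "(dirichlet_kernel b s x)\<^sup>2 = (kernel_const b s)\<^sup>2 *
     (indicator simplex_set x * (1 - l1_norm x) powr ((1 - l1_norm s) / (b / 2)) * (\<Prod>i\<in>UNIV. x $ i powr (s $ i / (b / 2))))"
    unfolding dirichlet_kernel_eq[OF assms] power_mult_distrib prod_power_distrib sq
    by (simp add: indicator_def)
  also have "\<dots> = kernel_sq_factor b s * dirichlet_kernel (b / 2) s x"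
    using assms kernel_const_pos[of "b / 2" s]
    by (subst dirichlet_kernel_eq) (auto simp: kernel_sq_factor_def)
  finally show ?thesis .
qed

lemma sqrt_prod: "(\<And>i. i \<in> I \<Longrightarrow> h i \<ge> 0) \<Longrightarrow> sqrt (\<Prod>i\<in>I. h i) = (\<Prod>i\<in>I. sqrt (h i))"
  by (induction I rule: infinite_finite_induct) (auto simp: real_sqrt_mult)

text \<open>
  The quotient of the shifts of Gamma by \<open>d\<close> that arises when \<open>Gamma (u + d + 1)\<close> is written through
  \<open>Gamma (u + 1)\<close>, normalised to tend to 1.
\<close>

definition poch_ratio :: "nat \<Rightarrow> real \<Rightarrow> real" where
  "poch_ratio d u = (\<Prod>j<d. 2 * (u + 1 + real j)\<^sup>2 / (u * (2 * u + 1 + real j)))"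

lemma poch_ratio_tendsto: "(poch_ratio d \<longlongrightarrow> 1) at_top"
proof -
  have "((\<lambda>u. \<Prod>j<d. 2 * (u + 1 + real j)\<^sup>2 / (u * (2 * u + 1 + real j))) \<longlongrightarrow> (\<Prod>j<d. 1)) at_top"
    by (intro tendsto_prod) real_asymp
  then show ?thesis by (simp add: poch_ratio_def[abs_def])
qed

lemma poch_ratio_pos: "u > 0 \<Longrightarrow> poch_ratio d u > 0"
  unfolding poch_ratio_def by (intro prod_pos divide_pos_pos mult_pos_pos zero_less_power) auto

lemma poch_ratio_eq:
  assumes "u > 0"
  shows "poch_ratio d u = 2 ^ d * (pochhammer (u + 1) d)\<^sup>2 / (u ^ d * pochhammer (2 * u + 1) d)"
  by (simp add: poch_ratio_def pochhammer_prod prod_dividef prod.distrib prod_power_distrib atLeast0LessThan)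

lemma Gamma_shift:
  fixes u :: real
  assumes "u > 0"
  shows "Gamma (u + (real d + 1)) = pochhammer (u + 1) d * Gamma (u + 1)"
proof -
  have nz: "u + 1 \<notin> \<int>\<^sub>\<le>\<^sub>0" using assms by (auto elim!: nonpos_Ints_cases)
  have g: "Gamma (u + 1) > 0" using assms by (intro Gamma_real_pos) simp
  have cancel: "x = x / y * y" if "y > 0" for x y :: real using that by simp
  have "u + (real d + 1) = u + 1 + real d" by simp
  then show ?thesis unfolding pochhammer_Gamma[OF nz] by (simp only: cancel[OF g, symmetric])
qed

lemma psi_interior:
  fixes s :: "real ^ 'd"
  assumes "\<And>i. 0 < s $ i" "l1_norm s < 1"
  shows "psi s = 1 / (2 ^ CARD('d) * sqrt pi ^ CARD('d) * sqrt (1 - l1_norm s) * (\<Prod>i\<in>UNIV. sqrt (s $ i)))"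
proof -
  have nn: "0 \<le> s $ i" "0 \<le> 1 - l1_norm s" for i
    using assms by (auto simp: less_imp_le)
  have "0 \<le> (4 * pi) ^ CARD('d) * (1 - l1_norm s) * (\<Prod>i\<in>UNIV. s $ i)"
    using nn by (intro mult_nonneg_nonneg prod_nonneg) auto
  then have "psi s = 1 / sqrt ((4 * pi) ^ CARD('d) * (1 - l1_norm s) * (\<Prod>i\<in>UNIV. s $ i))"
    unfolding psi_def by (simp add: powr_minus powr_half_sqrt inverse_eq_divide)
  also have "sqrt ((4 * pi) ^ CARD('d) * (1 - l1_norm s) * (\<Prod>i\<in>UNIV. s $ i))
    = 2 ^ CARD('d) * sqrt pi ^ CARD('d) * sqrt (1 - l1_norm s) * (\<Prod>i\<in>UNIV. sqrt (s $ i))"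
    using nn by (simp add: real_sqrt_mult real_sqrt_power sqrt_prod power_mult_distrib)
  finally show ?thesis .
qed

text \<open>
  Writing \<open>u = 1 / b\<close>, the factor is a product of generalised central binomial coefficients
  \<open>Gamma (2 y + 1) / (Gamma (y + 1))\<^sup>2\<close> at \<open>y = s\<^sub>i u\<close> and \<open>y = (1 - l1_norm s) u\<close>, divided by the one at \<open>u\<close>. The
  exponentials \<open>4 powr y\<close> cancel because the arguments sum to \<open>u\<close>. The remaining ratios are
  \<open>\<tau> y / sqrt y\<close> with \<open>\<tau> \<le> 1\<close> and \<open>\<tau> \<longlongrightarrow> 1\<close>, and the square roots assemble to \<^const>\<open>psi\<close>.
\<close>

lemma kernel_sq_factor_eq:
  fixes s :: "real ^ 'd"
  assumes b: "b > 0" and s: "\<And>i. 0 < s $ i" "l1_norm s < 1"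
  defines "\<tau> \<equiv> \<lambda>y. sqrt y * half_ratio y"
  shows "b powr (real CARD('d) / 2) * kernel_sq_factor b s
     = psi s * poch_ratio CARD('d) (1 / b) * ((\<Prod>i\<in>UNIV. \<tau> (s $ i / b)) * \<tau> ((1 - l1_norm s) / b) / \<tau> (1 / b))"
proof -
  define d where "d = CARD('d)"
  define u where "u = 1 / b"
  have u: "u > 0" using b by (simp add: u_def)
  define r where "r = 1 - l1_norm s"
  have r: "r > 0" using s by (simp add: r_def)
  have sum1: "(\<Sum>i\<in>UNIV. s $ i) + r = 1"
    using s(1) by (simp add: r_def l1_norm_nonneg_eq less_imp_le)
  define c where "c y = Gamma (2 * y + 1) / (Gamma (y + 1))\<^sup>2" for y :: real
  have c: "c y = 4 powr y / sqrt pi * half_ratio y" if "y > 0" for y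
    using that Gamma_real_pos[of "y + 1"]
    by (simp add: c_def Gamma_double half_ratio_def power2_eq_square)
  have Gp: "Gamma (y + 1) > 0" "Gamma (2 * y + 1) > 0" if "y > 0" for y :: real
    using that by (auto intro!: Gamma_real_pos)
  have K1: "kernel_const b s = pochhammer (u + 1) d * Gamma (u + 1) / (Gamma (r * u + 1) * (\<Prod>i\<in>UNIV. Gamma (s $ i * u + 1)))"
    unfolding kernel_const_def d_def Gamma_shift[OF u, symmetric] by (simp add: u_def r_def)
  have K2: "kernel_const (b / 2) s = pochhammer (2 * u + 1) d * Gamma (2 * u + 1)
      / (Gamma (2 * (r * u) + 1) * (\<Prod>i\<in>UNIV. Gamma (2 * (s $ i * u) + 1)))"
  proof -
    have "Gamma (2 * u + (real d + 1)) = pochhammer (2 * u + 1) d * Gamma (2 * u + 1)"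
      using u by (intro Gamma_shift) simp
    then show ?thesis unfolding kernel_const_def d_def by (simp add: u_def r_def mult_ac)
  qed
  have A: "kernel_sq_factor b s = (\<Prod>i\<in>UNIV. c (s $ i * u)) * c (r * u) / c u
      * ((pochhammer (u + 1) d)\<^sup>2 / pochhammer (2 * u + 1) d)"
    unfolding kernel_sq_factor_def K1 K2 c_def prod_dividef
    by (simp add: power_mult_distrib power_divide prod_power_distrib mult_ac)
  have pow: "(\<Prod>i\<in>UNIV. 4 powr (s $ i * u)) * 4 powr (r * u) = 4 powr u"
  proof -
    have "(\<Prod>i\<in>UNIV. 4 powr (s $ i * u)) * 4 powr (r * u) = 4 powr ((\<Sum>i\<in>UNIV. s $ i * u) + r * u)"
      by (simp add: powr_add powr_sum)
    also have "(\<Sum>i\<in>UNIV. s $ i * u) + r * u = ((\<Sum>i\<in>UNIV. s $ i) + r) * u"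
      by (simp add: sum_distrib_right distrib_right)
    finally show ?thesis using sum1 by simp
  qed
  have "(\<Prod>i\<in>UNIV. c (s $ i * u)) * c (r * u)
      = ((\<Prod>i\<in>UNIV. 4 powr (s $ i * u)) * 4 powr (r * u)) / sqrt pi ^ d / sqrt pi
        * (\<Prod>i\<in>UNIV. half_ratio (s $ i * u)) * half_ratio (r * u)"
    using s(1) u r by (simp add: c prod.distrib prod_dividef d_def)
  then have B: "(\<Prod>i\<in>UNIV. c (s $ i * u)) * c (r * u) / c u
     = (\<Prod>i\<in>UNIV. half_ratio (s $ i * u)) * half_ratio (r * u) / half_ratio u / sqrt pi ^ d"
    unfolding pow using c[OF u] by simp
  have t: "half_ratio y = \<tau> y / sqrt y" if "y > 0" for y using that by (simp add: \<tau>_def)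
  have C: "(\<Prod>i\<in>UNIV. half_ratio (s $ i * u)) * half_ratio (r * u) / half_ratio u
     = ((\<Prod>i\<in>UNIV. \<tau> (s $ i * u)) * \<tau> (r * u) / \<tau> u) / ((\<Prod>i\<in>UNIV. sqrt (s $ i)) * sqrt r * sqrt u ^ d)"
    using s(1) u r by (simp add: t prod_dividef real_sqrt_mult prod.distrib d_def)
  have bd: "b powr (real d / 2) = 1 / sqrt u ^ d"
  proof -
    have "b powr (real d / 2) = (b powr (1 / 2)) ^ d"
      using b by (simp add: powr_power)
    also have "\<dots> = 1 / sqrt u ^ d" using b by (simp add: powr_half_sqrt u_def real_sqrt_divide power_divide)
    finally show ?thesis .
  qed
  have su: "sqrt u ^ d * sqrt u ^ d = u ^ d" using u by (simp add: power_mult_distrib[symmetric])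
  have P: "poch_ratio d u = 2 ^ d * ((pochhammer (u + 1) d)\<^sup>2 / pochhammer (2 * u + 1) d) / (sqrt u ^ d * sqrt u ^ d)"
    unfolding su poch_ratio_eq[OF u] by simp
  have psi: "psi s = 1 / (2 ^ d * sqrt pi ^ d * sqrt r * (\<Prod>i\<in>UNIV. sqrt (s $ i)))"
    using psi_interior[OF s] by (simp add: r_def d_def)
  have "b powr (real d / 2) * kernel_sq_factor b s
     = psi s * poch_ratio d u * ((\<Prod>i\<in>UNIV. \<tau> (s $ i * u)) * \<tau> (r * u) / \<tau> u)"
    unfolding A B C bd P psi by (simp add: mult_ac)
  then show ?thesis by (simp add: d_def u_def r_def)
qed

lemma psi_nonneg: "psi s \<ge> 0"
  by (simp add: psi_def)

definition dominating_factor :: "nat \<Rightarrow> real \<Rightarrow> real" where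
  "dominating_factor d b = poch_ratio d (1 / b) / (sqrt (1 / b) * half_ratio (1 / b))"

lemma dominating_factor_tendsto: "(dominating_factor d \<longlongrightarrow> 1) (at_right 0)"
proof -
  have inf: "filterlim (\<lambda>b::real. 1 / b) at_top (at_right 0)" by real_asymp
  have "((\<lambda>b. poch_ratio d (1 / b) / (sqrt (1 / b) * half_ratio (1 / b))) \<longlongrightarrow> 1 / 1) (at_right 0)"
    by (intro tendsto_divide filterlim_compose[OF poch_ratio_tendsto inf]
        filterlim_compose[OF sqrt_half_ratio_tendsto inf]) auto
  then show ?thesis by (simp add: dominating_factor_def[abs_def])
qed

text \<open>
  Dropping the factors \<open>\<tau> \<le> 1\<close> leaves \<^const>\<open>psi\<close> times a quantity independent of \<open>s\<close> that stays bounded as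
  \<open>b\<close> tends to 0. This is the majorant for dominated convergence.
\<close>

lemma kernel_sq_factor_le:
  fixes s :: "real ^ 'd"
  assumes b: "b > 0" and s: "\<And>i. 0 < s $ i" "l1_norm s < 1"
  shows "b powr (real CARD('d) / 2) * kernel_sq_factor b s \<le> dominating_factor CARD('d) b * psi s"
proof -
  let ?\<tau> = "\<lambda>y. sqrt y * half_ratio y"
  have \<tau>: "0 < ?\<tau> y" "?\<tau> y \<le> 1" if "y > 0" for y
    using half_ratio_bounds[OF that] that by auto
  have p: "0 < s $ i / b" "0 < (1 - l1_norm s) / b" "0 < 1 / b" for i using b s by auto
  have "(\<Prod>i\<in>UNIV. ?\<tau> (s $ i / b)) * ?\<tau> ((1 - l1_norm s) / b) \<le> 1"
    by (rule mult_le_one[OF prod_le_1 less_imp_le[OF \<tau>(1)[OF p(2)]] \<tau>(2)[OF p(2)]])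
       (intro conjI less_imp_le[OF \<tau>(1)[OF p(1)]] \<tau>(2)[OF p(1)])
  then have "(\<Prod>i\<in>UNIV. ?\<tau> (s $ i / b)) * ?\<tau> ((1 - l1_norm s) / b) / ?\<tau> (1 / b) \<le> 1 / ?\<tau> (1 / b)"
    using \<tau>(1)[OF p(3)] by (intro divide_right_mono) auto
  then have "psi s * poch_ratio CARD('d) (1 / b) * ((\<Prod>i\<in>UNIV. ?\<tau> (s $ i / b)) * ?\<tau> ((1 - l1_norm s) / b) / ?\<tau> (1 / b))
     \<le> psi s * poch_ratio CARD('d) (1 / b) * (1 / ?\<tau> (1 / b))"
    by (rule mult_left_mono[OF _ mult_nonneg_nonneg[OF psi_nonneg less_imp_le[OF poch_ratio_pos[OF p(3)]]]])
  also have "\<dots> = dominating_factor CARD('d) b * psi s" by (simp add: dominating_factor_def)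
  finally show ?thesis using kernel_sq_factor_eq[OF b s] by simp
qed

lemma kernel_sq_factor_tendsto:
  fixes s :: "real ^ 'd"
  assumes s: "\<And>i. 0 < s $ i" "l1_norm s < 1"
  shows "((\<lambda>b. b powr (real CARD('d) / 2) * kernel_sq_factor b s) \<longlongrightarrow> psi s) (at_right 0)"
proof -
  let ?\<tau> = "\<lambda>y. sqrt y * half_ratio y"
  have inf: "filterlim (\<lambda>b::real. a / b) at_top (at_right 0)" if "a > 0" for a using that by real_asymp
  note \<tau> = filterlim_compose[OF sqrt_half_ratio_tendsto inf]
  have "((\<lambda>b. psi s * poch_ratio CARD('d) (1 / b) * ((\<Prod>i\<in>UNIV. ?\<tau> (s $ i / b)) * ?\<tau> ((1 - l1_norm s) / b) / ?\<tau> (1 / b)))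
     \<longlongrightarrow> psi s * 1 * ((\<Prod>i::'d\<in>UNIV. 1) * 1 / 1)) (at_right 0)"
    using s by (intro tendsto_mult tendsto_divide tendsto_prod tendsto_const \<tau> filterlim_compose[OF poch_ratio_tendsto inf]) auto
  moreover have "\<forall>\<^sub>F b in at_right 0. psi s * poch_ratio CARD('d) (1 / b) * ((\<Prod>i\<in>UNIV. ?\<tau> (s $ i / b)) * ?\<tau> ((1 - l1_norm s) / b) / ?\<tau> (1 / b))
      = b powr (real CARD('d) / 2) * kernel_sq_factor b s"
    using eventually_at_right_less[of 0] by eventually_elim (rule kernel_sq_factor_eq[OF _ s, symmetric])
  ultimately show ?thesis using tendsto_cong by fastforce
qed

text \<open>
  Up to a constant, \<^const>\<open>psi\<close> is the Dirichlet weight with all parameters equal to \<open>1 / 2\<close>.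
\<close>

lemma integrable_psi: "set_integrable lborel (simplex_set :: (real ^ 'd) set) psi"
proof -
  let ?c = "((4 * pi) ^ CARD('d)) powr (- 1 / 2)"
  have "integrable lborel (\<lambda>s. ?c * dirichlet_weight (\<chi> i::'d. 1 / 2) (1 / 2) s)"
    by (intro integrable_mult_right integrable_dirichlet_weight) auto
  also have "(\<lambda>s. ?c * dirichlet_weight (\<chi> i::'d. 1 / 2) (1 / 2) s) = (\<lambda>s. indicator simplex_set s *\<^sub>R psi s)"
  proof
    fix s :: "real ^ 'd"
    have "(\<Prod>i\<in>UNIV. s $ i) powr (- 1 / 2) = (\<Prod>i\<in>UNIV. s $ i powr (- 1 / 2))" if "s \<in> simplex_set"
      by (rule prod_powr_distrib)
    then show "?c * dirichlet_weight (\<chi> i::'d. 1 / 2) (1 / 2) s = indicator simplex_set s *\<^sub>R psi s"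
      using simplex_nth[of s] by (auto simp: dirichlet_weight_def psi_def indicator_def powr_mult prod_nonneg)
  qed
  finally show ?thesis by (simp add: set_integrable_def)
qed

section \<open>Limits of the integrated variance and bias\<close>

lemma borel_measurable_kernel_const [measurable]: "kernel_const b \<in> borel_measurable borel"
  unfolding kernel_const_def[abs_def] by measurable

lemma borel_measurable_kernel_sq_factor [measurable]: "kernel_sq_factor b \<in> borel_measurable borel"
  unfolding kernel_sq_factor_def[abs_def] by measurable

lemma borel_measurable_dirichlet_smooth [measurable]:
  fixes h :: "real ^ 'd \<Rightarrow> real"
  assumes [measurable]: "h \<in> borel_measurable borel"
  shows "dirichlet_smooth b h \<in> borel_measurable borel"
proof -
  let ?P = "(borel :: (real ^ 'd) measure) \<Otimes>\<^sub>M (borel :: (real ^ 'd) measure)"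
  have nth: "(\<lambda>x :: real ^ 'd. x $ i) \<in> borel_measurable borel" for i
    by (intro borel_measurable_continuous_onI continuous_intros)
  have [measurable]: "(\<lambda>z. fst z $ i) \<in> borel_measurable ?P" "(\<lambda>z. snd z $ i) \<in> borel_measurable ?P" for i
    by (rule measurable_compose[OF measurable_fst nth], rule measurable_compose[OF measurable_snd nth])
  have "(\<lambda>z. dirichlet_kernel b (fst z) (snd z) * h (snd z)) \<in> borel_measurable ?P"
    unfolding dirichlet_kernel_def dirichlet_density_eq_weight dirichlet_weight_def l1_norm_def vec_lambda_beta
    by measurable
  then have "case_prod (\<lambda>s x. dirichlet_kernel b s x * h x) \<in> borel_measurable (borel \<Otimes>\<^sub>M lborel)"
    by (simp add: case_prod_unfold cong: measurable_cong_sets)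
  then show ?thesis
    unfolding dirichlet_smooth_def[abs_def] by (rule lborel.borel_measurable_lebesgue_integral)
qed

lemma set_integrable_simplex_bounded:
  fixes h :: "real ^ 'd \<Rightarrow> real"
  assumes "set_borel_measurable lborel simplex_set h" "\<And>s. s \<in> simplex_set \<Longrightarrow> \<bar>h s\<bar> \<le> C"
  shows "set_integrable lborel simplex_set h"
proof (rule set_integrable_bound[OF _ assms(1)])
  have "emeasure lborel (simplex_set :: (real ^ 'd) set) < \<infinity>"
    using compact_imp_bounded[OF compact_simplex_set] by (rule emeasure_bounded_finite)
  then have "integrable lborel (indicator (simplex_set :: (real ^ 'd) set) :: _ \<Rightarrow> real)"
    by (intro integrable_real_indicator) auto
  then show "set_integrable lborel (simplex_set :: (real ^ 'd) set) (\<lambda>_. C)"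
    unfolding set_integrable_def by (simp add: mult.commute)
  show "AE x in lborel. x \<in> simplex_set \<longrightarrow> norm (h x) \<le> norm C"
    using assms(2) by (force intro!: AE_I2)
qed

lemma integral_dominated_convergence_at_right_0:
  fixes H :: "real \<Rightarrow> 'a \<Rightarrow> real"
  assumes "h \<in> borel_measurable M" "\<And>b. H b \<in> borel_measurable M" "integrable M w"
    and lim: "AE x in M. ((\<lambda>b. H b x) \<longlongrightarrow> h x) (at_right 0)"
    and bound: "\<forall>\<^sub>F b in at_right 0. AE x in M. \<bar>H b x\<bar> \<le> w x"
  shows "((\<lambda>b. integral\<^sup>L M (H b)) \<longlongrightarrow> integral\<^sup>L M h) (at_right 0)"
  unfolding filterlim_at_right_to_top
proof (rule integral_dominated_convergence_at_top[where w=w])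
  show "AE x in M. ((\<lambda>t. H (inverse t) x) \<longlongrightarrow> h x) at_top"
    using lim unfolding filterlim_at_right_to_top .
  show "\<forall>\<^sub>F t in at_top. AE x in M. norm (H (inverse t) x) \<le> w x"
    using bound unfolding eventually_at_right_to_top by simp
qed (use assms in auto)

definition int_sq_factor :: "(real ^ 'd \<Rightarrow> real) \<Rightarrow> real \<Rightarrow> real" where
  "int_sq_factor f b = (LINT s:simplex_set|lborel. kernel_sq_factor b s * dirichlet_smooth (b / 2) f s)"

definition int_smooth_sq :: "(real ^ 'd \<Rightarrow> real) \<Rightarrow> real \<Rightarrow> real" where
  "int_smooth_sq f b = (LINT s:simplex_set|lborel. (dirichlet_smooth b f s)\<^sup>2)"

definition int_bias_sq :: "(real ^ 'd \<Rightarrow> real) \<Rightarrow> real \<Rightarrow> real" where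
  "int_bias_sq f b = (LINT s:simplex_set|lborel. (dirichlet_smooth b f s - f s)\<^sup>2)"

context
  fixes f :: "real ^ 'd \<Rightarrow> real"
  assumes f: "twice_cont_diff_on_simplex f" and f_meas [measurable]: "f \<in> borel_measurable borel"
begin

lemma simplex_bounded_f: "simplex_bounded f"
  by (rule simplex_bounded_continuous_on[OF f_meas continuous_on_simplex_derivs(1)[OF f]])

lemma density_smooth_bound:
  obtains B where "B \<ge> 0" "\<And>s. s \<in> simplex_set \<Longrightarrow> \<bar>f s\<bar> \<le> B"
    "\<And>b s. b > 0 \<Longrightarrow> s \<in> simplex_set \<Longrightarrow> \<bar>dirichlet_smooth b f s\<bar> \<le> B"
proof -
  obtain B where B: "\<And>s. s \<in> simplex_set \<Longrightarrow> \<bar>f s\<bar> \<le> B"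
    using simplex_bounded_f unfolding simplex_bounded_def by blast
  have B': "\<bar>f s\<bar> \<le> max 0 B" if "s \<in> simplex_set" for s using B[OF that] by simp
  have "\<bar>dirichlet_smooth b f s\<bar> \<le> max 0 B" if "b > 0" "s \<in> simplex_set" for b s
    using smooth_abs_le[OF that simplex_bounded_f simplex_bounded_const B'] dirichlet_smooth_const[OF that]
    by simp
  with B' show thesis by (intro that[of "max 0 B"]) auto
qed

lemma continuous_on_g_fun: "continuous_on simplex_set (g_fun f)"
  unfolding g_fun_def[abs_def] by (intro continuous_intros continuous_on_simplex_derivs[OF f])

lemma g_fun_set_measurable: "set_borel_measurable lborel simplex_set (g_fun f)"
  using borel_measurable_continuous_on_indicator[OF simplex_set_borel continuous_on_g_fun]
  by (simp add: set_borel_measurable_def)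

lemma smooth_tendsto:
  assumes s: "s \<in> simplex_set"
  shows "((\<lambda>b. dirichlet_smooth b f s) \<longlongrightarrow> f s) (at_right 0)"
    and "((\<lambda>b. (dirichlet_smooth b f s - f s) / b) \<longlongrightarrow> g_fun f s) (at_right 0)"
proof -
  show *: "((\<lambda>b. (dirichlet_smooth b f s - f s) / b) \<longlongrightarrow> g_fun f s) (at_right 0)"
  proof (rule tendstoI)
    fix e :: real assume e: "e > 0"
    obtain b0 where b0: "0 < b0" "b0 \<le> 1" "\<And>b s. 0 < b \<Longrightarrow> b < b0 \<Longrightarrow> s \<in> simplex_set \<Longrightarrow>
        \<bar>dirichlet_smooth b f s - f s - b * g_fun f s\<bar> \<le> e / 2 * b"
      by (rule smooth_bias_uniform[OF f f_meas, of "e / 2"]) (use e in auto)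
    have "dist ((dirichlet_smooth b f s - f s) / b) (g_fun f s) < e" if b: "b \<in> {0<..<b0}" for b
    proof -
      have "dist ((dirichlet_smooth b f s - f s) / b) (g_fun f s) = \<bar>dirichlet_smooth b f s - f s - b * g_fun f s\<bar> / b"
      proof -
        have "(dirichlet_smooth b f s - f s) / b - g_fun f s = (dirichlet_smooth b f s - f s - b * g_fun f s) / b"
          using b by (simp add: diff_divide_distrib)
        then show ?thesis using b by (simp add: dist_real_def)
      qed
      also have "\<dots> \<le> e / 2" using b0(3)[OF _ _ s, of b] b by (simp add: pos_divide_le_eq)
      finally show ?thesis using e by linarith
    qed
    then show "\<forall>\<^sub>F b in at_right 0. dist ((dirichlet_smooth b f s - f s) / b) (g_fun f s) < e"
      by (rule eventually_at_rightI[OF _ b0(1)])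
  qed
  have "((\<lambda>b. f s + b * ((dirichlet_smooth b f s - f s) / b)) \<longlongrightarrow> f s + 0 * g_fun f s) (at_right 0)"
    by (intro tendsto_add tendsto_const tendsto_mult * tendsto_ident_at)
  then have "((\<lambda>b. f s + b * ((dirichlet_smooth b f s - f s) / b)) \<longlongrightarrow> f s) (at_right 0)"
    by simp
  moreover have "\<forall>\<^sub>F b in at_right 0. f s + b * ((dirichlet_smooth b f s - f s) / b) = dirichlet_smooth b f s"
    using eventually_at_right_less[of 0] by eventually_elim simp
  ultimately show "((\<lambda>b. dirichlet_smooth b f s) \<longlongrightarrow> f s) (at_right 0)"
    by (rule Lim_transform_eventually)
qed

text \<open>
  Uniform convergence of \<open>(dirichlet_smooth b f - f) / b\<close> provides both the pointwise limit and a
  constant majorant.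
\<close>

lemma int_bias_sq_tendsto: "((\<lambda>b. int_bias_sq f b / b\<^sup>2) \<longlongrightarrow> int_g_sq f) (at_right 0)"
proof -
  obtain b0 where b0: "0 < b0" "b0 \<le> 1" "\<And>b s. 0 < b \<Longrightarrow> b < b0 \<Longrightarrow> s \<in> simplex_set \<Longrightarrow>
        \<bar>dirichlet_smooth b f s - f s - b * g_fun f s\<bar> \<le> 1 * b"
    by (rule smooth_bias_uniform[OF f f_meas, of 1]) auto
  obtain G where G: "\<And>s. s \<in> simplex_set \<Longrightarrow> \<bar>g_fun f s\<bar> \<le> G"
    using compact_imp_bounded[OF compact_continuous_image[OF continuous_on_g_fun compact_simplex_set]]
    unfolding bounded_iff by auto
  let ?H = "\<lambda>b s. indicator simplex_set s *\<^sub>R ((dirichlet_smooth b f s - f s) / b)\<^sup>2"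
  have "((\<lambda>b. \<integral>s. ?H b s \<partial>lborel) \<longlongrightarrow> (\<integral>s. indicator simplex_set s *\<^sub>R (g_fun f s)\<^sup>2 \<partial>lborel)) (at_right 0)"
  proof (rule integral_dominated_convergence_at_right_0)
    have "(\<lambda>s. (indicator simplex_set s *\<^sub>R g_fun f s)\<^sup>2) \<in> borel_measurable lborel"
      using g_fun_set_measurable unfolding set_borel_measurable_def by measurable
    also have "(\<lambda>s. (indicator simplex_set s *\<^sub>R g_fun f s)\<^sup>2) = (\<lambda>s. indicator simplex_set s *\<^sub>R (g_fun f s)\<^sup>2)"
      by (auto simp: indicator_def)
    finally show "(\<lambda>s. indicator simplex_set s *\<^sub>R (g_fun f s)\<^sup>2) \<in> borel_measurable lborel" .
    show "?H b \<in> borel_measurable lborel" for b by measurable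
    have "set_integrable lborel (simplex_set :: (real ^ 'd) set) (\<lambda>_. (G + 1)\<^sup>2)"
      by (rule set_integrable_simplex_bounded[where C="(G + 1)\<^sup>2"]) (auto simp: set_borel_measurable_def)
    then show "integrable lborel (\<lambda>s::real^'d. indicator simplex_set s *\<^sub>R (G + 1)\<^sup>2)"
      by (simp add: set_integrable_def)
    have "((\<lambda>b. ?H b s) \<longlongrightarrow> indicator simplex_set s *\<^sub>R (g_fun f s)\<^sup>2) (at_right 0)" for s
      by (cases "s \<in> simplex_set") (auto intro!: tendsto_intros smooth_tendsto(2))
    then show "AE s in lborel. ((\<lambda>b. ?H b s) \<longlongrightarrow> indicator simplex_set s *\<^sub>R (g_fun f s)\<^sup>2) (at_right 0)"
      by simp
    have "\<bar>?H b s\<bar> \<le> indicator simplex_set s *\<^sub>R (G + 1)\<^sup>2" if b: "b \<in> {0<..<b0}" for b and s :: "real ^ 'd"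
    proof (cases "s \<in> simplex_set")
      case True
      have "\<bar>dirichlet_smooth b f s - f s\<bar> \<le> b + \<bar>b * g_fun f s\<bar>"
        using b0(3)[OF _ _ True, of b] b by simp
      also have "\<bar>b * g_fun f s\<bar> \<le> b * G" using G[OF True] b by (simp add: abs_mult)
      finally have "\<bar>dirichlet_smooth b f s - f s\<bar> \<le> (G + 1) * b" by (simp add: algebra_simps)
      then have "\<bar>(dirichlet_smooth b f s - f s) / b\<bar> \<le> G + 1"
        using b by (simp add: abs_divide pos_divide_le_eq)
      then have "((dirichlet_smooth b f s - f s) / b)\<^sup>2 \<le> (G + 1)\<^sup>2"
        by (rule abs_le_square_iff[THEN iffD1, OF order_trans]) simp
      then show ?thesis using True by simp
    qed simp
    then show "\<forall>\<^sub>F b in at_right 0. AE s in lborel. \<bar>?H b s\<bar> \<le> indicator simplex_set s *\<^sub>R (G + 1)\<^sup>2"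
      by (intro eventually_at_rightI[OF _ b0(1)] AE_I2)
  qed
  moreover have "(\<integral>s. ?H b s \<partial>lborel) = int_bias_sq f b / b\<^sup>2" for b
    by (simp add: int_bias_sq_def set_lebesgue_integral_def power_divide)
  ultimately show ?thesis by (simp add: int_g_sq_def set_lebesgue_integral_def)
qed

lemma kernel_sq_factor_smooth_bound:
  assumes b: "b > 0" and B: "\<forall>b>0. \<forall>s\<in>simplex_set. \<bar>dirichlet_smooth b f s\<bar> \<le> B"
  shows "AE s in lborel. s \<in> simplex_set \<longrightarrow>
     \<bar>b powr (real CARD('d) / 2) * (kernel_sq_factor b s * dirichlet_smooth (b / 2) f s)\<bar>
       \<le> dominating_factor CARD('d) b * B * psi s"
  using AE_simplex_interior
proof eventually_elim
  case (elim s)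
  show ?case
  proof
    assume s: "s \<in> simplex_set"
    with elim have i: "\<And>i. 0 < s $ i" "l1_norm s < 1" by auto
    have k: "0 \<le> b powr (real CARD('d) / 2) * kernel_sq_factor b s"
      using kernel_sq_factor_pos[OF b s] by simp
    have "\<bar>b powr (real CARD('d) / 2) * (kernel_sq_factor b s * dirichlet_smooth (b / 2) f s)\<bar>
       = (b powr (real CARD('d) / 2) * kernel_sq_factor b s) * \<bar>dirichlet_smooth (b / 2) f s\<bar>"
      unfolding mult.assoc[symmetric] abs_mult[of _ "dirichlet_smooth (b / 2) f s"] abs_of_nonneg[OF k] ..
    also have "\<dots> \<le> (dominating_factor CARD('d) b * psi s) * B"
    proof (rule mult_mono)
      show "b powr (real CARD('d) / 2) * kernel_sq_factor b s \<le> dominating_factor CARD('d) b * psi s"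
        by (rule kernel_sq_factor_le[OF b i])
      then show "0 \<le> dominating_factor CARD('d) b * psi s" using k by linarith
      show "\<bar>dirichlet_smooth (b / 2) f s\<bar> \<le> B" using B b s by simp
    qed simp
    finally show "\<bar>b powr (real CARD('d) / 2) * (kernel_sq_factor b s * dirichlet_smooth (b / 2) f s)\<bar>
       \<le> dominating_factor CARD('d) b * B * psi s" by (simp only: mult_ac)
  qed
qed

lemma integrable_kernel_sq_factor:
  assumes b: "b > 0"
  shows "set_integrable lborel simplex_set (\<lambda>s. kernel_sq_factor b s * dirichlet_smooth (b / 2) f s)"
proof -
  obtain B where B: "\<forall>b>0. \<forall>s\<in>simplex_set. \<bar>dirichlet_smooth b f s\<bar> \<le> B"
    by (rule density_smooth_bound) blast
  let ?p = "b powr (real CARD('d) / 2)"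
  have "set_integrable lborel simplex_set (\<lambda>s. ?p * (kernel_sq_factor b s * dirichlet_smooth (b / 2) f s))"
  proof (rule set_integrable_bound)
    show "set_integrable lborel simplex_set (\<lambda>s::real^'d. dominating_factor CARD('d) b * B * psi s)"
      using integrable_psi by (rule set_integrable_mult_right)
    show "set_borel_measurable lborel simplex_set (\<lambda>s. ?p * (kernel_sq_factor b s * dirichlet_smooth (b / 2) f s))"
      unfolding set_borel_measurable_def by measurable
    show "AE s in lborel. s \<in> simplex_set \<longrightarrow> norm (?p * (kernel_sq_factor b s * dirichlet_smooth (b / 2) f s))
        \<le> norm (dominating_factor CARD('d) b * B * psi s)"
      using kernel_sq_factor_smooth_bound[OF b B] by eventually_elim auto
  qed
  then have "set_integrable lborel simplex_set (\<lambda>s. (1 / ?p) * (?p * (kernel_sq_factor b s * dirichlet_smooth (b / 2) f s)))"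
    by (rule set_integrable_mult_right)
  then show ?thesis using b by simp
qed

text \<open>
  The smoothed density is bounded and converges to \<open>f\<close>, so a multiple of \<^const>\<open>psi\<close> dominates.
\<close>

lemma int_sq_factor_tendsto:
  "((\<lambda>b. b powr (real CARD('d) / 2) * int_sq_factor f b) \<longlongrightarrow> int_psi_f f) (at_right 0)"
proof -
  obtain B where B: "B \<ge> 0" "\<forall>b>0. \<forall>s\<in>simplex_set. \<bar>dirichlet_smooth b f s\<bar> \<le> B"
    by (rule density_smooth_bound) blast
  let ?H = "\<lambda>b s. indicator simplex_set s *\<^sub>R
     (b powr (real CARD('d) / 2) * (kernel_sq_factor b s * dirichlet_smooth (b / 2) f s))"
  have "((\<lambda>b. \<integral>s. ?H b s \<partial>lborel) \<longlongrightarrow> (\<integral>s. indicator simplex_set s *\<^sub>R (psi s * f s) \<partial>lborel)) (at_right 0)"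
  proof (rule integral_dominated_convergence_at_right_0)
    show "(\<lambda>s. indicator simplex_set s *\<^sub>R (psi s * f s)) \<in> borel_measurable lborel"
      unfolding psi_def by measurable
    show "?H b \<in> borel_measurable lborel" for b by measurable
    have "set_integrable lborel simplex_set (\<lambda>s::real^'d. 2 * B * psi s)"
      using integrable_psi by (rule set_integrable_mult_right)
    then show "integrable lborel (\<lambda>s::real^'d. indicator simplex_set s *\<^sub>R (2 * B * psi s))"
      by (simp only: set_integrable_def)
    show "AE s in lborel. ((\<lambda>b. ?H b s) \<longlongrightarrow> indicator simplex_set s *\<^sub>R (psi s * f s)) (at_right 0)"
      using AE_simplex_interior
    proof eventually_elim
      case (elim s)
      show ?case
      proof (cases "s \<in> simplex_set")
        case True
        with elim have i: "\<And>i. 0 < s $ i" "l1_norm s < 1" by auto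
        have "filterlim (\<lambda>b::real. b / 2) (at_right 0) (at_right 0)" by real_asymp
        then have "((\<lambda>b. dirichlet_smooth (b / 2) f s) \<longlongrightarrow> f s) (at_right 0)"
          by (rule filterlim_compose[OF smooth_tendsto(1)[OF True]])
        from tendsto_mult[OF kernel_sq_factor_tendsto[OF i] this] True show ?thesis
          by (simp add: mult.assoc)
      qed simp
    qed
    \<comment> \<open>Any constant larger than the limit 1 of this factor would do.\<close>
    have "\<forall>\<^sub>F b in at_right 0. dominating_factor CARD('d) b < 2"
      using dominating_factor_tendsto by (rule order_tendstoD(2)) simp
    then show "\<forall>\<^sub>F b in at_right 0. AE s in lborel. \<bar>?H b s\<bar> \<le> indicator simplex_set s *\<^sub>R (2 * B * psi s)"
      using eventually_at_right_less[of 0]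
    proof eventually_elim
      case (elim b)
      show ?case
        using kernel_sq_factor_smooth_bound[OF elim(2) B(2)]
      proof eventually_elim
        case bound: (elim s)
        have "dominating_factor CARD('d) b * B * psi s \<le> 2 * B * psi s"
          using elim(1) B(1) psi_nonneg[of s] by (intro mult_right_mono) auto
        then show ?case using bound by (cases "s \<in> simplex_set") (auto simp del: mult_le_cancel_right)
      qed
    qed
  qed
  moreover have "(\<integral>s. ?H b s \<partial>lborel) = b powr (real CARD('d) / 2) * int_sq_factor f b" for b
    by (simp add: int_sq_factor_def set_lebesgue_integral_def mult.left_commute[of _ "b powr _"])
  ultimately show ?thesis by (simp add: int_psi_f_def set_lebesgue_integral_def)
qed

lemma integrable_smooth_sq:
  assumes "b > 0"
  shows "set_integrable lborel simplex_set (\<lambda>s. (dirichlet_smooth b f s)\<^sup>2)"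
    "set_integrable lborel simplex_set (\<lambda>s. (dirichlet_smooth b f s - f s)\<^sup>2)"
proof -
  obtain B where B: "B \<ge> 0" "\<And>s. s \<in> simplex_set \<Longrightarrow> \<bar>f s\<bar> \<le> B"
    "\<And>b s. b > 0 \<Longrightarrow> s \<in> simplex_set \<Longrightarrow> \<bar>dirichlet_smooth b f s\<bar> \<le> B"
    by (rule density_smooth_bound) blast
  have sq: "\<bar>x\<^sup>2\<bar> \<le> C\<^sup>2" if "\<bar>x\<bar> \<le> C" for x C :: real
    using that power_mono[OF that abs_ge_zero, of 2] by simp
  show "set_integrable lborel simplex_set (\<lambda>s. (dirichlet_smooth b f s)\<^sup>2)"
  proof (rule set_integrable_simplex_bounded)
    show "set_borel_measurable lborel simplex_set (\<lambda>s. (dirichlet_smooth b f s)\<^sup>2)"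
      unfolding set_borel_measurable_def by measurable
  qed (rule sq, rule B(3)[OF assms])
  show "set_integrable lborel simplex_set (\<lambda>s. (dirichlet_smooth b f s - f s)\<^sup>2)"
  proof (rule set_integrable_simplex_bounded)
    show "set_borel_measurable lborel simplex_set (\<lambda>s. (dirichlet_smooth b f s - f s)\<^sup>2)"
      unfolding set_borel_measurable_def by measurable
    fix s :: "real ^ 'd" assume "s \<in> simplex_set"
    then have "\<bar>dirichlet_smooth b f s - f s\<bar> \<le> 2 * B" using B(2)[of s] B(3)[OF assms, of s] by linarith
    then show "\<bar>(dirichlet_smooth b f s - f s)\<^sup>2\<bar> \<le> (2 * B)\<^sup>2" by (rule sq)
  qed
qed

lemma int_smooth_sq_bound:
  obtains C where "\<And>b. b > 0 \<Longrightarrow> \<bar>int_smooth_sq f b\<bar> \<le> C"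
proof -
  obtain B where B: "\<And>b s. b > 0 \<Longrightarrow> s \<in> simplex_set \<Longrightarrow> \<bar>dirichlet_smooth b f s\<bar> \<le> B"
    by (rule density_smooth_bound) blast
  have "\<bar>int_smooth_sq f b\<bar> \<le> (LINT s:(simplex_set::(real^'d) set)|lborel. B\<^sup>2)" if b: "b > 0" for b
  proof -
    have "0 \<le> int_smooth_sq f b"
      unfolding int_smooth_sq_def set_lebesgue_integral_def by (intro integral_nonneg_AE) simp
    moreover have "int_smooth_sq f b \<le> (LINT s:(simplex_set::(real^'d) set)|lborel. B\<^sup>2)"
      unfolding int_smooth_sq_def
    proof (rule set_integral_mono[OF integrable_smooth_sq(1)[OF b]])
      show "set_integrable lborel (simplex_set :: (real ^ 'd) set) (\<lambda>_. B\<^sup>2)"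
        by (rule set_integrable_simplex_bounded[where C="B\<^sup>2"]) (auto simp: set_borel_measurable_def)
      show "(dirichlet_smooth b f s)\<^sup>2 \<le> B\<^sup>2" if "s \<in> simplex_set" for s
        using power_mono[OF B[OF b that] abs_ge_zero, of 2] by simp
    qed
    ultimately show ?thesis by simp
  qed
  then show thesis by (rule that)
qed

text \<open>
  The squared mean is bounded in \<open>b\<close>, so it vanishes against the second moment, which is of order
  \<open>b powr (- d / 2)\<close>.
\<close>

lemma variance_part_tendsto:
  "((\<lambda>b. b powr (real CARD('d) / 2) * (int_sq_factor f b - int_smooth_sq f b)) \<longlongrightarrow> int_psi_f f) (at_right 0)"
proof -
  obtain C where C: "\<And>b. b > 0 \<Longrightarrow> \<bar>int_smooth_sq f b\<bar> \<le> C"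
    by (rule int_smooth_sq_bound) blast
  have z: "((\<lambda>b::real. b powr (real CARD('d) / 2)) \<longlongrightarrow> 0) (at_right 0)"
    by real_asymp
  have "((\<lambda>b. b powr (real CARD('d) / 2) * int_smooth_sq f b) \<longlongrightarrow> 0) (at_right 0)"
  proof (rule Lim_null_comparison)
    show "\<forall>\<^sub>F b in at_right 0. norm (b powr (real CARD('d) / 2) * int_smooth_sq f b) \<le> b powr (real CARD('d) / 2) * C"
      using eventually_at_right_less[of 0]
      by eventually_elim (auto simp: abs_mult intro!: mult_left_mono C)
    show "((\<lambda>b. b powr (real CARD('d) / 2) * C) \<longlongrightarrow> 0) (at_right 0)"
      using tendsto_mult_left_zero[OF z] .
  qed
  from tendsto_diff[OF int_sq_factor_tendsto this] show ?thesis by (simp add: right_diff_distrib)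
qed

end

section \<open>Decomposition of the mean integrated squared error\<close>

text \<open>
  Expanding the square of the sum, the off-diagonal products have mean \<open>m\<^sup>2\<close> by pairwise independence, and
  only the \<open>n\<close> diagonal ones contribute to the variance.
\<close>

lemma (in prob_space) mean_square_error_sample_mean:
  fixes Y :: "nat \<Rightarrow> 'a \<Rightarrow> real"
  assumes n: "n \<ge> 1" and indep: "indep_vars (\<lambda>_. borel) Y {1..n}"
    and int: "\<And>i. i \<in> {1..n} \<Longrightarrow> integrable M (Y i)" "\<And>i. i \<in> {1..n} \<Longrightarrow> integrable M (\<lambda>\<omega>. (Y i \<omega>)\<^sup>2)"
    and m: "\<And>i. i \<in> {1..n} \<Longrightarrow> expectation (Y i) = m"
    and q: "\<And>i. i \<in> {1..n} \<Longrightarrow> expectation (\<lambda>\<omega>. (Y i \<omega>)\<^sup>2) = q"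
  shows "expectation (\<lambda>\<omega>. (1 / real n * (\<Sum>i=1..n. Y i \<omega>) - c)\<^sup>2) = 1 / real n * (q - m\<^sup>2) + (m - c)\<^sup>2"
proof -
  have prod: "integrable M (\<lambda>\<omega>. Y i \<omega> * Y j \<omega>)"
      "expectation (\<lambda>\<omega>. Y i \<omega> * Y j \<omega>) = m\<^sup>2 + (if i = j then q - m\<^sup>2 else 0)"
    if ij: "i \<in> {1..n}" "j \<in> {1..n}" for i j
  proof -
    have "integrable M (\<lambda>\<omega>. Y i \<omega> * Y j \<omega>) \<and>
      expectation (\<lambda>\<omega>. Y i \<omega> * Y j \<omega>) = m\<^sup>2 + (if i = j then q - m\<^sup>2 else 0)"
    proof (cases "i = j")
      case True
      then show ?thesis using int(2)[OF ij(1)] q[OF ij(1)] by (simp add: power2_eq_square)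
    next
      case False
      have ind: "indep_vars (\<lambda>_. borel) Y {i, j}"
        using ij by (intro indep_vars_subset[OF indep]) auto
      have "integrable M (Y k)" if "k \<in> {i, j}" for k using that int(1) ij by auto
      from indep_vars_lebesgue_integral[OF _ ind this] indep_vars_integrable[OF _ ind this]
      show ?thesis using False m[OF ij(1)] m[OF ij(2)] by (simp add: power2_eq_square)
    qed
    then show "integrable M (\<lambda>\<omega>. Y i \<omega> * Y j \<omega>)"
      "expectation (\<lambda>\<omega>. Y i \<omega> * Y j \<omega>) = m\<^sup>2 + (if i = j then q - m\<^sup>2 else 0)" by auto
  qed
  define S where "S \<omega> = (\<Sum>i=1..n. Y i \<omega>)" for \<omega>
  have iS: "integrable M S"
    unfolding S_def[abs_def] by (intro Bochner_Integration.integrable_sum int(1))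
  have "expectation S = (\<Sum>i=1..n. expectation (Y i))"
    unfolding S_def[abs_def] by (intro Bochner_Integration.integral_sum int(1))
  also have "\<dots> = real n * m" using m by simp
  finally have eS: "expectation S = real n * m" .
  have S2: "(S \<omega>)\<^sup>2 = (\<Sum>i=1..n. \<Sum>j=1..n. Y i \<omega> * Y j \<omega>)" for \<omega>
    unfolding S_def power2_eq_square by (rule sum_product)
  have iS2: "integrable M (\<lambda>\<omega>. (S \<omega>)\<^sup>2)"
    unfolding S2 by (intro Bochner_Integration.integrable_sum prod(1))
  have "expectation (\<lambda>\<omega>. (S \<omega>)\<^sup>2) = (\<Sum>i=1..n. \<Sum>j=1..n. m\<^sup>2 + (if i = j then q - m\<^sup>2 else 0))"
  proof -
    have "expectation (\<lambda>\<omega>. (S \<omega>)\<^sup>2) = (\<Sum>i=1..n. expectation (\<lambda>\<omega>. \<Sum>j=1..n. Y i \<omega> * Y j \<omega>))"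
      unfolding S2 by (intro Bochner_Integration.integral_sum Bochner_Integration.integrable_sum prod(1))
    also have "\<dots> = (\<Sum>i=1..n. \<Sum>j=1..n. expectation (\<lambda>\<omega>. Y i \<omega> * Y j \<omega>))"
      by (intro sum.cong refl Bochner_Integration.integral_sum prod(1))
    also have "\<dots> = (\<Sum>i=1..n. \<Sum>j=1..n. m\<^sup>2 + (if i = j then q - m\<^sup>2 else 0))"
      by (intro sum.cong refl prod(2))
    finally show ?thesis .
  qed
  also have "\<dots> = (real n)\<^sup>2 * m\<^sup>2 + real n * (q - m\<^sup>2)"
    by (simp add: sum.distrib power2_eq_square algebra_simps)
  finally have eS2: "expectation (\<lambda>\<omega>. (S \<omega>)\<^sup>2) = (real n)\<^sup>2 * m\<^sup>2 + real n * (q - m\<^sup>2)" .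
  have "expectation (\<lambda>\<omega>. (1 / real n * S \<omega> - c)\<^sup>2)
     = expectation (\<lambda>\<omega>. (1 / (real n)\<^sup>2) * (S \<omega>)\<^sup>2 - (2 * c / real n) * S \<omega> + c\<^sup>2)"
    by (intro Bochner_Integration.integral_cong refl) (simp add: power2_diff power_divide)
  also have "\<dots> = (1 / (real n)\<^sup>2) * ((real n)\<^sup>2 * m\<^sup>2 + real n * (q - m\<^sup>2)) - (2 * c / real n) * (real n * m) + c\<^sup>2"
    using iS iS2 by (simp add: eS eS2 prob_space)
  also have "\<dots> = 1 / real n * (q - m\<^sup>2) + (m - c)\<^sup>2"
    using n by (simp add: field_simps power2_eq_square)
  finally show ?thesis by (simp add: S_def)
qed

text \<open>
  An identity for every bandwidth: pointwise variance plus squared bias, integrated over the simplex.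
  The second moment of the kernel is expressed by the smoothing operator of bandwidth \<open>b / 2\<close>.
\<close>

lemma MISE_decomposition:
  fixes M :: "'a measure" and X :: "nat \<Rightarrow> 'a \<Rightarrow> real ^ 'd" and f :: "real ^ 'd \<Rightarrow> real"
  assumes "prob_space M" and indep: "prob_space.indep_vars M (\<lambda>_. borel) X {1..}"
    and dens: "\<And>i. i \<ge> 1 \<Longrightarrow> distributed M lborel (X i) (\<lambda>x. ennreal (f x))"
    and nn: "\<And>x. f x \<ge> 0"
    and f: "twice_cont_diff_on_simplex f" and f_meas: "f \<in> borel_measurable borel"
    and n: "n \<ge> 1" and b: "b > 0"
  shows "MISE M X f n b = 1 / real n * (int_sq_factor f b - int_smooth_sq f b) + int_bias_sq f b"
proof -
  interpret prob_space M by fact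
  have pt: "expectation (\<lambda>\<omega>. \<bar>dirichlet_estimator X n b s \<omega> - f s\<bar>\<^sup>2)
      = 1 / real n * (kernel_sq_factor b s * dirichlet_smooth (b / 2) f s - (dirichlet_smooth b f s)\<^sup>2)
        + (dirichlet_smooth b f s - f s)\<^sup>2" if s: "s \<in> simplex_set" for s
  proof -
    let ?Y = "\<lambda>i \<omega>. dirichlet_kernel b s (X i \<omega>)"
    note sb = simplex_bounded_f[OF f f_meas]
    have b2: "b / 2 > 0" using b by simp
    have ind: "indep_vars (\<lambda>_. borel) ?Y {1..n}"
      by (rule indep_vars_compose2[OF indep_vars_subset[OF indep]]) auto
    have sq: "(dirichlet_kernel b s x)\<^sup>2 = kernel_sq_factor b s * dirichlet_kernel (b / 2) s x" for x
      by (rule dirichlet_kernel_square[OF b s])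
    have "integrable lborel (\<lambda>x. f x * dirichlet_kernel b s x)"
      using integrable_kernel[OF b s sb] by (simp add: mult.commute)
    then have i1: "integrable M (?Y i)" if "i \<in> {1..n}" for i
      using distributed_integrable[OF dens[of i], of "dirichlet_kernel b s"] that nn by simp
    have "integrable lborel (\<lambda>x. f x * (dirichlet_kernel b s x)\<^sup>2)"
      using integrable_mult_right[OF integrable_kernel[OF b2 s sb], of "kernel_sq_factor b s"] by (simp add: sq mult_ac)
    then have i2: "integrable M (\<lambda>\<omega>. (?Y i \<omega>)\<^sup>2)" if "i \<in> {1..n}" for i
      using distributed_integrable[OF dens[of i], of "\<lambda>x. (dirichlet_kernel b s x)\<^sup>2"] that nn by simp
    have e1: "expectation (?Y i) = dirichlet_smooth b f s" if "i \<in> {1..n}" for i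
      using distributed_integral[OF dens[of i], of "dirichlet_kernel b s"] that nn
      by (simp add: dirichlet_smooth_def mult.commute)
    have e2: "expectation (\<lambda>\<omega>. (?Y i \<omega>)\<^sup>2) = kernel_sq_factor b s * dirichlet_smooth (b / 2) f s" if "i \<in> {1..n}" for i
    proof -
      have "expectation (\<lambda>\<omega>. (?Y i \<omega>)\<^sup>2) = (\<integral>x. f x * (dirichlet_kernel b s x)\<^sup>2 \<partial>lborel)"
        using distributed_integral[OF dens[of i], of "\<lambda>x. (dirichlet_kernel b s x)\<^sup>2"] that nn by simp
      also have "\<dots> = (\<integral>x. kernel_sq_factor b s * (dirichlet_kernel (b / 2) s x * f x) \<partial>lborel)"
        by (simp add: sq mult_ac)
      finally show ?thesis by (simp add: dirichlet_smooth_def)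
    qed
    have "dirichlet_estimator X n b s \<omega> = 1 / real n * (\<Sum>i=1..n. ?Y i \<omega>)" for \<omega>
      by (simp add: dirichlet_estimator_def dirichlet_kernel_def)
    then show ?thesis
      using mean_square_error_sample_mean[OF n ind i1 i2 e1 e2, of "f s"] by simp
  qed
  have V: "set_integrable lborel simplex_set (\<lambda>s. kernel_sq_factor b s * dirichlet_smooth (b / 2) f s)"
    by (rule integrable_kernel_sq_factor[OF f f_meas b])
  note WQ = integrable_smooth_sq[OF f f_meas b]
  have "MISE M X f n b = (LINT s:simplex_set|lborel.
      1 / real n * (kernel_sq_factor b s * dirichlet_smooth (b / 2) f s - (dirichlet_smooth b f s)\<^sup>2)
        + (dirichlet_smooth b f s - f s)\<^sup>2)"
    unfolding MISE_def by (rule set_lebesgue_integral_cong) (use pt in auto)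
  also have "\<dots> = 1 / real n * (int_sq_factor f b - int_smooth_sq f b) + int_bias_sq f b"
    unfolding int_sq_factor_def int_smooth_sq_def int_bias_sq_def
    by (subst set_integral_add(2)[OF set_integrable_mult_right[OF set_integral_diff(1)[OF V WQ(1)]] WQ(2)])
       (simp add: set_integral_diff(2)[OF V WQ(1)])
  finally show ?thesis .
qed

text \<open>
  The weight \<^const>\<open>psi\<close> is positive in the interior, so a vanishing integral would force the
  probability density \<open>f\<close> to vanish almost everywhere.
\<close>

lemma int_psi_f_pos:
  fixes M :: "'a measure" and X :: "'a \<Rightarrow> real ^ 'd" and f :: "real ^ 'd \<Rightarrow> real"
  assumes "prob_space M" and dens: "distributed M lborel X (\<lambda>x. ennreal (f x))"
    and nn: "\<And>x. f x \<ge> 0" and out: "\<And>x. x \<notin> simplex_set \<Longrightarrow> f x = 0"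
    and f: "twice_cont_diff_on_simplex f" and f_meas [measurable]: "f \<in> borel_measurable borel"
  shows "int_psi_f f > 0"
proof (rule ccontr)
  interpret prob_space M by fact
  obtain B where B: "B \<ge> 0" "\<And>s. s \<in> simplex_set \<Longrightarrow> \<bar>f s\<bar> \<le> B"
    by (rule density_smooth_bound[OF f f_meas]) blast
  let ?h = "\<lambda>s. indicator simplex_set s *\<^sub>R (psi s * f s)"
  have h0: "?h s \<ge> 0" for s using psi_nonneg[of s] nn[of s] by simp
  have int: "integrable lborel ?h"
  proof -
    have "set_integrable lborel simplex_set (\<lambda>s. psi s * f s)"
    proof (rule set_integrable_bound)
      show "set_integrable lborel (simplex_set :: (real ^ 'd) set) (\<lambda>s. B * psi s)"
        using integrable_psi by (rule set_integrable_mult_right)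
      show "set_borel_measurable lborel simplex_set (\<lambda>s. psi s * f s)"
        unfolding set_borel_measurable_def psi_def by measurable
      show "AE s in lborel. s \<in> simplex_set \<longrightarrow> norm (psi s * f s) \<le> norm (B * psi s)"
        using B by (intro AE_I2 impI) (simp add: abs_mult mult.commute[of B] mult_left_mono)
    qed
    then show ?thesis by (simp add: set_integrable_def)
  qed
  assume "\<not> int_psi_f f > 0"
  moreover have "int_psi_f f = (\<integral>s. ?h s \<partial>lborel)" by (simp add: int_psi_f_def set_lebesgue_integral_def)
  moreover have "(\<integral>s. ?h s \<partial>lborel) \<ge> 0" using h0 by (intro integral_nonneg_AE) simp
  ultimately have "(\<integral>s. ?h s \<partial>lborel) = 0" by simp
  then have "AE s in lborel. ?h s = 0"
    using integral_nonneg_eq_0_iff_AE[OF int] h0 by simp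
  then have "AE s in lborel. f s = 0"
    using AE_simplex_interior
  proof eventually_elim
    case (elim s)
    show ?case
    proof (cases "s \<in> simplex_set")
      case True
      with elim have "\<And>i. 0 < s $ i" "l1_norm s < 1" by auto
      then have "psi s > 0" by (simp add: psi_interior prod_pos)
      with elim True show ?thesis by simp
    qed (rule out)
  qed
  then have "AE x in lborel. ennreal (f x) * 1 = 0"
    by eventually_elim simp
  then have "(\<integral>\<^sup>+x. ennreal (f x) * 1 \<partial>lborel) = (\<integral>\<^sup>+(x::real^'d). 0 \<partial>lborel)"
    by (rule nn_integral_cong_AE)
  moreover have "(\<integral>\<^sup>+x. ennreal (f x) * 1 \<partial>lborel) = (\<integral>\<^sup>+x. 1 \<partial>M)"
    by (rule distributed_nn_integral[OF dens]) simp
  ultimately show False by (simp add: emeasure_space_1)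
qed

section \<open>Optimal bandwidth\<close>

lemma exp_gt_add_one:
  fixes y :: real
  assumes "y \<noteq> 0"
  shows "1 + y < exp y"
proof -
  have "exp y \<noteq> 1 + y"
  proof
    assume eq: "exp y = 1 + y"
    have "ln (exp y) = exp y - 1" unfolding ln_exp using eq by simp
    from ln_eq_minus_one[OF exp_gt_zero this] have "exp y = 1" .
    with assms show False by simp
  qed
  with exp_ge_add_one_self[of y] show ?thesis by linarith
qed

text \<open>
  In the variable \<open>y = ln (b / c)\<close> both summands are exponentials. The inequality \<open>1 + y < exp y\<close> bounds
  each from below by its tangent at \<open>y = 0\<close>, and \<open>crit\<close> says that the two slopes cancel.
\<close>

lemma power_sum_unique_min:
  fixes A B k b c :: real
  assumes pos: "A > 0" "B > 0" "k > 0" "b > 0" "c > 0"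
    and crit: "k * A * c powr (- k) = 2 * B * c\<^sup>2" and neq: "b \<noteq> c"
  shows "A * c powr (- k) + B * c\<^sup>2 < A * b powr (- k) + B * b\<^sup>2"
proof -
  define y where "y = ln (b / c)"
  have y: "y \<noteq> 0" using pos neq by (auto simp: y_def)
  have "b = c * exp y" using pos by (simp add: y_def)
  then have bk: "b powr (- k) = c powr (- k) * exp (- k * y)" and b2: "b\<^sup>2 = c\<^sup>2 * exp (2 * y)"
    using pos by (simp_all add: powr_mult powr_def[of "exp y"] power_mult_distrib exp_double)
  have "A * c powr (- k) * (1 + - k * y) < A * c powr (- k) * exp (- k * y)"
    using pos y by (intro mult_strict_left_mono exp_gt_add_one) auto
  moreover have "B * c\<^sup>2 * (1 + 2 * y) < B * c\<^sup>2 * exp (2 * y)"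
    using pos y by (intro mult_strict_left_mono exp_gt_add_one) auto
  moreover have "A * c powr (- k) * (1 + - k * y) + B * c\<^sup>2 * (1 + 2 * y)
     = A * c powr (- k) + B * c\<^sup>2 + y * (2 * B * c\<^sup>2 - k * A * c powr (- k))"
    by (simp add: algebra_simps)
  ultimately show ?thesis unfolding bk b2 using crit by (simp add: mult.assoc)
qed

lemma smallo_of_remainder_tendsto_0:
  fixes h e r :: "nat \<Rightarrow> real"
  assumes "e \<longlonglongrightarrow> 0" "\<And>n. n \<ge> 1 \<Longrightarrow> h n > 0" "\<And>n. n \<ge> 1 \<Longrightarrow> r n = h n * e n"
  shows "r \<in> o(h)"
proof (rule smalloI_tendsto)
  have "\<forall>\<^sub>F n in sequentially. e n = r n / h n"
    using eventually_ge_at_top[of 1]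
  proof eventually_elim
    case (elim n)
    then show ?case using assms(2)[OF elim] assms(3)[OF elim] by simp
  qed
  with assms(1) show "(\<lambda>n. r n / h n) \<longlonglongrightarrow> 0" by (rule Lim_transform_eventually)
  show "\<forall>\<^sub>F n in sequentially. h n \<noteq> 0"
    using eventually_ge_at_top[of 1]
  proof eventually_elim
    case (elim n)
    then show ?case using assms(2)[OF elim] by simp
  qed
qed

lemma leading_MISE_b_opt:
  fixes f :: "real ^ 'd \<Rightarrow> real"
  assumes "int_psi_f f > 0" "int_g_sq f > 0" "n \<ge> 1"
  shows "b_opt f n > 0"
    and "is_arg_min (leading_MISE f n) (\<lambda>b. b > 0) b \<longleftrightarrow> b = b_opt f n"
proof -
  define d where "d = real CARD('d)"
  have d: "d > 0" by (simp add: d_def)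
  define P G where "P = int_psi_f f" and "G = int_g_sq f"
  have PG: "P > 0" "G > 0" using assms by (simp_all add: P_def G_def)
  have n: "real n > 0" using assms(3) by simp
  define c where "c = b_opt f n"
  define A where "A = real n powr (-1) * P"
  have A: "A > 0" using n PG by (simp add: A_def)
  have cdef: "c = real n powr (- 2 / (d + 4)) * (d / 4 * (P / G)) powr (2 / (d + 4))"
    by (simp add: c_def b_opt_def d_def P_def G_def)
  show c0: "b_opt f n > 0"
    using n PG d cdef unfolding c_def by simp
  then have c: "c > 0" by (simp add: c_def)
  have crit: "d / 2 * A * c powr (- (d / 2)) = 2 * G * c\<^sup>2"
  proof -
    have cA: "c = (d / 4 * (A / G)) powr (2 / (d + 4))"
    proof -
      have e: "d / 4 * (A / G) = real n powr (-1) * (d / 4 * (P / G))" by (simp add: A_def)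
      have "(d / 4 * (A / G)) powr (2 / (d + 4))
          = (real n powr (-1)) powr (2 / (d + 4)) * (d / 4 * (P / G)) powr (2 / (d + 4))"
        unfolding e by (rule powr_mult)
      then show ?thesis unfolding cdef powr_powr by simp
    qed
    have "c powr (2 + d / 2) = d / 4 * (A / G)"
    proof -
      have "2 / (d + 4) * (2 + d / 2) = 1" using d by (simp add: field_simps)
      then have "c powr (2 + d / 2) = (d / 4 * (A / G)) powr 1" unfolding cA powr_powr by (simp only:)
      then show ?thesis using d A PG by simp
    qed
    then have "c powr (d / 2) * c\<^sup>2 = d / 4 * (A / G)"
      using c by (simp add: powr_add powr_numeral mult.commute)
    then show ?thesis using c PG by (simp add: powr_minus field_simps)
  qed
  have lead: "leading_MISE f n b = A * b powr (- (d / 2)) + G * b\<^sup>2" for b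
    by (simp add: leading_MISE_def A_def d_def P_def G_def mult_ac)
  have strict: "leading_MISE f n c < leading_MISE f n b" if "b > 0" "b \<noteq> c" for b
    unfolding lead using power_sum_unique_min[OF A PG(2) _ that(1) c crit that(2)] d by simp
  show "is_arg_min (leading_MISE f n) (\<lambda>b. b > 0) b \<longleftrightarrow> b = b_opt f n"
    unfolding c_def[symmetric] is_arg_min_def using strict c by (metis less_asym less_irrefl)
qed

text \<open>
  The value of the rate constant at the optimal ratio of bandwidth to \<open>n powr (- 2 / (d + 4))\<close>. In terms
  of \<open>q = 4 / (d + 4)\<close> both summands have the common factor \<open>(d / 4) powr (q - 1) * P powr q / G powr (q - 1)\<close>.
\<close>

lemma optimal_constant:
  fixes P G d :: real
  assumes "P > 0" "G > 0" "d > 0"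
  defines "l \<equiv> (d / 4 * (P / G)) powr (2 / (d + 4))"
  shows "l powr (- d / 2) * P + l\<^sup>2 * G
    = (1 + d / 4) / (d / 4) powr (d / (d + 4)) * (P powr (4 / (d + 4)) / G powr (- d / (d + 4)))"
proof -
  define q where "q = 4 / (d + 4)"
  have q: "d / (d + 4) = 1 - q" "- d / (d + 4) = q - 1" using assms by (simp_all add: q_def field_simps)
  define k where "k = d / 4"
  have k: "k > 0" using assms by (simp add: k_def)
  have "l powr (- d / 2) = (k * (P / G)) powr (q - 1)"
  proof -
    have "2 / (d + 4) * (- d / 2) = q - 1" using assms by (simp add: q_def field_simps)
    then show ?thesis unfolding l_def powr_powr k_def by simp
  qed
  also have "\<dots> = k powr (q - 1) * P powr (q - 1) / G powr (q - 1)"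
    by (simp add: powr_mult powr_divide)
  finally have 1: "l powr (- d / 2) * P = k powr (q - 1) * P powr q / G powr (q - 1)"
    using assms by (simp add: powr_diff)
  have "l > 0" using assms by (simp add: l_def)
  then have "l\<^sup>2 = l powr 2" by (simp add: powr_numeral)
  also have "\<dots> = (k * (P / G)) powr q" unfolding l_def powr_powr k_def q_def by simp
  also have "\<dots> = k powr (q - 1) * k * P powr q / (G powr (q - 1) * G)"
    using assms k by (simp add: powr_mult powr_divide powr_diff)
  finally have 2: "l\<^sup>2 * G = k powr (q - 1) * k * P powr q / G powr (q - 1)"
    using assms by simp
  have "l powr (- d / 2) * P + l\<^sup>2 * G = (1 + k) * k powr (q - 1) * (P powr q / G powr (q - 1))"
    unfolding 1 2 by (simp add: add_divide_distrib distrib_right distrib_left mult_ac)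
  also have "k powr (q - 1) = 1 / k powr (1 - q)"
    using powr_minus_divide[of k "1 - q"] by simp
  finally show ?thesis unfolding q by (simp add: q_def[symmetric] k_def)
qed

section \<open>The asymptotic expansion\<close>

theorem theorem2:
  fixes M :: "'a measure"
    and X :: "nat \<Rightarrow> 'a \<Rightarrow> real ^ 'd"
    and f :: "real ^ 'd \<Rightarrow> real"
  assumes "prob_space M"
    and "prob_space.indep_vars M (\<lambda>_. borel) X {1..}"
    and "\<And>i. i \<ge> 1 \<Longrightarrow> distributed M lborel (X i) (\<lambda>x. ennreal (f x))"
    and "\<And>x. f x \<ge> 0"
    and "\<And>x. x \<notin> simplex_set \<Longrightarrow> f x = 0"
    and "twice_cont_diff_on_simplex f"
  shows
    "(\<forall>b :: nat \<Rightarrow> real. (\<forall>n\<ge>1. b n > 0) \<and> b \<longlonglongrightarrow> 0 \<longrightarrow>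
        (\<exists>r1 r2. r1 \<in> o(\<lambda>n. real n powr (-1) * b n powr (- real CARD('d) / 2)) \<and>
                 r2 \<in> o(\<lambda>n. (b n)\<^sup>2) \<and>
                 (\<forall>n\<ge>1. MISE M X f n (b n) = leading_MISE f n (b n) + r1 n + r2 n)))
     \<and>
     (int_g_sq f > 0 \<longrightarrow>
        (\<forall>n\<ge>1. \<forall>b. is_arg_min (leading_MISE f n) (\<lambda>b. b > 0) b \<longleftrightarrow> b = b_opt f n) \<and>
        (\<lambda>n. MISE M X f n (b_opt f n)
              - real n powr (- 4 / (real CARD('d) + 4))
                * ((1 + real CARD('d) / 4)
                     / (real CARD('d) / 4) powr (real CARD('d) / (real CARD('d) + 4)))
                * (int_psi_f f powr (4 / (real CARD('d) + 4))
                     / int_g_sq f powr (- real CARD('d) / (real CARD('d) + 4))))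
          \<in> o(\<lambda>n. real n powr (- 4 / (real CARD('d) + 4))))
     \<and>
     (\<forall>(b :: nat \<Rightarrow> real) l. (\<forall>n\<ge>1. b n > 0) \<and> l > 0 \<and>
        (\<lambda>n. real n powr (2 / (real CARD('d) + 4)) * b n) \<longlonglongrightarrow> l \<longrightarrow>
        (\<lambda>n. MISE M X f n (b n)
              - real n powr (- 4 / (real CARD('d) + 4))
                * (l powr (- real CARD('d) / 2) * int_psi_f f + l\<^sup>2 * int_g_sq f))
          \<in> o(\<lambda>n. real n powr (- 4 / (real CARD('d) + 4))))"
proof -
  let ?d = "real CARD('d)"
  let ?P = "int_psi_f f" and ?G = "int_g_sq f"
  have nn: "\<And>x. f x \<ge> 0" and f: "twice_cont_diff_on_simplex f" by fact+
  note dens = assms(3)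
  have fm: "f \<in> borel_measurable borel"
    using distributed_real_measurable[OF nn dens[of 1]] by simp
  have P: "?P > 0"
    by (rule int_psi_f_pos[OF assms(1) dens[of 1] nn assms(5) f fm]) simp_all
  define V where "V b = b powr (?d / 2) * (int_sq_factor f b - int_smooth_sq f b)" for b
  define Q where "Q b = int_bias_sq f b / b\<^sup>2" for b
  have V: "(V \<longlongrightarrow> ?P) (at_right 0)"
    unfolding V_def[abs_def] by (rule variance_part_tendsto[OF f fm])
  have Q: "(Q \<longlongrightarrow> ?G) (at_right 0)"
    unfolding Q_def[abs_def] by (rule int_bias_sq_tendsto[OF f fm])
  have dec: "MISE M X f n b = real n powr (-1) * b powr (- ?d / 2) * V b + b\<^sup>2 * Q b"
    if "n \<ge> 1" "b > 0" for n b
  proof -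
    have "b powr (- ?d / 2) * b powr (?d / 2) = b powr (- ?d / 2 + ?d / 2)"
      by (rule powr_add[symmetric])
    also have "\<dots> = 1" using that by simp
    finally have cancel: "b powr (- ?d / 2) * b powr (?d / 2) = 1" .
    have "real n powr (-1) * b powr (- ?d / 2) * V b
        = real n powr (-1) * (b powr (- ?d / 2) * b powr (?d / 2)) * (int_sq_factor f b - int_smooth_sq f b)"
      unfolding V_def by (simp only: mult.assoc)
    also have "\<dots> = 1 / real n * (int_sq_factor f b - int_smooth_sq f b)"
      unfolding cancel using powr_minus_divide[of "real n" 1] by simp
    finally have "real n powr (-1) * b powr (- ?d / 2) * V b = 1 / real n * (int_sq_factor f b - int_smooth_sq f b)" .
    moreover have "b\<^sup>2 * Q b = int_bias_sq f b" using that by (simp add: Q_def)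
    ultimately show ?thesis
      using MISE_decomposition[OF assms(1,2) dens nn f fm that] by (simp only:)
  qed
  have right0: "filterlim b (at_right 0) sequentially" if "\<forall>n\<ge>1. b n > 0" "b \<longlonglongrightarrow> 0" for b :: "nat \<Rightarrow> real"
    using that(2)
  proof (rule tendsto_imp_filterlim_at_right)
    show "\<forall>\<^sub>F n in sequentially. 0 < b n"
      using eventually_ge_at_top[of 1] by eventually_elim (use that(1) in simp)
  qed

  have expansion: "\<exists>r1 r2. r1 \<in> o(\<lambda>n. real n powr (-1) * b n powr (- ?d / 2)) \<and> r2 \<in> o(\<lambda>n. (b n)\<^sup>2) \<and>
      (\<forall>n\<ge>1. MISE M X f n (b n) = leading_MISE f n (b n) + r1 n + r2 n)"
    if b: "\<forall>n\<ge>1. b n > 0" "b \<longlonglongrightarrow> 0" for b :: "nat \<Rightarrow> real"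
  proof (intro exI conjI)
    note r0 = right0[OF b]
    have V0: "(\<lambda>n. V (b n) - ?P) \<longlonglongrightarrow> 0" and Q0: "(\<lambda>n. Q (b n) - ?G) \<longlonglongrightarrow> 0"
      by (intro LIM_zero filterlim_compose[OF V r0], intro LIM_zero filterlim_compose[OF Q r0])
    show "(\<lambda>n. (real n powr (-1) * b n powr (- ?d / 2)) * (V (b n) - ?P)) \<in> o(\<lambda>n. real n powr (-1) * b n powr (- ?d / 2))"
      by (rule smallo_of_remainder_tendsto_0[OF V0]) (use b in \<open>auto\<close>)
    show "(\<lambda>n. (b n)\<^sup>2 * (Q (b n) - ?G)) \<in> o(\<lambda>n. (b n)\<^sup>2)"
      by (rule smallo_of_remainder_tendsto_0[OF Q0]) (use b in \<open>auto\<close>)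
    show "\<forall>n\<ge>1. MISE M X f n (b n) = leading_MISE f n (b n)
        + (real n powr (-1) * b n powr (- ?d / 2)) * (V (b n) - ?P) + (b n)\<^sup>2 * (Q (b n) - ?G)"
    proof (intro allI impI)
      fix n :: nat assume n: "n \<ge> 1"
      have "x * v + y * q = (x * p + y * g) + x * (v - p) + y * (q - g)" for x y v q p g :: real
        by (simp add: algebra_simps)
      then show "MISE M X f n (b n) = leading_MISE f n (b n)
          + (real n powr (-1) * b n powr (- ?d / 2)) * (V (b n) - ?P) + (b n)\<^sup>2 * (Q (b n) - ?G)"
        unfolding dec[OF n b(1)[rule_format, OF n]] leading_MISE_def .
    qed
  qed

  \<comment> \<open>With \<open>b n = c n * n powr (- 2 / (d + 4))\<close> both parts scale exactly like \<open>n powr (- 4 / (d + 4))\<close>.\<close>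
  have rate: "(\<lambda>n. MISE M X f n (b n) - real n powr (- 4 / (?d + 4)) * (l powr (- ?d / 2) * ?P + l\<^sup>2 * ?G))
      \<in> o(\<lambda>n. real n powr (- 4 / (?d + 4)))"
    if b: "\<forall>n\<ge>1. b n > 0" and l: "l > 0" and lim: "(\<lambda>n. real n powr (2 / (?d + 4)) * b n) \<longlonglongrightarrow> l"
    for b :: "nat \<Rightarrow> real" and l
  proof -
    define c where "c n = real n powr (2 / (?d + 4)) * b n" for n
    have c: "c \<longlonglongrightarrow> l" using lim by (simp add: c_def[abs_def])
    have bc: "b n = real n powr (- 2 / (?d + 4)) * c n" if "n \<ge> 1" for n
      using that by (simp add: c_def mult.assoc[symmetric] powr_add[symmetric])
    have "(\<lambda>n. real n powr (- 2 / (?d + 4))) \<longlonglongrightarrow> 0"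
      by (intro tendsto_neg_powr filterlim_real_sequentially) (simp add: divide_neg_pos)
    from tendsto_mult[OF this c] have "(\<lambda>n. real n powr (- 2 / (?d + 4)) * c n) \<longlonglongrightarrow> 0" by simp
    then have b0: "b \<longlonglongrightarrow> 0"
      by (rule Lim_transform_eventually) (auto simp: eventually_sequentially bc intro!: exI[of _ 1])
    note r0 = right0[OF b b0]
    have "(\<lambda>n. c n powr (- ?d / 2) * V (b n) + (c n)\<^sup>2 * Q (b n)) \<longlonglongrightarrow> l powr (- ?d / 2) * ?P + l\<^sup>2 * ?G"
      using l by (intro tendsto_add tendsto_mult tendsto_powr tendsto_power tendsto_const c
          filterlim_compose[OF V r0] filterlim_compose[OF Q r0]) auto
    then have e0: "(\<lambda>n. (c n powr (- ?d / 2) * V (b n) + (c n)\<^sup>2 * Q (b n)) - (l powr (- ?d / 2) * ?P + l\<^sup>2 * ?G)) \<longlonglongrightarrow> 0"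
      by (rule LIM_zero)
    show ?thesis
    proof (rule smallo_of_remainder_tendsto_0[OF e0])
      fix n :: nat assume n: "n \<ge> 1"
      then show "0 < real n powr (- 4 / (?d + 4))" by simp
      have 1: "real n powr (-1) * b n powr (- ?d / 2) = real n powr (- 4 / (?d + 4)) * c n powr (- ?d / 2)"
      proof -
        have "- 1 + - 2 / (?d + 4) * (- ?d / 2) = - 4 / (?d + 4)" by (simp add: field_simps)
        then show ?thesis
          unfolding bc[OF n] powr_mult powr_powr mult.assoc[symmetric] powr_add[symmetric] by simp
      qed
      have 2: "(b n)\<^sup>2 = real n powr (- 4 / (?d + 4)) * (c n)\<^sup>2"
        using n by (simp add: bc[OF n] power_mult_distrib powr_power)
      show "MISE M X f n (b n) - real n powr (- 4 / (?d + 4)) * (l powr (- ?d / 2) * ?P + l\<^sup>2 * ?G)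
        = real n powr (- 4 / (?d + 4)) * ((c n powr (- ?d / 2) * V (b n) + (c n)\<^sup>2 * Q (b n)) - (l powr (- ?d / 2) * ?P + l\<^sup>2 * ?G))"
        unfolding dec[OF n b[rule_format, OF n]] 1 2 by (simp only: right_diff_distrib distrib_left mult.assoc)
    qed
  qed

  \<comment> \<open>Here \<open>n powr (2 / (d + 4)) * b_opt f n\<close> is constant, so this is the case \<open>l = ?l\<close> of the previous statement.\<close>
  have optimal: "(\<lambda>n. MISE M X f n (b_opt f n)
              - real n powr (- 4 / (?d + 4)) * ((1 + ?d / 4) / (?d / 4) powr (?d / (?d + 4)))
                * (?P powr (4 / (?d + 4)) / ?G powr (- ?d / (?d + 4))))
          \<in> o(\<lambda>n. real n powr (- 4 / (?d + 4)))" if G: "?G > 0"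
  proof -
    let ?l = "(?d / 4 * (?P / ?G)) powr (2 / (?d + 4))"
    have d: "?d > 0" by simp
    have l: "?l > 0" using P G by simp
    have "(\<lambda>n. real n powr (2 / (?d + 4)) * b_opt f n) \<longlonglongrightarrow> ?l"
    proof (rule tendsto_eventually)
      show "\<forall>\<^sub>F n in sequentially. real n powr (2 / (?d + 4)) * b_opt f n = ?l"
        using eventually_ge_at_top[of 1]
        by eventually_elim (simp add: b_opt_def mult.assoc[symmetric] powr_add[symmetric])
    qed
    moreover have "\<forall>n\<ge>1. b_opt f n > 0"
      using leading_MISE_b_opt(1)[OF P G] by simp
    ultimately have "(\<lambda>n. MISE M X f n (b_opt f n) - real n powr (- 4 / (?d + 4)) * (?l powr (- ?d / 2) * ?P + ?l\<^sup>2 * ?G))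
        \<in> o(\<lambda>n. real n powr (- 4 / (?d + 4)))"
      using l by (intro rate)
    then show ?thesis
      unfolding optimal_constant[OF P G d] by (simp only: mult.assoc)
  qed
  show ?thesis
  proof (intro conjI allI impI, goal_cases)
    case (1 b)
    then show ?case by (intro expansion) auto
  next
    case (2 n b)
    then show ?case by (intro leading_MISE_b_opt(2)[OF P])
  next
    case 3
    then show ?case by (rule optimal)
  next
    case (4 b l)
    then show ?case by (intro rate) auto
  qed
qed

end
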